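(* Let $f:\mathbb{R}^d\to\mathbb{R}$ be a $q$-times differentiable convex function with a minimizer at $x^\ast$ whose $q$-th derivative is $(L,\nu)$-H\"older continuous with respect to $\|\cdot\|_p$, where $p\in(1,\infty)$, $q\ge1$ is an integer, $\nu\in(0,1]$ and $L>0$. By making use of Algorithm A or its generalization Algorithm B (both described in the context), initialized at $x_0$, and defining $R_p=\|x^\ast-x_0\|_p$ and $m=\max\{2,p\}$, one obtains a point $y_T$ after $T$ iterations satisfying $$f(y_T)-f(x^\ast)=O_{q+\nu,p}\!\left(L\,R_p^{\,q+\nu}\,T^{-\frac{(m+1)(q+\nu)-m}{m}}\right).$$ Each iteration of the algorithm makes $1$ query to a $q$-th order oracle of $f$.
   Context: $O_{q+\nu,p}(\cdot)$ is big-$O$ notation omitting factors depending on $q+\nu$ and $p$. The $q$-th derivative of $f$ is $(L,\nu)$-H\"older continuous with respect to a norm $\|\cdot\|$ if $\|\nabla^qf(x)-\nabla^qf(y)\|_\ast\le L\|x-y\|^\nu$ for all $x,y$, where for a $q$-linear form $F$, $\|F\|_\ast=\max_{\|v\|\le1}|F[v]^{\otimes q}|$. A $q$-th order oracle for $f$, queried at $x$, returns $(f(x),\nabla f(x),\dots,\nabla^qf(x))$. Notation: $\|\cdot\|_\ast$ applied to vectors is the dual norm; $r_\ast=(1-1/r)^{-1}$; $D_\psi(x,y)=\psi(x)-\psi(y)-\langle\nabla\psi(y),x-y\rangle$; for $\gamma\ge0$, $\partial^\gamma f(y)=\{g: f(z)\ge f(y)+\langle g,z-y\rangle-\gamma\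 \forall z\}$; $\partial(-\phi)$ for convex $\phi$ means $-\partial\phi$. A differentiable function $\psi$ is $\delta$-inexact $(\mu,r)$-uniformly convex with respect to $\|\cdot\|$ if $D_\psi(x,y)\ge\frac{\mu}{r}\|x-y\|^r-\delta$ for all $x,y$; it is $(\mu,r)$-uniformly convex if this holds with $\delta=0$ (and $r\ge2$). Inexact proximal oracle $(y_k,v_k)\leftarrow\mathcal{O}_r(x_k,\lambda_k)$, with constants $\sigma,\sigma'\in[0,1/2)$: returns a point $y_k$ and $v_k\in\partial^{\varepsilon_k}f(y_k)$ with $\|v_k-\hat v_k\|_\ast\le\frac{\sigma}{\lambda_k}\|x_k-y_k\|^{r-1}$ for some $\hat v_k\in\partial_y(-\frac1{r\lambda_k}\|y-x_k\|^r)(y_k)$, and $\varepsilon_k\le\frac{\sigma'}{\lambda_k}\|x_k-y_k\|^r$. Generalized inexact proximal oracle $(\tilde y_k,v_k,\lambda_k)\leftarrow\widehat{\mathcal{O}}_r(x_k,\widehat\lambda_k)$: returns a proximal parameter $\lambda_k$ as well, possibly using $\widehat\lambda_k$, a point $\tilde y_k$ and $v_k\in\partial^{\varepsilon_k}f(\tilde y_k)$ satisfying the same two conditions with $\tilde y_k$ in place of $y_k$. Algorithm A. Inputs: convex $f$; a regularizer $\psi$ that is $\delta$-inexact $(\mu,r)$-uniformly convex with respect to a norm $\|\cdot\|$, $r>1$; constants $\sigma,\sigma'$; proximal parameters $\lambda_k>0$. Set $z_0=y_0=x_0$, $A_0=0$, $C=\frac\mu2\Big(\frac{r_\ast(1-\sigma-\sigma')}{1+\sigma^{r_\ast}}\Big)^{r-1}$.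 For $k=1,\dots,T$: let $a_k>0$ and $A_k=a_k+A_{k-1}$ solve $a_k=(CA_k^{r-1}\lambda_k)^{1/r}$; $x_k=\frac{A_{k-1}}{A_k}y_{k-1}+\frac{a_k}{A_k}z_{k-1}$; $(y_k,v_k)\leftarrow\mathcal{O}_r(x_k,\lambda_k)$; $z_k=\arg\min_z\{\sum_{i=1}^ka_i\langle v_i,z\rangle+D_\psi(z,x_0)\}$. Return $y_T$. Algorithm B. Inputs: convex $f$; a regularizer $\psi$ that is $(1,r)$-uniformly convex with respect to a norm $\|\cdot\|$; an initial $\widehat\lambda_0$; a factor $\alpha>1$; constants $\sigma,\sigma'$. Set $z_0=y_0=x_0$, $A_0=0$, $C=\frac12\Big(\frac{r_\ast(1-\sigma-\sigma')}{1+\sigma^{r_\ast}}\Big)^{r-1}$; $(\tilde y_1,v_1,\lambda_1)\leftarrow\widehat{\mathcal{O}}_r(x_0,\widehat\lambda_0)$; $\widehat\lambda_1=\lambda_1$. For $k=1,\dots,T$: let $\widehat a_k>0$ and $\widehat A_k=\widehat a_k+A_{k-1}$ solve $\widehat a_k=(C\widehat A_k^{r-1}\widehat\lambda_k)^{1/r}$; $x_k=\frac{A_{k-1}}{\widehat A_k}y_{k-1}+\frac{\widehat a_k}{\widehat A_k}z_{k-1}$; if $k>1$, $(\tilde y_k,v_k,\lambda_k)\leftarrow\widehat{\mathcal{O}}_r(x_k,\widehat\lambda_k)$; $\gamma_k=\min\{\lambda_k/\widehat\lambda_k,1\}$, $a_k=\gamma_k\widehat a_k$, $A_k=a_k+A_{k-1}$;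 $y_k$ is a point of $\{\tilde y_k,y_{k-1}\}$ with smallest $f$-value (or $y_k=\frac{(1-\gamma_k)A_{k-1}}{A_k}y_{k-1}+\frac{\gamma_k\widehat A_k}{A_k}\tilde y_k$); $z_k=\arg\min_z\{\sum_{i=1}^ka_i\langle v_i,z\rangle+D_\psi(z,x_0)\}$; $\widehat\lambda_{k+1}=\alpha\widehat\lambda_k$ if $\widehat\lambda_k\le\lambda_k$, else $\widehat\lambda_{k+1}=\alpha^{-1}\widehat\lambda_k$. Return $y_T$. *)

theory Defs
  imports "HOL-Analysis.Analysis" "HOL-Library.Function_Algebras"
begin

section \<open>Points of $d$-dimensional space with explicit dimension\<close>

text \<open>
  The constants hidden in the $O$-notation must not depend on the dimension, so the dimension has
  to be an ordinary variable below an existential quantifier. Points are therefore functions on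
  the natural numbers that vanish from index \<open>d\<close> on, which is the carrier of the library
  topology \<^const>\<open>Euclidean_space\<close>. Functions into a real vector space get their
  pointwise vector space structure.
\<close>

type_synonym pt = "nat \<Rightarrow> real"

instantiation "fun" :: (type, real_vector) real_vector
begin

definition scaleR_fun :: "real \<Rightarrow> ('a \<Rightarrow> 'b) \<Rightarrow> 'a \<Rightarrow> 'b"
  where "scaleR_fun c x = (\<lambda>i. c *\<^sub>R x i)"

instance
  by standard (auto simp: scaleR_fun_def fun_eq_iff scaleR_add_right scaleR_add_left)

end

abbreviation Rd :: "nat \<Rightarrow> pt set"
  where "Rd d \<equiv> topspace (Euclidean_space d)"

definition dotp :: "nat \<Rightarrow> pt \<Rightarrow> pt \<Rightarrow> real"
  where "dotp d g x = (\<Sum>i<d. g i * x i)"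

definition pnorm :: "nat \<Rightarrow> real \<Rightarrow> pt \<Rightarrow> real"
  where "pnorm d p x = (\<Sum>i<d. \<bar>x i\<bar> powr p) powr (1 / p)"

definition dual_norm :: "nat \<Rightarrow> (pt \<Rightarrow> real) \<Rightarrow> pt \<Rightarrow> real"
  where "dual_norm d N g = Sup {dotp d g v | v. v \<in> Rd d \<and> N v \<le> 1}"

section \<open>Higher derivatives\<close>

text \<open>\<open>Dn f [v1, \<dots>, vk] x\<close> is the value of the \<open>k\<close>-linear form $\nabla^k f(x)$ at $(v_1,\dots,v_k)$,
  computed by iterated directional derivatives.\<close>

primrec Dn :: "(pt \<Rightarrow> real) \<Rightarrow> pt list \<Rightarrow> pt \<Rightarrow> real"
where
  "Dn f [] x = f x"
| "Dn f (v # vs) x = deriv (\<lambda>t. Dn f vs (x + t *\<^sub>R v)) 0"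

text \<open>Frechet differentiability on the \<open>d\<close>-dimensional space. The choice of the Euclidean norm
  is immaterial, as all norms are equivalent there.\<close>

definition frechet_at :: "nat \<Rightarrow> (pt \<Rightarrow> real) \<Rightarrow> (pt \<Rightarrow> real) \<Rightarrow> pt \<Rightarrow> bool"
  where "frechet_at d F F' x \<longleftrightarrow>
    (\<forall>u\<in>Rd d. \<forall>w\<in>Rd d. \<forall>a b. F' (a *\<^sub>R u + b *\<^sub>R w) = a * F' u + b * F' w) \<and>
    (\<forall>e>0. \<exists>\<delta>>0. \<forall>h\<in>Rd d. L2_set h {..<d} < \<delta> \<longrightarrow>
       \<bar>F (x + h) - F x - F' h\<bar> \<le> e * L2_set h {..<d})"

text \<open>\<open>q\<close>-fold Frechet differentiability. As the space of \<open>k\<close>-linear forms is finite-dimensional,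
  $\nabla^k f$ is differentiable iff all its evaluations at fixed vectors are.\<close>

definition times_differentiable :: "nat \<Rightarrow> nat \<Rightarrow> (pt \<Rightarrow> real) \<Rightarrow> bool"
  where "times_differentiable d q f \<longleftrightarrow>
    (\<forall>vs x. length vs < q \<longrightarrow> set vs \<subseteq> Rd d \<longrightarrow> x \<in> Rd d \<longrightarrow>
       frechet_at d (Dn f vs) (\<lambda>h. Dn f (h # vs) x) x)"

definition grad :: "nat \<Rightarrow> (pt \<Rightarrow> real) \<Rightarrow> pt \<Rightarrow> pt"
  where "grad d f x = (\<lambda>i. if i < d then Dn f [\<lambda>j. if j = i then 1 else 0] x else 0)"

text \<open>The norm $\|F\|_*=\max_{\|v\|\le 1}|F[v]^{\otimes q}|$ of a \<open>q\<close>-linear form.\<close>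

definition form_norm :: "nat \<Rightarrow> (pt \<Rightarrow> real) \<Rightarrow> nat \<Rightarrow> (pt list \<Rightarrow> real) \<Rightarrow> real"
  where "form_norm d N q F = Sup {\<bar>F (replicate q v)\<bar> | v. v \<in> Rd d \<and> N v \<le> 1}"

definition holder_deriv :: "nat \<Rightarrow> (pt \<Rightarrow> real) \<Rightarrow> nat \<Rightarrow> real \<Rightarrow> real \<Rightarrow> (pt \<Rightarrow> real) \<Rightarrow> bool"
  where "holder_deriv d N q L \<nu> f \<longleftrightarrow>
    (\<forall>x\<in>Rd d. \<forall>y\<in>Rd d.
       form_norm d N q (\<lambda>vs. Dn f vs x - Dn f vs y) \<le> L * N (x - y) powr \<nu>)"

text \<open>The answer $(f(x),\nabla f(x),\dots,\nabla^q f(x))$ of a \<open>q\<close>-th order oracle as one function: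
  on lists of length \<open>k \<le> q\<close> it is the \<open>k\<close>-linear form $\nabla^k f(x)$, so it carries no further
  information on \<open>f\<close>.\<close>

definition order_oracle :: "nat \<Rightarrow> (pt \<Rightarrow> real) \<Rightarrow> nat \<Rightarrow> pt \<Rightarrow> pt list \<Rightarrow> real"
  where "order_oracle d f q x =
    (\<lambda>vs. if length vs \<le> q \<and> set vs \<subseteq> Rd d then Dn f vs x else 0)"

section \<open>Regularizers and inexact proximal oracles\<close>

definition bregman :: "nat \<Rightarrow> (pt \<Rightarrow> real) \<Rightarrow> pt \<Rightarrow> pt \<Rightarrow> real"
  where "bregman d \<psi> x y = \<psi> x - \<psi> y - dotp d (grad d \<psi> y) (x - y)"

definition inexact_uniformly_convex ::
    "nat \<Rightarrow> (pt \<Rightarrow> real) \<Rightarrow> real \<Rightarrow> real \<Rightarrow> real \<Rightarrow> (pt \<Rightarrow> real) \<Rightarrow> bool"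
  where "inexact_uniformly_convex d N \<delta> \<mu> r \<psi> \<longleftrightarrow>
    times_differentiable d 1 \<psi> \<and>
    (\<forall>x\<in>Rd d. \<forall>y\<in>Rd d. bregman d \<psi> x y \<ge> \<mu> / r * N (x - y) powr r - \<delta>)"

definition uniformly_convex :: "nat \<Rightarrow> (pt \<Rightarrow> real) \<Rightarrow> real \<Rightarrow> real \<Rightarrow> (pt \<Rightarrow> real) \<Rightarrow> bool"
  where "uniformly_convex d N \<mu> r \<psi> \<longleftrightarrow> r \<ge> 2 \<and> inexact_uniformly_convex d N 0 \<mu> r \<psi>"

definition eps_subdiff :: "nat \<Rightarrow> (pt \<Rightarrow> real) \<Rightarrow> real \<Rightarrow> pt \<Rightarrow> pt set"
  where "eps_subdiff d f \<gamma> y =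
    {g \<in> Rd d. \<forall>z\<in>Rd d. f z \<ge> f y + dotp d g (z - y) - \<gamma>}"

text \<open>\<open>(y, v)\<close> is an admissible answer of the inexact proximal oracle at \<open>x\<close> with proximal
  parameter \<open>lam\<close>.\<close>

definition prox_answer :: "nat \<Rightarrow> (pt \<Rightarrow> real) \<Rightarrow> (pt \<Rightarrow> real) \<Rightarrow> real \<Rightarrow> real \<Rightarrow> real \<Rightarrow>
    pt \<Rightarrow> real \<Rightarrow> pt \<Rightarrow> pt \<Rightarrow> bool"
  where "prox_answer d N f r \<sigma> \<sigma>' x lam y v \<longleftrightarrow> y \<in> Rd d \<and>
    (\<exists>\<epsilon>\<ge>0. \<exists>w \<in> uminus ` eps_subdiff d (\<lambda>u. 1 / (r * lam) * N (u - x) powr r) 0 y.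
       v \<in> eps_subdiff d f \<epsilon> y \<and>
       dual_norm d N (v - w) \<le> \<sigma> / lam * N (x - y) powr (r - 1) \<and>
       \<epsilon> \<le> \<sigma>' / lam * N (x - y) powr r)"

definition step_const :: "real \<Rightarrow> real \<Rightarrow> real \<Rightarrow> real \<Rightarrow> real"
  where "step_const \<mu> r \<sigma> \<sigma>' =
    (let rs = inverse (1 - 1 / r)
     in \<mu> / 2 * (rs * (1 - \<sigma> - \<sigma>') / (1 + \<sigma> powr rs)) powr (r - 1))"

definition mirror_step ::
    "nat \<Rightarrow> (pt \<Rightarrow> real) \<Rightarrow> pt \<Rightarrow> (nat \<Rightarrow> real) \<Rightarrow> (nat \<Rightarrow> pt) \<Rightarrow> nat \<Rightarrow> pt \<Rightarrow> bool"
  where "mirror_step d \<psi> x0 a v k z \<longleftrightarrow>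
    is_arg_min (\<lambda>z. (\<Sum>i=1..k. a i * dotp d (v i) z) + bregman d \<psi> z x0) (\<lambda>z. z \<in> Rd d) z"

section \<open>The two algorithms\<close>

text \<open>
  The proximal oracle is an argument \<open>Orc\<close> of the algorithms; in every iteration that calls it,
  its answer has to be admissible. \<open>algorithm_A \<dots> y\<close> says that \<open>y 0, \<dots>, y T\<close> are
  iterates of a run.
\<close>

definition algorithm_A :: "nat \<Rightarrow> (pt \<Rightarrow> real) \<Rightarrow> (pt \<Rightarrow> real) \<Rightarrow> (pt \<Rightarrow> real) \<Rightarrow> real \<Rightarrow> real \<Rightarrow>
    real \<Rightarrow> real \<Rightarrow> (nat \<Rightarrow> real) \<Rightarrow> (pt \<Rightarrow> real \<Rightarrow> pt \<times> pt) \<Rightarrow> pt \<Rightarrow> nat \<Rightarrow> (nat \<Rightarrow> pt) \<Rightarrow> bool"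
  where "algorithm_A d N f \<psi> \<mu> r \<sigma> \<sigma>' lam Orc x0 T y \<longleftrightarrow>
    (\<exists>x z v a A.
       z 0 = x0 \<and> y 0 = x0 \<and> A 0 = 0 \<and>
       (\<forall>k\<in>{1..T}.
          a k > 0 \<and> A k = a k + A (k - 1) \<and>
          a k = (step_const \<mu> r \<sigma> \<sigma>' * A k powr (r - 1) * lam k) powr (1 / r) \<and>
          x k = (A (k - 1) / A k) *\<^sub>R y (k - 1) + (a k / A k) *\<^sub>R z (k - 1) \<and>
          (y k, v k) = Orc (x k) (lam k) \<and>
          prox_answer d N f r \<sigma> \<sigma>' (x k) (lam k) (y k) (v k) \<and>
          mirror_step d \<psi> x0 a v k (z k)))"

definition admissible_A :: "nat \<Rightarrow> (pt \<Rightarrow> real) \<Rightarrow> (pt \<Rightarrow> real) \<Rightarrow> real \<Rightarrow> real \<Rightarrow> real \<Rightarrow>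
    real \<Rightarrow> real \<Rightarrow> (nat \<Rightarrow> real) \<Rightarrow> bool"
  where "admissible_A d N \<psi> \<delta> \<mu> r \<sigma> \<sigma>' lam \<longleftrightarrow>
    1 < r \<and> 0 < \<mu> \<and> 0 \<le> \<delta> \<and> inexact_uniformly_convex d N \<delta> \<mu> r \<psi> \<and>
    \<sigma> \<in> {0..<1/2} \<and> \<sigma>' \<in> {0..<1/2} \<and> (\<forall>k. lam k > 0)"

text \<open>Here \<open>lamh\<close>, \<open>ah\<close>, \<open>Ah\<close>, \<open>yt\<close> are the hatted quantities $\widehat\lambda$,
  $\widehat a$, $\widehat A$ and $\tilde y$. The oracle returns \<open>(yt, v, lam)\<close>; for \<open>k = 1\<close> it is
  called at \<open>x0\<close> with \<open>lamh0\<close>.\<close>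

definition algorithm_B :: "nat \<Rightarrow> (pt \<Rightarrow> real) \<Rightarrow> (pt \<Rightarrow> real) \<Rightarrow> (pt \<Rightarrow> real) \<Rightarrow> real \<Rightarrow>
    real \<Rightarrow> real \<Rightarrow> real \<Rightarrow> real \<Rightarrow> (pt \<Rightarrow> real \<Rightarrow> pt \<times> pt \<times> real) \<Rightarrow> pt \<Rightarrow> nat \<Rightarrow> (nat \<Rightarrow> pt) \<Rightarrow> bool"
  where "algorithm_B d N f \<psi> r \<sigma> \<sigma>' \<alpha> lamh0 Orc x0 T y \<longleftrightarrow>
    (\<exists>x yt z v lam lamh ah Ah a A \<gamma>.
       z 0 = x0 \<and> y 0 = x0 \<and> A 0 = 0 \<and> lamh 0 = lamh0 \<and>
       (yt 1, v 1, lam 1) = Orc x0 (lamh 0) \<and>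
       0 < lam 1 \<and> prox_answer d N f r \<sigma> \<sigma>' x0 (lam 1) (yt 1) (v 1) \<and>
       lamh 1 = lam 1 \<and>
       (\<forall>k\<in>{1..T}.
          ah k > 0 \<and> Ah k = ah k + A (k - 1) \<and>
          ah k = (step_const 1 r \<sigma> \<sigma>' * Ah k powr (r - 1) * lamh k) powr (1 / r) \<and>
          x k = (A (k - 1) / Ah k) *\<^sub>R y (k - 1) + (ah k / Ah k) *\<^sub>R z (k - 1) \<and>
          (k > 1 \<longrightarrow>
             (yt k, v k, lam k) = Orc (x k) (lamh k) \<and>
             0 < lam k \<and> prox_answer d N f r \<sigma> \<sigma>' (x k) (lam k) (yt k) (v k)) \<and>
          \<gamma> k = min (lam k / lamh k) 1 \<and>
          a k = \<gamma> k * ah k \<and> A k = a k + A (k - 1) \<and>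
          (is_arg_min f (\<lambda>u. u \<in> {yt k, y (k - 1)}) (y k) \<or>
           y k = ((1 - \<gamma> k) * A (k - 1) / A k) *\<^sub>R y (k - 1) + (\<gamma> k * Ah k / A k) *\<^sub>R yt k) \<and>
          mirror_step d \<psi> x0 a v k (z k) \<and>
          lamh (k + 1) = (if lamh k \<le> lam k then \<alpha> * lamh k else inverse \<alpha> * lamh k)))"

definition admissible_B :: "nat \<Rightarrow> (pt \<Rightarrow> real) \<Rightarrow> (pt \<Rightarrow> real) \<Rightarrow> real \<Rightarrow> real \<Rightarrow> real \<Rightarrow>
    real \<Rightarrow> real \<Rightarrow> bool"
  where "admissible_B d N \<psi> r \<sigma> \<sigma>' \<alpha> lamh0 \<longleftrightarrow>
    uniformly_convex d N 1 r \<psi> \<and> \<sigma> \<in> {0..<1/2} \<and> \<sigma>' \<in> {0..<1/2} \<and> 1 < \<alpha> \<and> 0 < lamh0"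

section \<open>Proximal oracles implemented with one query\<close>

text \<open>
  A call of the proximal oracle makes one query to the \<open>q\<close>-th order oracle, at the given point
  \<open>x\<close>. The map \<open>Y\<close> computes the new point (and, for the generalized oracle, the proximal
  parameter) from this answer alone. The map \<open>V\<close> computes the \<open>\<epsilon>\<close>-subgradient of \<open>f\<close> at the new
  point \<open>y\<close>. It sees the same answer and in addition the value of \<open>f\<close> and, if \<open>q \<ge> 2\<close>, the
  gradient of \<open>f\<close> at \<open>y\<close>: this is information of order \<open>min 1 (q - 1) < q\<close>, hence not another
  query of order \<open>q\<close>. The maps \<open>Y\<close> and \<open>V\<close> have no other access to \<open>f\<close>.
\<close>

definition one_query_prox :: "nat \<Rightarrow> (pt \<Rightarrow> real) \<Rightarrow> nat \<Rightarrow>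
    (pt \<Rightarrow> real \<Rightarrow> (pt list \<Rightarrow> real) \<Rightarrow> pt) \<Rightarrow>
    (pt \<Rightarrow> real \<Rightarrow> (pt list \<Rightarrow> real) \<Rightarrow> (pt list \<Rightarrow> real) \<Rightarrow> pt) \<Rightarrow>
    pt \<Rightarrow> real \<Rightarrow> pt \<times> pt"
  where "one_query_prox d f q Y V x lam =
    (let ans = order_oracle d f q x; y = Y x lam ans
     in (y, V x lam ans (order_oracle d f (min 1 (q - 1)) y)))"

definition one_query_gen_prox :: "nat \<Rightarrow> (pt \<Rightarrow> real) \<Rightarrow> nat \<Rightarrow>
    (pt \<Rightarrow> real \<Rightarrow> (pt list \<Rightarrow> real) \<Rightarrow> pt \<times> real) \<Rightarrow>
    (pt \<Rightarrow> real \<Rightarrow> (pt list \<Rightarrow> real) \<Rightarrow> (pt list \<Rightarrow> real) \<Rightarrow> pt) \<Rightarrow>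
    pt \<Rightarrow> real \<Rightarrow> pt \<times> pt \<times> real"
  where "one_query_gen_prox d f q Y V x lamh =
    (let ans = order_oracle d f q x; (y, lam) = Y x lamh ans
     in (y, V x lamh ans (order_oracle d f (min 1 (q - 1)) y), lam))"

section \<open>The problem class\<close>

definition smooth_convex_problem ::
    "nat \<Rightarrow> real \<Rightarrow> nat \<Rightarrow> real \<Rightarrow> real \<Rightarrow> (pt \<Rightarrow> real) \<Rightarrow> pt \<Rightarrow> bool"
  where "smooth_convex_problem d p q \<nu> L f xstar \<longleftrightarrow>
    times_differentiable d q f \<and> convex_on (Rd d) f \<and>
    holder_deriv d (pnorm d p) q L \<nu> f \<and>
    is_arg_min f (\<lambda>x. x \<in> Rd d) xstar"

definition rate :: "real \<Rightarrow> real \<Rightarrow> real \<Rightarrow> real \<Rightarrow> nat \<Rightarrow> real"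
  where "rate s p L R T =
    (let m = max 2 p in L * R powr s * real T powr (- (((m + 1) * s - m) / m)))"

end

theory Submission
  imports Defs
begin

text \<open>
  Let $s = q + \nu$ and $m = \max\{2, p\}$. A multiple of $\|x - x_0\|_p^m$ is uniformly convex of
  degree $m$ and serves as regularizer. The proximal step minimizes the Taylor polynomial of $f$ at
  $x$ plus $\frac{M}{s} \|h\|_p^s$, where $M$ is a multiple of $L$. At a minimizer $h$ the negative
  gradient of the Taylor polynomial is a subgradient of this power, hence also of
  $\frac{1}{r \lambda} \|h\|_p^r$ with $\lambda = \|h\|_p^{r-s} / M$, and it differs from the
  negative gradient of $f$ at $x + h$ by a small multiple of $M \|h\|_p^{s-1}$. For $q = 1$ the
  gradient at $x$ is used instead, as an $\varepsilon$-subgradient at $x + h$.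

  If $s \le m$, algorithm A is run with $r = s$, so that $\lambda = 1/M$ is constant. Young's
  inequality turns uniform convexity of degree $m$ into the inexact one of degree $s$ with an error of
  order $R^m / T$. If $s > m$, algorithm B is run with $r = m$. The potential argument bounds
  $\sum_k \gamma_k \widehat A_k \|x_k - \tilde y_k\|_p^m / \lambda_k$, and over the steps that decrease
  $\widehat\lambda$ this bounds $\sum_k A_k \widehat\lambda_k^{-s/(s-m)}$. Since $\widehat\lambda$
  moves by a factor $2$ in each step, the steps that increase it inherit the bound, which forces $A_T$
  to grow at the claimed rate.
\<close>

section \<open>Inequalities for powers and polynomials\<close>

text \<open>All constants are fixed before the dimension. Dimension-dependent estimates therefore
  serve only for continuity, finiteness and existence of minimizers; \<open>M / L\<close> comes from
  a coefficient bound for one-variable polynomials, the moduli of convexity from scalar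
  inequalities. For \<open>s \<le> m\<close> the \<open>m\<close>-th power is too flat near the
  origin to pay for a step of degree \<open>s\<close>. Young's inequality at distance
  \<open>\<rho> = R * T powr (- 1 / m)\<close> leaves the modulus
  \<open>\<rho> powr (m - s)\<close>, so the growth \<open>T powr s\<close> of the weights drops by
  \<open>T powr ((m - s) / m)\<close>, which produces the claimed exponent. The \<open>T + 1\<close>
  errors add up to the order of \<open>R powr m\<close>, the initial Bregman distance, and cost only
  a factor. For \<open>s > m\<close> a step that increases the guess may be arbitrarily short and is
  then invisible in the proximal sum, whereas a step that decreases it has a length bounded below by
  a power of the guess. Hence the contribution of increasing steps has to be inferred from their
  neighbours. The case \<open>R = 0\<close> is separate because the parameters are powers of
  \<open>R\<close>.\<close>

lemma powr_ge_tangent: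
  fixes a b r :: real
  assumes "1 < r" "0 \<le> a" "0 \<le> b"
  shows "b powr r + r * b powr (r - 1) * (a - b) \<le> a powr r"
proof (cases "b = 0")
  case False
  then have b: "b > 0" using assms by simp
  define q where "q = r / (r - 1)"
  have q: "q > 1" "1 / r + 1 / q = 1"
    using assms by (auto simp: q_def field_simps)
  have "a / b * 1 \<le> (a / b) powr r / r + 1 powr q / q"
    by (rule Youngs_inequality) (use assms q b in auto)
  moreover have "1 / q = 1 - 1 / r" using q by simp
  ultimately have "r * (a / b) \<le> r * ((a / b) powr r / r + (1 - 1 / r))"
    using assms by (intro mult_left_mono) auto
  also have "\<dots> = (a / b) powr r + r - 1"
    using assms by (simp add: algebra_simps)
  finally have "r * (a / b) \<le> (a / b) powr r + r - 1" .
  then have "r * (a / b) * b powr r \<le> ((a / b) powr r + r - 1) * b powr r"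
    by (intro mult_right_mono) auto
  moreover have "(a / b) powr r * b powr r = a powr r"
    using assms b by (simp add: powr_divide)
  moreover have "b powr r = b powr (r - 1) * b"
    using b by (simp add: powr_mult_base mult.commute)
  ultimately show ?thesis using b by (simp add: algebra_simps)
qed (use assms in auto)

text \<open>The exponent \<open>1 / e\<close> is at least \<open>1\<close>, so this is the convex
  case for the powers \<open>a powr e\<close> and \<open>b powr e\<close>, solved for their
  difference.\<close>

lemma powr_le_tangent:
  fixes a b e :: real
  assumes "0 < e" "e \<le> 1" "0 \<le> a" "0 < b"
  shows "a powr e \<le> b powr e + e * b powr (e - 1) * (a - b)"
proof (cases "e = 1")
  case False
  define x where "x = a powr e"
  define y where "y = b powr e"
  have "y powr (1/e) + 1/e * y powr (1/e - 1) * (x - y) \<le> x powr (1/e)"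
    by (rule powr_ge_tangent) (use assms False in \<open>auto simp: x_def y_def\<close>)
  moreover have "y powr (1/e) = b" "x powr (1/e) = a" "y powr (1/e - 1) = b powr (1 - e)"
    using assms by (auto simp: x_def y_def powr_powr algebra_simps)
  ultimately have "b powr (1 - e) * (x - y) \<le> e * (a - b)"
    using assms by (simp add: field_simps)
  then have "b powr (e - 1) * (b powr (1 - e) * (x - y)) \<le> b powr (e - 1) * (e * (a - b))"
    by (intro mult_left_mono) auto
  moreover have "b powr (e - 1) * b powr (1 - e) = 1"
    using assms by (simp flip: powr_add)
  then have "b powr (e - 1) * (b powr (1 - e) * (x - y)) = x - y"
    by (metis mult.assoc mult_1)
  ultimately have "x - y \<le> b powr (e - 1) * (e * (a - b))" by (simp only:)
  then show ?thesis by (simp add: x_def y_def mult_ac)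
qed (use assms in auto)

text \<open>\<open>ln t \<le> t - 1\<close> followed by \<open>1 + u \<le> exp u\<close> gives the
  tangent at \<open>1\<close>; homogeneity moves it to \<open>y\<close>.\<close>

lemma powr_neg_ge_tangent:
  fixes x y e :: real
  assumes "0 \<le> e" "0 < x" "0 < y"
  shows "y powr (- e) - e * y powr (- e - 1) * (x - y) \<le> x powr (- e)"
proof -
  have "1 - e * (x / y - 1) \<le> 1 + (- e) * ln (x / y)"
    using ln_le_minus_one[of "x / y"] assms by (simp add: mult_left_mono)
  also have "\<dots> \<le> exp (- e * ln (x / y))" by (rule exp_ge_add_one_self)
  also have "\<dots> = (x / y) powr (- e)" using assms by (simp add: powr_def)
  also have "\<dots> = x powr (- e) / y powr (- e)" using assms by (simp add: powr_divide)
  finally have "(1 - e * (x / y - 1)) * y powr (- e) \<le> x powr (- e)"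
    using assms by (simp add: pos_le_divide_eq)
  moreover have *: "y powr (- e - 1) * y = y powr (- e)"
    using assms by (simp add: powr_mult_base mult.commute)
  moreover have "(1 - e * (x / y - 1)) * y powr (- e) = y powr (- e) - e * y powr (- e - 1) * (x - y)"
    using assms unfolding *[symmetric] by (simp add: field_simps)
  ultimately show ?thesis by simp
qed

text \<open>
  Passing from $P(t)$ to $P(t) - 2^n P(t/2)$ removes the leading coefficient, which drives the
  induction.
\<close>

lemma poly_coeff_bound:
  "\<exists>C\<ge>0. \<forall>(b :: nat \<Rightarrow> real) M. (\<forall>t\<in>{0..1}. \<bar>\<Sum>j\<le>n. b j * t ^ j\<bar> \<le> M) \<longrightarrow> (\<forall>j\<le>n. \<bar>b j\<bar> \<le> C * M)"
proof (induction n)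
  case 0
  show ?case by (intro exI[of _ 1]) auto
next
  case (Suc n)
  then obtain C where C: "C \<ge> 0"
    and bd: "\<forall>(b :: nat \<Rightarrow> real) M. (\<forall>t\<in>{0..1}. \<bar>\<Sum>j\<le>n. b j * t ^ j\<bar> \<le> M) \<longrightarrow> (\<forall>j\<le>n. \<bar>b j\<bar> \<le> C * M)"
    by blast
  define D where "D = C * (1 + 2 ^ Suc n)"
  have D: "D \<ge> 0" using C by (simp add: D_def)
  have "\<bar>b j\<bar> \<le> (D + 1 + real (Suc n) * D) * M"
    if b: "\<And>t. t \<in> {0..1} \<Longrightarrow> \<bar>\<Sum>j\<le>Suc n. b j * t ^ j\<bar> \<le> M" and j: "j \<le> Suc n" for b :: "nat \<Rightarrow> real" and M j
  proof -
    have M: "M \<ge> 0" using b[of 0] by simp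
    define b' where "b' = (\<lambda>j. b j * (1 - 2 ^ (Suc n - j)))"
    have "\<bar>\<Sum>j\<le>n. b' j * t ^ j\<bar> \<le> (1 + 2 ^ Suc n) * M" if t: "t \<in> {0..1}" for t
    proof -
      have "2 ^ Suc n * (\<Sum>j\<le>Suc n. b j * (t/2) ^ j) = (\<Sum>j\<le>Suc n. b j * (2 ^ (Suc n - j) * t ^ j))"
        unfolding sum_distrib_left
        by (intro sum.cong refl) (auto simp: power_divide power_diff)
      then have "(\<Sum>j\<le>Suc n. b j * t ^ j) - 2 ^ Suc n * (\<Sum>j\<le>Suc n. b j * (t/2) ^ j)
          = (\<Sum>j\<le>Suc n. b' j * t ^ j)"
        by (simp only: flip: sum_subtractf) (intro sum.cong refl, auto simp: b'_def algebra_simps)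
      also have "\<dots> = (\<Sum>j\<le>n. b' j * t ^ j)" by (simp add: b'_def)
      finally have eq: "(\<Sum>j\<le>n. b' j * t ^ j) = (\<Sum>j\<le>Suc n. b j * t ^ j) - 2 ^ Suc n * (\<Sum>j\<le>Suc n. b j * (t/2) ^ j)"
        by simp
      have 1: "\<bar>\<Sum>j\<le>Suc n. b j * t ^ j\<bar> \<le> M" and 2: "\<bar>\<Sum>j\<le>Suc n. b j * (t/2) ^ j\<bar> \<le> M"
        using b[of t] b[of "t/2"] t by auto
      have "\<bar>2 ^ Suc n * (\<Sum>j\<le>Suc n. b j * (t/2) ^ j)\<bar> \<le> 2 ^ Suc n * M"
        using 2 by (simp only: abs_mult) (intro mult_mono, auto)
      then show ?thesis unfolding eq using 1 unfolding distrib_right by linarith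
    qed
    then have *: "\<bar>b' j\<bar> \<le> D * M" if "j \<le> n" for j
      using bd[rule_format, of b' "(1 + 2 ^ Suc n) * M"] that by (simp add: D_def mult.assoc)
    \<comment> \<open>The factors \<open>1 - 2 ^ (Suc n - j)\<close> have modulus at least
      \<open>1\<close>, so a bound for the difference polynomial passes to the lower coefficients of
      \<open>b\<close>. The top coefficient then follows from the value at
      \<open>t = 1\<close>.\<close>
    have low: "\<bar>b j\<bar> \<le> D * M" if "j \<le> n" for j
    proof -
      have "(2::real) ^ 1 \<le> 2 ^ (Suc n - j)" using that by (intro power_increasing) auto
      then have "\<bar>b j\<bar> * 1 \<le> \<bar>b j\<bar> * \<bar>1 - 2 ^ (Suc n - j)\<bar>" by (intro mult_left_mono) auto
      also have "\<dots> = \<bar>b' j\<bar>" by (simp add: b'_def abs_mult)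
      finally show ?thesis using *[OF that] by simp
    qed
    have "\<bar>b (Suc n)\<bar> \<le> M + (\<Sum>j\<le>n. \<bar>b j\<bar>)"
      proof -
      have "\<bar>sum b {..n} + b (Suc n)\<bar> \<le> M" using b[of 1] by simp
      then show ?thesis using sum_abs[of b "{..n}"] by linarith
    qed
    also have "(\<Sum>j\<le>n. \<bar>b j\<bar>) \<le> (\<Sum>j\<le>n. D * M)" using low by (intro sum_mono) auto
    finally have top: "\<bar>b (Suc n)\<bar> \<le> M + real (Suc n) * (D * M)" by simp
    have nn: "D * M \<ge> 0" "real (Suc n) * (D * M) \<ge> 0" using D M by auto
    have "(D + 1 + real (Suc n) * D) * M = D * M + M + real (Suc n) * (D * M)"
      by (simp add: algebra_simps)
    then show ?thesis
      using low[of j] top nn M j by (cases "j = Suc n") auto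
  qed
  moreover have "D + 1 + real (Suc n) * D \<ge> 0" using D by simp
  ultimately show ?case by (intro exI[of _ "D + 1 + real (Suc n) * D"]) auto
qed

text \<open>Jensen's inequality for the convex map \<open>t powr (- e)\<close>: all tangents are
  taken at \<open>S / card I\<close>, and since \<open>sum u I \<le> S\<close> while the slope is
  nonpositive, the linear terms have a nonnegative sum.\<close>

lemma sum_powr_neg_ge:
  fixes u :: "nat \<Rightarrow> real"
  assumes "finite I" "I \<noteq> {}" "\<And>i. i \<in> I \<Longrightarrow> u i > 0" "0 \<le> e" "sum u I \<le> S" "0 < S"
  shows "real (card I) powr (1 + e) * S powr (- e) \<le> (\<Sum>i\<in>I. u i powr (- e))"
proof -
  define n where "n = real (card I)"
  have n: "n > 0" using assms by (auto simp: n_def card_gt_0_iff)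
  define y where "y = S / n"
  have y: "y > 0" using n assms by (simp add: y_def)
  have "n powr (1 + e) * S powr (- e) = n * (S powr (- e) / n powr (- e))"
    using n by (simp add: powr_add powr_minus_divide)
  also have "\<dots> = n * y powr (- e)"
    using n assms by (simp add: y_def powr_divide)
  also have "\<dots> \<le> n * y powr (- e) - e * y powr (- e - 1) * (sum u I - n * y)"
    using assms n by (simp add: y_def mult_nonneg_nonpos)
  also have "\<dots> = (\<Sum>i\<in>I. y powr (- e) - e * y powr (- e - 1) * (u i - y))"
    by (simp add: sum_subtractf sum_distrib_left[symmetric] n_def)
  also have "\<dots> \<le> (\<Sum>i\<in>I. u i powr (- e))"
    using assms y by (intro sum_mono powr_neg_ge_tangent) auto
  finally show ?thesis by (simp add: n_def)
qed

text \<open>In the first iteration \<open>A 0 = 0\<close>, so the weight and the partial sum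
  coincide and the implicit weight equation has this explicit solution.\<close>

lemma weight_from_zero:
  fixes A c r l :: real
  assumes r: "1 < r" and "0 < A" "0 < c" "0 < l" and eq: "A = (c * A powr (r - 1) * l) powr (1 / r)"
  shows "A = c * l"
proof -
  have "A powr r = (c * A powr (r - 1) * l) powr (1 / r * r)" using eq by (metis powr_powr)
  also have "\<dots> = A powr (r - 1) * (c * l)" using assms by simp
  also have "A powr r = A powr (r - 1) * A" using assms by (simp add: powr_mult_base mult.commute)
  finally show ?thesis using assms(2) by simp
qed

section \<open>The balance of one proximal step\<close>

text \<open>
  This tolerance makes $(1+\sigma)^r = \sqrt{2}$, while \<open>step_const\<close> contains the
  factor $1/2$. The remaining slack is \<open>prox_gain\<close>, the fraction of the proximal term that
  is kept in the potential.
\<close>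

definition prox_tol :: "real \<Rightarrow> real"
  where "prox_tol r = 2 powr (1 / (2 * r)) - 1"

lemma prox_tol_bounds:
  assumes "1 < r"
  shows "0 < prox_tol r" "prox_tol r < 1 / 2"
proof -
  have "2 powr 0 < 2 powr (1 / (2 * r))" using assms by (intro powr_less_mono) auto
  then show "0 < prox_tol r" by (simp add: prox_tol_def)
  have "2 powr (1 / (2 * r)) < 2 powr (1 / 2)" using assms by (intro powr_less_mono) (auto simp: field_simps)
  also have "\<dots> = sqrt 2" by (simp add: powr_half_sqrt)
  also have "\<dots> < 3 / 2" by (rule real_less_lsqrt) (auto simp: power2_eq_square)
  finally show "prox_tol r < 1 / 2" by (simp add: prox_tol_def)
qed

definition prox_gain :: "real \<Rightarrow> real"
  where "prox_gain r = (1 - prox_tol r - 1/4) * (1 - 2 powr (- 1 / (2 * (r - 1))))"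

lemma prox_gain_pos: "1 < r \<Longrightarrow> 0 < prox_gain r"
proof -
  assume r: "1 < r"
  have "2 powr (- 1 / (2 * (r - 1))) < 2 powr 0" using r by (intro powr_less_mono) auto
  then show ?thesis using prox_tol_bounds[OF r] by (simp add: prox_gain_def)
qed

lemma step_const_pos:
  assumes "1 < r" "0 < \<mu>"
  shows "0 < step_const \<mu> r (prox_tol r) (1/4)"
proof -
  have "0 < 1 + prox_tol r powr inverse (1 - 1 / r)" by (intro add_pos_nonneg) auto
  moreover have "0 < inverse (1 - 1 / r)" using assms by simp
  ultimately show ?thesis
    unfolding step_const_def Let_def using assms prox_tol_bounds[OF assms(1)] by simp
qed

lemma step_const_scale: "step_const \<mu> r \<sigma> \<sigma>' = \<mu> * step_const 1 r \<sigma> \<sigma>'"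
  by (simp add: step_const_def Let_def)

text \<open>The cross term is linear in \<open>t\<close>. Young's inequality with the conjugate
  exponents \<open>r\<close> and \<open>rs\<close> splits it into the uniform convexity term and a
  part \<open>Q\<close> of the proximal term. The weight equation is tuned so that \<open>Q\<close>
  stays a fixed fraction \<open>k0 < 1\<close> of the proximal term; what remains is
  \<open>prox_gain r\<close>.\<close>

lemma prox_step_balance:
  fixes r \<mu> Ah ah l lam \<rho> t :: real
  assumes r: "1 < r" and \<mu>: "0 < \<mu>" and pos: "0 < lam" "0 < l" "0 < Ah" "0 \<le> \<rho>" "0 \<le> t"
    and ah: "ah = (step_const \<mu> r (prox_tol r) (1/4) * Ah powr (r - 1) * l) powr (1 / r)"
    and g: "g = min (lam / l) 1"
  shows "prox_gain r * (g * Ah * \<rho> powr r / lam)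
    \<le> \<mu> / r * t powr r + g * (Ah * ((1 - prox_tol r - 1/4) * \<rho> powr r / lam)
        - ah * ((1 + prox_tol r) * \<rho> powr (r - 1) / lam) * t)"
proof -
  define S where "S = 1 - prox_tol r - 1/4"
  define k0 :: real where "k0 = 2 powr (- 1 / (2 * (r - 1)))"
  define rs where "rs = r / (r - 1)"
  define B where "B = g * Ah * \<rho> powr r / lam"
  define Q where "Q = k0 * S * B"
  define X where "X = g * ah * ((1 + prox_tol r) * \<rho> powr (r - 1) / lam)"
  define C where "C = step_const \<mu> r (prox_tol r) (1/4)"
  note sb = prox_tol_bounds[OF r]
  have S: "0 < S" using sb by (simp add: S_def)
  have k0: "0 < k0" by (simp add: k0_def)
  have g0: "0 < g" "g * l / lam \<le> 1" using pos by (auto simp: g min_def field_simps)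
  have rs: "1 < rs" "1 / r + 1 / rs = 1" "r / rs = r - 1" using r by (auto simp: rs_def field_simps)
  have rs': "inverse (1 - 1 / r) = rs" using r by (simp add: rs_def field_simps)
  have Q: "0 \<le> Q" using S k0 g0 pos by (simp add: Q_def B_def)
  have C: "0 < C" unfolding C_def by (rule step_const_pos[OF r \<mu>])
  have ahr: "ah powr r = C * Ah powr (r - 1) * l" "0 < ah"
    unfolding ah using r pos C by (auto simp: powr_powr C_def[symmetric])
  have X: "X \<le> \<mu> powr (1/r) * (rs * Q) powr (1 / rs)"
  proof (cases "\<rho> = 0")
    case True
    then show ?thesis by (simp add: X_def)
  next
    case False
    then have \<rho>: "0 < \<rho>" using pos by simp
    define W where "W = g powr (r-1) * Ah powr (r-1) * \<rho> powr (r * (r-1)) / lam powr (r-1)"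
    have W: "0 < W" using g0 pos \<rho> by (simp add: W_def)
    have s2: "(1 + prox_tol r) powr r = 2 powr (1/2)" using r by (simp add: prox_tol_def powr_powr)
    have p1: "g powr r = g powr (r - 1) * g" "lam powr r = lam powr (r - 1) * lam"
      using g0 pos by (simp_all add: powr_mult_base mult.commute)
    have "X powr r = g powr r * ah powr r * ((1 + prox_tol r) powr r * \<rho> powr (r * (r-1)) / lam powr r)"
      using g0 ahr sb pos \<rho> by (simp add: X_def powr_mult powr_divide powr_powr mult.commute)
    also have "\<dots> = W * (g * l / lam) * C * 2 powr (1/2)"
      unfolding s2 ahr p1 using pos by (simp add: W_def field_simps)
    \<comment> \<open>The damping \<open>g\<close> acts here: \<open>g * l \<le> lam\<close>,
      although the weight was computed from the guess \<open>l\<close>.\<close>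
    also have "\<dots> \<le> W * 1 * C * 2 powr (1/2)"
      using W C g0 by (intro mult_right_mono mult_left_mono) auto
    also have "C \<le> \<mu> / 2 * (rs * S) powr (r - 1)"
    proof -
      have "1 \<le> 1 + prox_tol r powr rs" by simp
      then have "rs * S / (1 + prox_tol r powr rs) \<le> rs * S / 1"
        using rs S by (intro divide_left_mono mult_pos_pos) (auto intro: add_pos_nonneg)
      then have "rs * S / (1 + prox_tol r powr rs) \<le> rs * S" by simp
      then have "(rs * S / (1 + prox_tol r powr rs)) powr (r - 1) \<le> (rs * S) powr (r - 1)"
        using rs S r by (intro powr_mono2) (auto intro!: divide_nonneg_nonneg add_nonneg_nonneg)
      then show ?thesis using \<mu> by (simp add: C_def step_const_def rs' S_def Let_def)
    qed
    then have "W * 1 * C * 2 powr (1/2) \<le> W * 1 * (\<mu> / 2 * (rs * S) powr (r - 1)) * 2 powr (1/2)"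
      using W by (intro mult_right_mono mult_left_mono) auto
    \<comment> \<open>The factor \<open>1 / 2\<close> of \<open>step_const\<close> against
      \<open>(1 + prox_tol r) powr r = 2 powr (1/2)\<close> leaves \<open>2 powr (- 1/2)\<close>,
      which is \<open>k0 powr (r - 1)\<close>.\<close>
    also have "\<dots> = W * \<mu> * (rs * S) powr (r - 1) * 2 powr (- 1/2)"
    proof -
      have "(2::real) powr (1/2) = 2 * 2 powr (- 1/2)"
        by (simp add: powr_mult_base)
      then show ?thesis by simp
    qed
    also have "\<dots> = \<mu> * (rs * Q) powr (r - 1)"
    proof -
      have "k0 powr (r - 1) = 2 powr (- 1/2)"
      proof -
        have "- 1 / (2 * (r - 1)) * (r - 1) = - 1 / 2" using r by (simp add: field_simps)
        then show ?thesis by (metis k0_def powr_powr)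
      qed
      moreover have "B powr (r - 1) = W"
        using g0 pos \<rho> by (simp add: B_def W_def powr_mult powr_divide powr_powr)
      moreover have "B > 0" using g0 pos \<rho> by (simp add: B_def)
      ultimately show ?thesis using rs S k0 by (simp add: Q_def powr_mult)
    qed
    also have "\<dots> = (\<mu> powr (1/r) * (rs * Q) powr (1 / rs)) powr r"
      using \<mu> r rs Q by (simp add: powr_mult powr_powr)
    finally have "X powr r \<le> (\<mu> powr (1/r) * (rs * Q) powr (1 / rs)) powr r" .
    then show ?thesis
      using r powr_less_mono2[of r "\<mu> powr (1/r) * (rs * Q) powr (1 / rs)" X] by fastforce
  qed
  have "\<mu> powr (1/r) * t * (rs * Q) powr (1 / rs)
      \<le> (\<mu> powr (1/r) * t) powr r / r + ((rs * Q) powr (1 / rs)) powr rs / rs"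
    using r rs pos by (intro Youngs_inequality) auto
  also have "\<dots> = \<mu> / r * t powr r + Q"
    using r rs pos \<mu> Q by (simp add: powr_mult powr_powr)
  finally have "X * t \<le> \<mu> / r * t powr r + Q"
    using mult_right_mono[OF X, of t] pos by (simp add: mult_ac)
  moreover have "prox_gain r * B = S * B - Q"
    by (simp add: prox_gain_def S_def k0_def Q_def algebra_simps)
  moreover have "g * (Ah * (S * \<rho> powr r / lam) - ah * ((1 + prox_tol r) * \<rho> powr (r - 1) / lam) * t) = S * B - X * t"
    by (simp add: B_def X_def algebra_simps)
  ultimately show ?thesis by (simp add: B_def S_def)
qed

section \<open>Norms on $d$-dimensional space\<close>

lemma Rd_iff: "x \<in> Rd d \<longleftrightarrow> (\<forall>i\<ge>d. x i = 0)"
  by (simp add: topspace_Euclidean_space)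

lemma scaleR_fun_apply [simp]: "(c *\<^sub>R x) i = c *\<^sub>R x i"
  by (simp add: scaleR_fun_def)

lemma Rd_closed [intro, simp]:
  "0 \<in> Rd d" "x \<in> Rd d \<Longrightarrow> y \<in> Rd d \<Longrightarrow> x + y \<in> Rd d" "x \<in> Rd d \<Longrightarrow> y \<in> Rd d \<Longrightarrow> x - y \<in> Rd d"
  "x \<in> Rd d \<Longrightarrow> c *\<^sub>R x \<in> Rd d" "x \<in> Rd d \<Longrightarrow> - x \<in> Rd d"
  by (auto simp: Rd_iff)

definition unit_vec :: "nat \<Rightarrow> pt"
  where "unit_vec i = (\<lambda>j. if j = i then 1 else 0)"

lemma unit_vec_Rd [simp]: "i < d \<Longrightarrow> unit_vec i \<in> Rd d"
  by (auto simp: unit_vec_def Rd_iff)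

lemma dotp_simps:
  "dotp d g (x + y) = dotp d g x + dotp d g y" "dotp d g (x - y) = dotp d g x - dotp d g y"
  "dotp d g (c *\<^sub>R x) = c * dotp d g x" "dotp d g (- x) = - dotp d g x" "dotp d g 0 = 0"
  "dotp d (g + h) x = dotp d g x + dotp d h x" "dotp d (g - h) x = dotp d g x - dotp d h x"
  "dotp d (c *\<^sub>R g) x = c * dotp d g x" "dotp d (- g) x = - dotp d g x" "dotp d 0 x = 0"
  by (simp_all add: dotp_def algebra_simps sum.distrib sum_subtractf sum_negf sum_distrib_left)

lemma le_limit_at_right:
  fixes D :: real and \<phi> :: "real \<Rightarrow> real"
  assumes "\<And>t. 0 < t \<Longrightarrow> t < 1 \<Longrightarrow> D \<le> \<phi> t" "(\<phi> \<longlongrightarrow> l) (at_right 0)"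
  shows "D \<le> l"
proof -
  have "eventually (\<lambda>t. D \<le> \<phi> t) (at_right 0)"
    unfolding eventually_at_right_field using assms(1) by (intro exI[of _ 1]) auto
  then show ?thesis by (rule tendsto_lowerbound[OF assms(2)]) simp
qed

lemma deriv_le_if_slope_le:
  fixes \<phi> :: "real \<Rightarrow> real"
  assumes "(\<phi> has_real_derivative D) (at 0)" "\<And>t. 0 < t \<Longrightarrow> t < 1 \<Longrightarrow> \<phi> t - \<phi> 0 \<le> t * c"
  shows "D \<le> c"
proof -
  have "((\<lambda>t. (\<phi> t - \<phi> 0) / t) \<longlongrightarrow> D) (at_right 0)"
    using assms(1) by (auto simp: has_field_derivative_iff intro: tendsto_mono at_le)
  moreover have "eventually (\<lambda>t. (\<phi> t - \<phi> 0) / t \<le> c) (at_right 0)"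
    unfolding eventually_at_right_field using assms(2)
    by (intro exI[of _ 1]) (auto simp: divide_le_eq mult.commute)
  ultimately show ?thesis by (rule tendsto_upperbound) simp
qed

text \<open>A seminorm on all sequences that is a norm on \<open>Rd d\<close>, so the axioms carry
  no membership conditions. Domination of the coordinates takes the place of equivalence of norms:
  it yields definiteness, bounded linear forms and compactness of bounded sets.\<close>

locale coord_norm =
  fixes d :: nat and N :: "pt \<Rightarrow> real"
  assumes N_ge0: "0 \<le> N x"
    and N_scale: "N (c *\<^sub>R x) = \<bar>c\<bar> * N x"
    and N_triangle: "N (x + y) \<le> N x + N y"
    and N_coord: "i < d \<Longrightarrow> \<bar>x i\<bar> \<le> N x"
    and N_cont: "continuous_on UNIV N"
begin

lemma N_0: "N 0 = 0"
  using N_scale[of 0 0] by simp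

lemma N_eq_0: "x \<in> Rd d \<Longrightarrow> N x = 0 \<longleftrightarrow> x = 0"
proof
  assume x: "x \<in> Rd d" "N x = 0"
  then have "x i = 0" for i using N_coord[of i x] by (cases "i < d") (auto simp: Rd_iff)
  then show "x = 0" by (simp add: fun_eq_iff)
qed (simp add: N_0)

lemma N_minus: "N (- x) = N x"
  using N_scale[of "- 1" x] by simp

lemma N_minus_commute: "N (x - y) = N (y - x)"
  using N_minus[of "x - y"] by simp

text \<open>A crude bound that only shows the supremum in \<open>dual_norm\<close> to be finite; its
  dimension-dependent factor reaches no rate constant.\<close>

lemma dotp_le: "dotp d g u \<le> (\<Sum>i<d. \<bar>g i\<bar>) * N u"
  unfolding dotp_def sum_distrib_right
proof (rule sum_mono)
  fix i assume "i \<in> {..<d}"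
  then have "\<bar>g i\<bar> * \<bar>u i\<bar> \<le> \<bar>g i\<bar> * N u" by (intro mult_left_mono N_coord) auto
  then show "g i * u i \<le> \<bar>g i\<bar> * N u" using abs_ge_self[of "g i * u i"] by (simp add: abs_mult)
qed

lemma dual_norm_leI:
  assumes "\<And>u. u \<in> Rd d \<Longrightarrow> N u \<le> 1 \<Longrightarrow> dotp d g u \<le> c"
  shows "dual_norm d N g \<le> c"
  unfolding dual_norm_def using assms by (intro cSup_least) (auto intro!: exI[of _ 0] simp: N_0)

lemma dotp_le_dual_norm:
  assumes "u \<in> Rd d"
  shows "dotp d g u \<le> dual_norm d N g * N u"
proof (cases "N u = 0")
  case True
  then show ?thesis using assms by (simp add: N_eq_0 dotp_simps N_0)
next
  case False
  then have pos: "0 < N u" using N_ge0[of u] by simp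
  have "bdd_above {dotp d g v | v. v \<in> Rd d \<and> N v \<le> 1}"
  proof (rule bdd_aboveI)
    fix y assume "y \<in> {dotp d g v | v. v \<in> Rd d \<and> N v \<le> 1}"
    then obtain v where v: "y = dotp d g v" "N v \<le> 1" by blast
    have "y \<le> (\<Sum>i<d. \<bar>g i\<bar>) * N v" using v dotp_le by simp
    also have "\<dots> \<le> (\<Sum>i<d. \<bar>g i\<bar>) * 1" using v by (intro mult_left_mono sum_nonneg) auto
    finally show "y \<le> (\<Sum>i<d. \<bar>g i\<bar>)" by simp
  qed
  then have "dotp d g ((1 / N u) *\<^sub>R u) \<le> dual_norm d N g"
    unfolding dual_norm_def using assms pos by (intro cSup_upper) (auto simp: N_scale)
  then show ?thesis using pos by (simp add: dotp_simps field_simps)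
qed

text \<open>The norm may be nonsmooth, so the subgradient inequality is tested along segments
  instead of differentiating. The points \<open>h + t *\<^sub>R u\<close> with \<open>t\<close>
  tending to \<open>0\<close> give the dual bound; the points \<open>(1 - t) *\<^sub>R h\<close> on
  the ray to the origin show that this bound is attained at \<open>h\<close>.\<close>

lemma subgrad_norm_power:
  assumes r: "1 < r" and c: "0 \<le> c" and h: "h \<in> Rd d"
    and g: "\<And>z. z \<in> Rd d \<Longrightarrow> c / r * N h powr r + dotp d g (z - h) \<le> c / r * N z powr r"
  shows "dotp d g h = c * N h powr r"
    and "\<And>u. u \<in> Rd d \<Longrightarrow> dotp d g u \<le> c * N h powr (r - 1) * N u"
proof -
  show le: "dotp d g u \<le> c * N h powr (r - 1) * N u" if u: "u \<in> Rd d" for u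
  proof (rule le_limit_at_right)
    fix t :: real assume t: "0 < t" "t < 1"
    define b where "b = N h + t * N u"
    have b: "0 \<le> b" using t N_ge0 by (simp add: b_def)
    have "N (h + t *\<^sub>R u) \<le> b" using N_triangle[of h "t *\<^sub>R u"] t by (simp add: b_def N_scale)
    then have "N (h + t *\<^sub>R u) powr r \<le> b powr r" using r N_ge0 by (intro powr_mono2) auto
    then have "c / r * N (h + t *\<^sub>R u) powr r \<le> c / r * b powr r"
      using c r by (intro mult_left_mono) auto
    moreover have "c / r * N h powr r + dotp d g (h + t *\<^sub>R u - h) \<le> c / r * N (h + t *\<^sub>R u) powr r"
      using g[of "h + t *\<^sub>R u"] u h by auto
    ultimately have "t * dotp d g u \<le> c / r * (b powr r - N h powr r)"
      by (simp add: dotp_simps right_diff_distrib)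
    also have "b powr r - N h powr r \<le> r * b powr (r - 1) * (t * N u)"
      using powr_ge_tangent[OF r N_ge0 b, of h] by (simp add: b_def algebra_simps)
    then have "c / r * (b powr r - N h powr r) \<le> c / r * (r * b powr (r - 1) * (t * N u))"
      using c r by (intro mult_left_mono) auto
    also have "\<dots> = t * (c * b powr (r - 1) * N u)" using r by simp
    finally show "dotp d g u \<le> c * (N h + t * N u) powr (r - 1) * N u" using t by (simp add: b_def)
  next
    have "eventually (\<lambda>t. 0 \<le> N h + t * N u) (at_right 0)"
      unfolding eventually_at_right_field using N_ge0[of h] N_ge0[of u] by (intro exI[of _ 1]) auto
    moreover have "((\<lambda>t. N h + t * N u) \<longlongrightarrow> N h + 0 * N u) (at_right 0)"
      by (intro tendsto_intros)
    ultimately have "((\<lambda>t. (N h + t * N u) powr (r - 1)) \<longlongrightarrow> (N h + 0 * N u) powr (r - 1)) (at_right 0)"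
      using r by (intro tendsto_powr2 tendsto_const) auto
    then show "((\<lambda>t. c * (N h + t * N u) powr (r - 1) * N u) \<longlongrightarrow> c * N h powr (r - 1) * N u) (at_right 0)"
      by (intro tendsto_mult tendsto_const) simp
  qed
  have "N h powr (r - 1) * N h = N h powr r"
    using N_ge0[of h] by (simp add: powr_mult_base mult.commute)
  then have "dotp d g h \<le> c * N h powr r" using le[OF h] by (simp add: mult.assoc)
  moreover have "- dotp d g h \<le> - (c * N h powr r)"
  proof (rule le_limit_at_right)
    fix t :: real assume t: "0 < t" "t < 1"
    have "N ((1 - t) *\<^sub>R h) powr r = (1 - t) powr r * N h powr r"
      using t N_ge0[of h] unfolding N_scale by (simp add: powr_mult)
    moreover have "dotp d g ((1 - t) *\<^sub>R h - h) = - (t * dotp d g h)"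
      unfolding dotp_simps by (simp add: left_diff_distrib)
    ultimately have "c / r * N h powr r - t * dotp d g h \<le> c / r * ((1 - t) powr r * N h powr r)"
      using g[of "(1 - t) *\<^sub>R h"] h by auto
    then have "- (t * dotp d g h) \<le> c / r * ((1 - t) powr r * N h powr r) - c / r * N h powr r"
      by linarith
    also have "\<dots> = c / r * N h powr r * ((1 - t) powr r - 1)"
      by (simp add: right_diff_distrib mult_ac diff_divide_distrib)
    finally have "- (t * dotp d g h) \<le> c / r * N h powr r * ((1 - t) powr r - 1)" .
    also have "(1 - t) powr r - 1 \<le> - (r * (1 - t) powr (r - 1) * t)"
      using powr_ge_tangent[OF r, of 1 "1 - t"] t by (simp add: algebra_simps)
    then have "c / r * N h powr r * ((1 - t) powr r - 1) \<le> c / r * N h powr r * (- (r * (1 - t) powr (r - 1) * t))"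
      using c r by (intro mult_left_mono) auto
    also have "\<dots> = t * - (c * (1 - t) powr (r - 1) * N h powr r)" using r by simp
    finally have "t * - dotp d g h \<le> t * - (c * (1 - t) powr (r - 1) * N h powr r)" by simp
    then show "- dotp d g h \<le> - (c * (1 - t) powr (r - 1) * N h powr r)" using t by (simp only: mult_le_cancel_left_pos)
  next
    have "((\<lambda>t::real. (1 - t) powr (r - 1)) \<longlongrightarrow> (1 - 0) powr (r - 1)) (at_right 0)"
      by (intro tendsto_intros) auto
    then show "((\<lambda>t. - (c * (1 - t) powr (r - 1) * N h powr r)) \<longlongrightarrow> - (c * N h powr r)) (at_right 0)"
      by (auto intro!: tendsto_eq_intros)
  qed
  ultimately show "dotp d g h = c * N h powr r" by simp
qed

text \<open>Converse of the preceding lemma. The two conditions see the exponent and the factor only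
  through \<open>c * N h powr r\<close> and \<open>c * N h powr (r - 1)\<close>; hence a subgradient
  for the exponent \<open>s\<close> is one for \<open>r\<close> after rescaling \<open>c\<close>.
  This lets a model of degree \<open>s\<close> answer an oracle of degree \<open>r\<close>.\<close>

lemma norm_power_subgradI:
  assumes r: "1 < r" and c: "0 \<le> c" and h: "h \<in> Rd d" "z \<in> Rd d"
    and eq: "dotp d g h = c * N h powr r"
    and le: "\<And>u. u \<in> Rd d \<Longrightarrow> dotp d g u \<le> c * N h powr (r - 1) * N u"
  shows "c / r * N h powr r + dotp d g (z - h) \<le> c / r * N z powr r"
proof -
  have "N h powr r = N h powr (r - 1) * N h"
    using N_ge0[of h] by (simp add: powr_mult_base mult.commute)
  then have "dotp d g (z - h) \<le> c * (N h powr (r - 1) * (N z - N h))"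
    using le[OF h(2)] eq by (simp add: dotp_simps algebra_simps)
  also have "\<dots> = c / r * (r * N h powr (r - 1) * (N z - N h))" using r by simp
  also have "\<dots> \<le> c / r * (N z powr r - N h powr r)"
    using powr_ge_tangent[OF r N_ge0 N_ge0, of h z] c r by (intro mult_left_mono) auto
  finally show ?thesis by (simp add: right_diff_distrib)
qed

text \<open>In the product topology on sequences the box is a product of compact intervals and of
  singletons \<open>{0}\<close> beyond index \<open>d\<close>, so Tychonoff's theorem
  applies.\<close>

lemma compact_box: "compact {x \<in> Rd d. \<forall>i<d. \<bar>x i\<bar> \<le> \<rho>}"
proof -
  define S where "S i = (if i < d then {- \<rho>..\<rho>} else {0::real})" for i
  have eq: "{x \<in> Rd d. \<forall>i<d. \<bar>x i\<bar> \<le> \<rho>} = PiE UNIV S"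
  proof (rule set_eqI)
    fix x :: pt
    have S: "x i \<in> S i \<longleftrightarrow> (if i < d then \<bar>x i\<bar> \<le> \<rho> else x i = 0)" for i
      by (auto simp: S_def abs_le_iff)
    have "x \<in> PiE UNIV S \<longleftrightarrow> (\<forall>i. if i < d then \<bar>x i\<bar> \<le> \<rho> else x i = 0)"
      by (simp add: PiE_UNIV_domain Pi_iff S)
    also have "\<dots> \<longleftrightarrow> x \<in> {x \<in> Rd d. \<forall>i<d. \<bar>x i\<bar> \<le> \<rho>}"
      unfolding Rd_iff mem_Collect_eq by (metis not_le)
    finally show "x \<in> {x \<in> Rd d. \<forall>i<d. \<bar>x i\<bar> \<le> \<rho>} \<longleftrightarrow> x \<in> PiE UNIV S" by simp
  qed
  have "compactin (product_topology (\<lambda>i. euclidean) UNIV) (PiE UNIV S)"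
    by (subst compactin_PiE) (auto simp: S_def)
  then show ?thesis unfolding eq
    by (simp add: euclidean_product_topology)
qed

lemma exists_min:
  assumes cont: "continuous_on UNIV G" and far: "\<And>x. x \<in> Rd d \<Longrightarrow> N x > \<rho> \<Longrightarrow> G 0 \<le> G x"
  shows "\<exists>x\<in>Rd d. \<forall>z\<in>Rd d. G x \<le> (G z :: real)"
proof -
  \<comment> \<open>The maximum ensures that the box contains the comparison point
    \<open>0\<close>.\<close>
  define \<rho>' where "\<rho>' = max \<rho> 0"
  let ?B = "{x \<in> Rd d. \<forall>i<d. \<bar>x i\<bar> \<le> \<rho>'}"
  have "0 \<in> ?B" by (auto simp: \<rho>'_def)
  then obtain x where x: "x \<in> ?B" "\<And>z. z \<in> ?B \<Longrightarrow> G x \<le> G z"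
    using continuous_attains_inf[OF compact_box[of \<rho>'], of G] continuous_on_subset[OF cont, of ?B] by blast
  have "G x \<le> G z" if z: "z \<in> Rd d" for z
  proof (cases "N z > \<rho>")
    case True
    then show ?thesis using far[OF z] x(2)[OF \<open>0 \<in> ?B\<close>] by simp
  next
    case False
    then have "\<bar>z i\<bar> \<le> \<rho>'" if "i < d" for i using N_coord[OF that, of z] by (simp add: \<rho>'_def)
    then show ?thesis using x(2) z by simp
  qed
  then show ?thesis using x(1) by blast
qed

end

section \<open>The p-norm and Minkowski's inequality\<close>

lemma powr_convex_comb:
  fixes u w t r :: real
  assumes "1 < r" "0 \<le> u" "0 \<le> w" "0 \<le> t" "t \<le> 1"
  shows "(t * u + (1 - t) * w) powr r \<le> t * u powr r + (1 - t) * w powr r"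
proof -
  define m where "m = t * u + (1 - t) * w"
  have m: "0 \<le> m" using assms by (simp add: m_def)
  have "t * (m powr r + r * m powr (r - 1) * (u - m)) \<le> t * u powr r"
    using assms m by (intro mult_left_mono powr_ge_tangent) auto
  moreover have "(1 - t) * (m powr r + r * m powr (r - 1) * (w - m)) \<le> (1 - t) * w powr r"
    using assms m by (intro mult_left_mono powr_ge_tangent) auto
  moreover have "t * (m powr r + r * m powr (r - 1) * (u - m)) + (1 - t) * (m powr r + r * m powr (r - 1) * (w - m))
     = m powr r + r * m powr (r - 1) * (t * u + (1 - t) * w - m)"
    by (simp add: algebra_simps)
  ultimately show ?thesis by (simp add: m_def)
qed

lemma pnorm_powr: "0 < p \<Longrightarrow> pnorm d p x powr p = (\<Sum>i<d. \<bar>x i\<bar> powr p)"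
  by (simp add: pnorm_def powr_powr sum_nonneg)

lemma pnorm_nonneg [simp]: "0 \<le> pnorm d p x"
  by (simp add: pnorm_def)

lemma pnorm_coord: "0 < p \<Longrightarrow> i < d \<Longrightarrow> \<bar>x i\<bar> \<le> pnorm d p x"
proof -
  assume p: "0 < p" and i: "i < d"
  have "\<bar>x i\<bar> powr p \<le> pnorm d p x powr p"
    unfolding pnorm_powr[OF p] using i by (intro member_le_sum) auto
  then show ?thesis using p powr_less_mono2[of p "pnorm d p x" "\<bar>x i\<bar>"] by fastforce
qed

text \<open>Dividing by \<open>a + b\<close> turns \<open>\<bar>x i\<bar> + \<bar>y i\<bar>\<close>
  into the convex combination of the normalized entries \<open>\<bar>x i\<bar> / a\<close> and
  \<open>\<bar>y i\<bar> / b\<close> with weight \<open>a / (a + b)\<close>; convexity of the power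
  is then summed over the coordinates. Vanishing norms cannot be normalized and are treated
  first.\<close>

lemma pnorm_triangle:
  assumes p: "1 < p"
  shows "pnorm d p (x + y) \<le> pnorm d p x + pnorm d p y"
proof -
  define a b where "a = pnorm d p x" and "b = pnorm d p y"
  have ab: "0 \<le> a" "0 \<le> b" by (auto simp: a_def b_def)
  consider "a = 0" | "b = 0" | "0 < a" "0 < b" using ab by linarith
  then show ?thesis
  proof cases
    case 1
    then have "x i = 0" if "i < d" for i using pnorm_coord[of p i d x] p that by (simp add: a_def)
    then show ?thesis by (simp add: pnorm_def)
  next
    case 2
    then have "y i = 0" if "i < d" for i using pnorm_coord[of p i d y] p that by (simp add: b_def)
    then show ?thesis by (simp add: pnorm_def)
  next
    case 3
    define t where "t = a / (a + b)"
    have t: "0 \<le> t" "t \<le> 1" "1 - t = b / (a + b)" using 3 by (auto simp: t_def field_simps)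
    have "\<bar>x i + y i\<bar> powr p \<le> (a + b) powr p * (t * (\<bar>x i\<bar> powr p / a powr p) + (1 - t) * (\<bar>y i\<bar> powr p / b powr p))" for i
    proof -
      have "\<bar>x i + y i\<bar> powr p \<le> ((a + b) * (t * (\<bar>x i\<bar> / a) + (1 - t) * (\<bar>y i\<bar> / b))) powr p"
      proof (rule powr_mono2)
        have "(a + b) * (t * (\<bar>x i\<bar> / a) + (1 - t) * (\<bar>y i\<bar> / b)) = \<bar>x i\<bar> + \<bar>y i\<bar>"
        proof -
          have "(a + b) * (a / (a + b) * (\<bar>x i\<bar> / a)) = \<bar>x i\<bar>" "(a + b) * (b / (a + b) * (\<bar>y i\<bar> / b)) = \<bar>y i\<bar>"
            using 3 by simp_all
          then show ?thesis unfolding t(3) unfolding t_def by (simp only: distrib_left)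
        qed
        then show "\<bar>x i + y i\<bar> \<le> (a + b) * (t * (\<bar>x i\<bar> / a) + (1 - t) * (\<bar>y i\<bar> / b))" by simp
      qed (use p in auto)
      also have "\<dots> = (a + b) powr p * (t * (\<bar>x i\<bar> / a) + (1 - t) * (\<bar>y i\<bar> / b)) powr p"
        by (rule powr_mult)
      also have "\<dots> \<le> (a + b) powr p * (t * (\<bar>x i\<bar> / a) powr p + (1 - t) * (\<bar>y i\<bar> / b) powr p)"
        using 3 t p by (intro mult_left_mono powr_convex_comb) auto
      finally show ?thesis using 3 by (simp add: powr_divide)
    qed
    then have "(\<Sum>i<d. \<bar>x i + y i\<bar> powr p)
        \<le> (\<Sum>i<d. (a + b) powr p * (t * (\<bar>x i\<bar> powr p / a powr p) + (1 - t) * (\<bar>y i\<bar> powr p / b powr p)))"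
      by (intro sum_mono) auto
    also have "\<dots> = (a + b) powr p * (t * ((\<Sum>i<d. \<bar>x i\<bar> powr p) / a powr p) + (1 - t) * ((\<Sum>i<d. \<bar>y i\<bar> powr p) / b powr p))"
      by (simp only: sum.distrib sum_divide_distrib flip: sum_distrib_left)
    also have "\<dots> = (a + b) powr p * (t * 1 + (1 - t) * 1)"
    proof -
      have "(\<Sum>i<d. \<bar>x i\<bar> powr p) / a powr p = 1" "(\<Sum>i<d. \<bar>y i\<bar> powr p) / b powr p = 1"
        using 3 p pnorm_powr[of p d x, symmetric] pnorm_powr[of p d y, symmetric] by (simp_all add: a_def b_def)
      then show ?thesis by (simp only:)
    qed
    also have "(a + b) powr p * (t * 1 + (1 - t) * 1) = (a + b) powr p" by simp
    finally have "pnorm d p (x + y) powr p \<le> (a + b) powr p" using p by (simp add: pnorm_powr)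
    then have "pnorm d p (x + y) \<le> a + b"
      using 3 p powr_less_mono2[of p "a + b" "pnorm d p (x + y)"] by fastforce
    then show ?thesis by (simp add: a_def b_def)
  qed
qed

lemma coord_norm_pnorm:
  assumes p: "1 < p"
  shows "coord_norm d (pnorm d p)"
proof
  fix x y :: pt and c :: real and i :: nat
  show "pnorm d p (c *\<^sub>R x) = \<bar>c\<bar> * pnorm d p x"
    using p by (simp add: pnorm_def abs_mult powr_mult powr_powr sum_nonneg flip: sum_distrib_left)
  show "continuous_on UNIV (pnorm d p)"
    unfolding pnorm_def using p
    by (intro continuous_on_powr' continuous_intros ballI) (auto intro: sum_nonneg)
qed (use p in \<open>auto intro: pnorm_triangle pnorm_coord\<close>)

section \<open>Multilinear derivatives and Taylor expansion\<close>

lemmas pt_apply = plus_fun_apply zero_fun_apply scaleR_fun_apply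

text \<open>As simplification rules these rewrite vectors to pointwise lambda terms.\<close>

declare pt_apply [simp del]

lemma L2_set_scaleR: "L2_set (t *\<^sub>R h) A = \<bar>t\<bar> * L2_set h A" for h :: pt
  by (simp add: pt_apply L2_set_def power_mult_distrib real_sqrt_mult flip: sum_distrib_left)

lemma frechet_line:
  assumes F: "frechet_at d F F' x" and h: "h \<in> Rd d"
  shows "((\<lambda>t. F (x + t *\<^sub>R h)) has_real_derivative F' h) (at 0)"
  unfolding DERIV_def LIM_def
proof (intro allI impI)
  fix e :: real assume e: "0 < e"
  define l where "l = L2_set h {..<d}"
  have l: "0 \<le> l" by (simp add: l_def L2_set_nonneg)
  \<comment> \<open>\<open>l + 1\<close> instead of \<open>l\<close> covers a direction of length
    zero.\<close>
  have "0 < e / (l + 1)" using e l by simp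
  then obtain \<delta> where \<delta>: "\<delta> > 0"
    "\<And>h. h \<in> Rd d \<Longrightarrow> L2_set h {..<d} < \<delta> \<Longrightarrow> \<bar>F (x + h) - F x - F' h\<bar> \<le> e / (l + 1) * L2_set h {..<d}"
    using F unfolding frechet_at_def by metis
  have F': "F' (t *\<^sub>R h) = t * F' h" for t
  proof -
    have "F' (t *\<^sub>R h + 0 *\<^sub>R h) = t * F' h + 0 * F' h"
      using F h unfolding frechet_at_def by blast
    then show ?thesis by simp
  qed
  have "\<bar>(F (x + t *\<^sub>R h) - F x) / t - F' h\<bar> < e" if t: "t \<noteq> 0" "\<bar>t\<bar> < \<delta> / (l + 1)" for t
  proof -
    have "\<bar>t\<bar> * (l + 1) < \<delta>" using t l by (simp add: field_simps)
    then have "L2_set (t *\<^sub>R h) {..<d} < \<delta>" unfolding L2_set_scaleR l_def[symmetric] using t by (simp add: distrib_left)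
    then have "\<bar>F (x + t *\<^sub>R h) - F x - t * F' h\<bar> \<le> e / (l + 1) * (\<bar>t\<bar> * l)"
      using \<delta>(2)[of "t *\<^sub>R h"] h by (simp add: F' L2_set_scaleR l_def)
    also have "\<dots> < e * \<bar>t\<bar>" using t e l by (simp add: field_simps)
    finally have "\<bar>F (x + t *\<^sub>R h) - F x - t * F' h\<bar> / \<bar>t\<bar> < e" using t by (simp add: field_simps)
    moreover have "(F (x + t *\<^sub>R h) - F x) / t - F' h = (F (x + t *\<^sub>R h) - F x - t * F' h) / t"
      using t by (simp add: field_simps)
    ultimately show ?thesis by simp
  qed
  then show "\<exists>s>0. \<forall>t. t \<noteq> 0 \<and> dist t 0 < s \<longrightarrow>
      dist ((F (x + (0 + t) *\<^sub>R h) - F (x + 0 *\<^sub>R h)) / t) (F' h) < e"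
    using \<delta>(1) l by (intro exI[of _ "\<delta> / (l + 1)"]) (auto simp: dist_real_def)
qed

lemma Dn_line:
  assumes "times_differentiable d q f" "length vs < q" "set vs \<subseteq> Rd d" "x \<in> Rd d" "h \<in> Rd d"
  shows "((\<lambda>t. Dn f vs (x + t *\<^sub>R h)) has_real_derivative Dn f (h # vs) (x + t *\<^sub>R h)) (at t)"
proof -
  have "frechet_at d (Dn f vs) (\<lambda>h. Dn f (h # vs) (x + t *\<^sub>R h')) (x + t *\<^sub>R h')" if "h' \<in> Rd d" for h'
    using assms that unfolding times_differentiable_def by blast
  from frechet_line[OF this[OF assms(5)] assms(5)]
  have "((\<lambda>u. Dn f vs (x + (u + t) *\<^sub>R h)) has_real_derivative Dn f (h # vs) (x + t *\<^sub>R h)) (at 0)"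
    by (simp add: scaleR_add_left add_ac)
  then show ?thesis using DERIV_shift[of "\<lambda>t. Dn f vs (x + t *\<^sub>R h)" _ 0 t] by simp
qed

text \<open>The slot under consideration is singled out by splitting the argument list; lists of a
  length other than \<open>k\<close> are left unconstrained, in accordance with \<open>Dn\<close>,
  which accepts lists of any length.\<close>

definition multilin :: "nat \<Rightarrow> nat \<Rightarrow> (pt list \<Rightarrow> real) \<Rightarrow> bool"
  where "multilin d k F \<longleftrightarrow> (\<forall>us ws v w a b. length us + length ws + 1 = k \<longrightarrow> set us \<subseteq> Rd d \<longrightarrow>
    set ws \<subseteq> Rd d \<longrightarrow> v \<in> Rd d \<longrightarrow> w \<in> Rd d \<longrightarrow>
    F (us @ (a *\<^sub>R v + b *\<^sub>R w) # ws) = a * F (us @ v # ws) + b * F (us @ w # ws))"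

text \<open>In the outermost slot linearity is part of Frechet differentiability. In an inner slot
  it is an identity between functions of the base point, which survives differentiation in the outer
  directions by uniqueness of derivatives. Symmetry of higher derivatives is thus bypassed.\<close>

lemma Dn_linear:
  assumes f: "times_differentiable d q f"
    and "length us + length ws + 1 \<le> q" "set us \<subseteq> Rd d" "set ws \<subseteq> Rd d" "v \<in> Rd d" "w \<in> Rd d" "x \<in> Rd d"
  shows "Dn f (us @ (a *\<^sub>R v + b *\<^sub>R w) # ws) x = a * Dn f (us @ v # ws) x + b * Dn f (us @ w # ws) x"
  using assms(2-)
proof (induction us arbitrary: x)
  case Nil
  then have "frechet_at d (Dn f ws) (\<lambda>h. Dn f (h # ws) x) x"
    using f unfolding times_differentiable_def by auto
  then show ?case using Nil unfolding frechet_at_def by simp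
next
  case (Cons u us)
  have D: "((\<lambda>t. Dn f (us @ z # ws) (x + t *\<^sub>R u)) has_real_derivative Dn f (u # us @ z # ws) x) (at 0)" if "z \<in> Rd d" for z
    using Dn_line[OF f, of "us @ z # ws" x u 0] Cons that by simp
  have "((\<lambda>t. Dn f (us @ (a *\<^sub>R v + b *\<^sub>R w) # ws) (x + t *\<^sub>R u)) has_real_derivative
      a * Dn f (u # us @ v # ws) x + b * Dn f (u # us @ w # ws) x) (at 0)"
  proof -
    have "(\<lambda>t. Dn f (us @ (a *\<^sub>R v + b *\<^sub>R w) # ws) (x + t *\<^sub>R u))
        = (\<lambda>t. a * Dn f (us @ v # ws) (x + t *\<^sub>R u) + b * Dn f (us @ w # ws) (x + t *\<^sub>R u))"
      using Cons by auto
    then show ?thesis using D[of v] D[of w] Cons.prems by (auto intro!: derivative_eq_intros)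
  qed
  then show ?case using DERIV_unique D[of "a *\<^sub>R v + b *\<^sub>R w"] Cons.prems by fastforce
qed

lemma Dn_multilin:
  assumes "times_differentiable d q f" "k \<le> q" "x \<in> Rd d"
  shows "multilin d k (\<lambda>vs. Dn f vs x)"
  unfolding multilin_def using Dn_linear[OF assms(1)] assms(2,3) by auto

lemma multilin_Cons:
  assumes "multilin d (Suc k) F" "e \<in> Rd d"
  shows "multilin d k (\<lambda>ws. F (e # ws))"
  unfolding multilin_def
proof (intro allI impI)
  fix us ws v w and a b :: real
  assume "length us + length ws + 1 = k" "set us \<subseteq> Rd d" "set ws \<subseteq> Rd d" "v \<in> Rd d" "w \<in> Rd d"
  then show "F (e # us @ (a *\<^sub>R v + b *\<^sub>R w) # ws) = a * F (e # us @ v # ws) + b * F (e # us @ w # ws)"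
    using assms(1)[unfolded multilin_def, rule_format, of "e # us" ws v w a b] assms(2) by simp
qed

lemma multilin_diff:
  assumes "multilin d k F" "multilin d k G"
  shows "multilin d k (\<lambda>vs. F vs - G vs)"
  using assms unfolding multilin_def by (simp add: algebra_simps)

lemma multilin_head:
  assumes F: "multilin d (Suc k) F" and h: "h \<in> Rd d" and ws: "length ws = k" "set ws \<subseteq> Rd d"
  shows "F (h # ws) = (\<Sum>i<d. h i * F (unit_vec i # ws))"
proof -
  have lin: "F ((a *\<^sub>R v + b *\<^sub>R w) # ws) = a * F (v # ws) + b * F (w # ws)" if "v \<in> Rd d" "w \<in> Rd d" for a b v w
    using F[unfolded multilin_def, rule_format, of "[]" ws v w a b] that ws by simp
  \<comment> \<open>Truncations of \<open>h\<close> lead from \<open>0\<close> to \<open>h\<close>,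
    one coordinate at a time.\<close>
  define \<pi> :: "nat \<Rightarrow> pt" where "\<pi> n = (\<lambda>i. if i < n then h i else 0)" for n
  have "F (\<pi> n # ws) = (\<Sum>i<n. h i * F (unit_vec i # ws))" if "n \<le> d" for n
    using that
  proof (induction n)
    case 0
    have "F ((0 *\<^sub>R 0 + 0 *\<^sub>R 0) # ws) = 0 * F (0 # ws) + 0 * F (0 # ws)" by (rule lin) auto
    moreover have "\<pi> 0 = 0" by (simp add: \<pi>_def fun_eq_iff pt_apply)
    ultimately show ?case by simp
  next
    case (Suc n)
    have "\<pi> n \<in> Rd d" using Suc by (auto simp: \<pi>_def Rd_iff)
    moreover have "\<pi> (Suc n) = 1 *\<^sub>R \<pi> n + h n *\<^sub>R unit_vec n"
      by (auto simp: \<pi>_def fun_eq_iff unit_vec_def less_Suc_eq pt_apply)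
    ultimately show ?case using Suc lin[of "\<pi> n" "unit_vec n" 1 "h n"] by simp
  qed
  moreover have "\<pi> d = h" using h by (auto simp: \<pi>_def fun_eq_iff Rd_iff)
  ultimately show ?thesis by (metis order.refl)
qed

lemma multilin_homogeneous:
  assumes "multilin d k F" "h \<in> Rd d"
  shows "F (replicate k (c *\<^sub>R h)) = c ^ k * F (replicate k h)"
  using assms
proof (induction k arbitrary: F)
  case (Suc k)
  have "set (replicate k (c *\<^sub>R h)) \<subseteq> Rd d" using Suc.prems(2) by auto
  then have "F ((c *\<^sub>R h + 0 *\<^sub>R h) # replicate k (c *\<^sub>R h)) = c * F (h # replicate k (c *\<^sub>R h)) + 0 * F (h # replicate k (c *\<^sub>R h))"
    using Suc.prems(1)[unfolded multilin_def, rule_format, of "[]" "replicate k (c *\<^sub>R h)" h h c 0] Suc.prems(2) by auto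
  moreover have "F (h # replicate k (c *\<^sub>R h)) = c ^ k * F (h # replicate k h)"
    using Suc.IH[OF multilin_Cons[OF Suc.prems]] Suc.prems(2) by simp
  ultimately show ?case by simp
qed simp

section \<open>Polynomial functions of the coordinates\<close>

text \<open>Polynomials of degree at most \<open>n\<close>, kept as plain functions: continuity,
  growth, restriction to lines and directional derivatives then all follow by one short induction
  each.\<close>

inductive polyfun :: "nat \<Rightarrow> nat \<Rightarrow> (pt \<Rightarrow> real) \<Rightarrow> bool" for d
where
  const: "polyfun d n (\<lambda>x. c)"
| add: "polyfun d n P \<Longrightarrow> polyfun d n Q \<Longrightarrow> polyfun d n (\<lambda>x. P x + Q x)"
| coord: "i < d \<Longrightarrow> polyfun d n P \<Longrightarrow> polyfun d (Suc n) (\<lambda>x. x i * P x)"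

lemma polyfun_mono: "polyfun d n P \<Longrightarrow> n \<le> m \<Longrightarrow> polyfun d m P"
proof (induction arbitrary: m rule: polyfun.induct)
  case (coord i n P)
  then obtain m' where "m = Suc m'" "n \<le> m'" by (cases m) auto
  then show ?case using coord by (auto intro: polyfun.coord)
qed (auto intro: polyfun.intros)

lemma polyfun_cmult: "polyfun d n P \<Longrightarrow> polyfun d n (\<lambda>x. c * P x)"
proof (induction rule: polyfun.induct)
  case (add n P Q)
  then show ?case using polyfun.add[of d n "\<lambda>x. c * P x" "\<lambda>x. c * Q x"] by (simp add: distrib_left)
next
  case (coord i n P)
  then show ?case using polyfun.coord[of i d n "\<lambda>x. c * P x"] by (simp add: mult.left_commute)
qed (rule polyfun.const)

lemma polyfun_sum: "finite I \<Longrightarrow> (\<And>i. i \<in> I \<Longrightarrow> polyfun d n (P i)) \<Longrightarrow> polyfun d n (\<lambda>x. \<Sum>i\<in>I. P i x)"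
  by (induction I rule: finite_induct) (auto intro: polyfun.intros)

lemma polyfun_cont: "polyfun d n P \<Longrightarrow> continuous_on UNIV P"
  by (induction rule: polyfun.induct) (auto intro!: continuous_intros)

lemma polyfun_line: "polyfun d n P \<Longrightarrow> \<exists>b. \<forall>t. P (x + t *\<^sub>R u) = (\<Sum>j\<le>n. b j * t ^ j)"
proof (induction rule: polyfun.induct)
  case (const n c)
  have "\<forall>t::real. c = (\<Sum>j\<le>n. (if j = 0 then c else 0) * t ^ j)"
    by (subst sum.atMost_shift) simp
  then show ?case by (rule exI[where x = "\<lambda>j. if j = 0 then c else 0"])
next
  case (add n P Q)
  then obtain b b' where "\<And>t. P (x + t *\<^sub>R u) = (\<Sum>j\<le>n. b j * t ^ j)" "\<And>t. Q (x + t *\<^sub>R u) = (\<Sum>j\<le>n. b' j * t ^ j)"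
    by blast
  then have "\<forall>t. P (x + t *\<^sub>R u) + Q (x + t *\<^sub>R u) = (\<Sum>j\<le>n. (b j + b' j) * t ^ j)"
    by (simp add: distrib_right sum.distrib)
  then show ?case by (rule exI[of _ "\<lambda>j. b j + b' j"])
next
  case (coord i n P)
  then obtain b where b: "\<And>t. P (x + t *\<^sub>R u) = (\<Sum>j\<le>n. b j * t ^ j)" by blast
  \<comment> \<open>Coefficients of \<open>x i + t * u i\<close> times the polynomial with
    coefficients \<open>b\<close>.\<close>
  define b' where "b' j = (if j \<le> n then x i * b j else 0) + (if j = 0 then 0 else u i * b (j - 1))" for j
  have "(x + t *\<^sub>R u) i * P (x + t *\<^sub>R u) = (\<Sum>j\<le>Suc n. b' j * t ^ j)" for t
  proof -
    have "(\<Sum>j\<le>Suc n. b' j * t ^ j) = (\<Sum>j\<le>Suc n. (if j \<le> n then x i * b j else 0) * t ^ j)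
        + (\<Sum>j\<le>Suc n. (if j = 0 then 0 else u i * b (j - 1)) * t ^ j)"
      by (simp only: b'_def distrib_right sum.distrib)
    also have "(\<Sum>j\<le>Suc n. (if j \<le> n then x i * b j else 0) * t ^ j) = x i * (\<Sum>j\<le>n. b j * t ^ j)"
      by (simp add: sum_distrib_left mult.assoc)
    also have "(\<Sum>j\<le>Suc n. (if j = 0 then 0 else u i * b (j - 1)) * t ^ j) = t * u i * (\<Sum>j\<le>n. b j * t ^ j)"
      by (subst sum.atMost_Suc_shift) (simp add: sum_distrib_left mult_ac)
    finally show ?thesis using b[of t] by (simp add: algebra_simps pt_apply)
  qed
  then show ?case by blast
qed

lemma polyfun_deriv:
  "polyfun d n P \<Longrightarrow> \<exists>g\<in>Rd d. \<forall>u. ((\<lambda>t. P (x + t *\<^sub>R u)) has_real_derivative dotp d g u) (at 0)"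
proof (induction rule: polyfun.induct)
  case (const n c)
  show ?case by (intro bexI[of _ 0]) (auto simp: dotp_simps)
next
  case (add n P Q)
  then obtain g g' where g: "g \<in> Rd d" "g' \<in> Rd d"
    and D: "\<And>u. ((\<lambda>t. P (x + t *\<^sub>R u)) has_real_derivative dotp d g u) (at 0)"
     "\<And>u. ((\<lambda>t. Q (x + t *\<^sub>R u)) has_real_derivative dotp d g' u) (at 0)"
    by blast
  show ?case
    by (intro bexI[of _ "g + g'"] allI) (auto simp: g dotp_simps intro!: DERIV_add D)
next
  case (coord i n P)
  then obtain g where g: "g \<in> Rd d"
    and D: "\<And>u. ((\<lambda>t. P (x + t *\<^sub>R u)) has_real_derivative dotp d g u) (at 0)" by blast
  have e: "dotp d (unit_vec i) u = u i" for u
    using coord by (simp add: dotp_def unit_vec_def if_distrib[of "\<lambda>a. a * _"] cong: if_cong)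
  show ?case
  proof (intro bexI[of _ "P x *\<^sub>R unit_vec i + x i *\<^sub>R g"] allI)
    fix u
    show "((\<lambda>t. (x + t *\<^sub>R u) i * P (x + t *\<^sub>R u)) has_real_derivative
        dotp d (P x *\<^sub>R unit_vec i + x i *\<^sub>R g) u) (at 0)"
      by (auto intro!: derivative_eq_intros D simp: dotp_simps e pt_apply)
  qed (use g coord in auto)
qed

text \<open>Taking the maximum with \<open>1\<close> keeps the bound stable under multiplication by
  a coordinate near the origin as well. \<open>B\<close> may depend on the dimension: it is used
  only for coercivity and for finiteness of \<open>form_norm\<close>.\<close>

lemma (in coord_norm) polyfun_growth:
  "polyfun d n P \<Longrightarrow> \<exists>B\<ge>0. \<forall>h. \<bar>P h\<bar> \<le> B * max 1 (N h) ^ n"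
proof (induction rule: polyfun.induct)
  case (const n c)
  have "\<bar>c\<bar> * 1 \<le> \<bar>c\<bar> * max 1 (N h) ^ n" for h by (intro mult_left_mono one_le_power) auto
  then show ?case by (intro exI[of _ "\<bar>c\<bar>"]) auto
next
  case (add n P Q)
  then obtain B B' where B: "0 \<le> B" "0 \<le> B'" "\<And>h. \<bar>P h\<bar> \<le> B * max 1 (N h) ^ n" "\<And>h. \<bar>Q h\<bar> \<le> B' * max 1 (N h) ^ n"
    by blast
  have "\<bar>P h + Q h\<bar> \<le> (B + B') * max 1 (N h) ^ n" for h
    using B(3,4)[of h] abs_triangle_ineq[of "P h" "Q h"] unfolding distrib_right by linarith
  then show ?case using B by (intro exI[of _ "B + B'"]) auto
next
  case (coord i n P)
  then obtain B where B: "0 \<le> B" "\<And>h. \<bar>P h\<bar> \<le> B * max 1 (N h) ^ n" by blast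
  have "\<bar>h i * P h\<bar> \<le> B * max 1 (N h) ^ Suc n" for h
  proof -
    have "\<bar>h i\<bar> * \<bar>P h\<bar> \<le> max 1 (N h) * (B * max 1 (N h) ^ n)"
      using B N_coord[OF coord(1), of h] by (intro mult_mono) auto
    then show ?thesis by (simp add: abs_mult mult_ac)
  qed
  then show ?case using B by blast
qed

text \<open>Expanding the first slot in unit vectors leaves forms of degree one less on the same
  diagonal.\<close>

lemma multilin_polyfun:
  assumes "multilin d k F"
  shows "\<exists>P. polyfun d k P \<and> (\<forall>h\<in>Rd d. F (replicate k h) = P h)"
  using assms
proof (induction k arbitrary: F)
  case 0
  show ?case by (intro exI[of _ "\<lambda>x. F []"]) (auto intro: polyfun.const)
next
  case (Suc k)
  have "\<forall>i. \<exists>P. i < d \<longrightarrow> polyfun d k P \<and> (\<forall>h\<in>Rd d. F (unit_vec i # replicate k h) = P h)"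
    using Suc.IH[OF multilin_Cons[OF Suc.prems unit_vec_Rd]] by blast
  then obtain P where P: "\<And>i. i < d \<Longrightarrow> polyfun d k (P i)"
    "\<And>i h. i < d \<Longrightarrow> h \<in> Rd d \<Longrightarrow> F (unit_vec i # replicate k h) = P i h" by metis
  have "polyfun d (Suc k) (\<lambda>x. \<Sum>i<d. x i * P i x)"
    using P by (intro polyfun_sum polyfun.coord) auto
  moreover have "F (replicate (Suc k) h) = (\<Sum>i<d. h i * P i h)" if "h \<in> Rd d" for h
  proof -
    have "F (h # replicate k h) = (\<Sum>i<d. h i * F (unit_vec i # replicate k h))"
      using that by (intro multilin_head[OF Suc.prems]) auto
    then show ?thesis using P that by simp
  qed
  ultimately show ?case by blast
qed

section \<open>Gradients, Taylor polynomials and their errors\<close>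

lemma Dn_single:
  assumes "times_differentiable d q f" "1 \<le> q" "x \<in> Rd d" "u \<in> Rd d"
  shows "Dn f [u] x = dotp d (grad d f x) u"
proof -
  have "multilin d (Suc 0) (\<lambda>vs. Dn f vs x)" using Dn_multilin[OF assms(1)] assms by simp
  from multilin_head[OF this assms(4), of "[]"]
  have "Dn f [u] x = (\<Sum>i<d. u i * Dn f [unit_vec i] x)" by simp
  also have "\<dots> = (\<Sum>i<d. grad d f x i * u i)"
    by (rule sum.cong) (simp_all add: grad_def unit_vec_def mult.commute del: Dn.simps)
  finally show ?thesis by (simp only: dotp_def)
qed

lemma grad_Rd [simp]: "grad d f x \<in> Rd d"
  by (simp add: grad_def Rd_iff)

lemma grad_line:
  assumes "times_differentiable d q f" "1 \<le> q" "x \<in> Rd d" "u \<in> Rd d"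
  shows "((\<lambda>t. f (x + t *\<^sub>R u)) has_real_derivative dotp d (grad d f (x + t *\<^sub>R u)) u) (at t)"
  using Dn_line[OF assms(1), of "[]" x u t] Dn_single[OF assms(1,2), of "x + t *\<^sub>R u" u] assms by simp

lemma convex_grad:
  assumes f: "times_differentiable d q f" "1 \<le> q" "convex_on (Rd d) f" and x: "x \<in> Rd d" "z \<in> Rd d"
  shows "f x + dotp d (grad d f x) (z - x) \<le> f z"
proof -
  have "((\<lambda>t. f (x + t *\<^sub>R (z - x))) has_real_derivative dotp d (grad d f x) (z - x)) (at 0)"
    using grad_line[OF f(1,2) x(1), of "z - x" 0] x by simp
  then have "dotp d (grad d f x) (z - x) \<le> f z - f x"
  proof (rule deriv_le_if_slope_le)
    fix t :: real assume t: "0 < t" "t < 1"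
    have "x + t *\<^sub>R (z - x) = (1 - t) *\<^sub>R x + t *\<^sub>R z" by (simp add: algebra_simps)
    then have "f (x + t *\<^sub>R (z - x)) \<le> (1 - t) * f x + t * f z"
      using convex_onD[OF f(3), of t x z] t x by simp
    then show "f (x + t *\<^sub>R (z - x)) - f (x + 0 *\<^sub>R (z - x)) \<le> t * (f z - f x)"
      by (simp add: algebra_simps)
  qed
  then show ?thesis by simp
qed

definition taylor :: "(pt \<Rightarrow> real) \<Rightarrow> nat \<Rightarrow> pt \<Rightarrow> pt \<Rightarrow> real"
  where "taylor f q x h = (\<Sum>k\<le>q. Dn f (replicate k h) x / fact k)"

lemma taylor_polyfun:
  assumes "times_differentiable d q f" "x \<in> Rd d"
  shows "\<exists>P. polyfun d q P \<and> (\<forall>h\<in>Rd d. taylor f q x h = P h)"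
proof -
  have "\<forall>k. \<exists>P. k \<le> q \<longrightarrow> polyfun d k P \<and> (\<forall>h\<in>Rd d. Dn f (replicate k h) x = P h)"
    using multilin_polyfun[OF Dn_multilin[OF assms(1) _ assms(2)]] by blast
  then obtain P where P: "\<And>k. k \<le> q \<Longrightarrow> polyfun d k (P k)"
    "\<And>k h. k \<le> q \<Longrightarrow> h \<in> Rd d \<Longrightarrow> Dn f (replicate k h) x = P k h" by metis
  have "polyfun d q (\<lambda>h. \<Sum>k\<le>q. 1 / fact k * P k h)"
    using P by (intro polyfun_sum polyfun_cmult) (auto intro: polyfun_mono)
  moreover have "taylor f q x h = (\<Sum>k\<le>q. 1 / fact k * P k h)" if "h \<in> Rd d" for h
    using P that by (simp add: taylor_def)
  ultimately show ?thesis by blast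
qed

context coord_norm
begin

lemma form_norm_le:
  assumes F: "multilin d k F" and k: "1 \<le> k" and h: "h \<in> Rd d"
  shows "\<bar>F (replicate k h)\<bar> \<le> form_norm d N k F * N h ^ k"
proof -
  obtain P B where P: "\<And>h. h \<in> Rd d \<Longrightarrow> F (replicate k h) = P h" and B: "\<And>h. \<bar>P h\<bar> \<le> B * max 1 (N h) ^ k"
    using multilin_polyfun[OF F] polyfun_growth by blast
  have bdd: "bdd_above {\<bar>F (replicate k v)\<bar> | v. v \<in> Rd d \<and> N v \<le> 1}"
  proof (rule bdd_aboveI)
    fix y assume "y \<in> {\<bar>F (replicate k v)\<bar> | v. v \<in> Rd d \<and> N v \<le> 1}"
    then obtain v where "y = \<bar>F (replicate k v)\<bar>" "v \<in> Rd d" "N v \<le> 1" by blast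
    then show "y \<le> B" using P B[of v] by (simp add: max_def split: if_splits)
  qed
  show ?thesis
  proof (cases "N h = 0")
    case True
    then have "h = 0" using h by (simp add: N_eq_0)
    then have "F (replicate k h) = 0"
      using multilin_homogeneous[OF F h, of 0] k by (simp add: power_0_left)
    then show ?thesis using True k by (simp add: power_0_left)
  next
    case False
    then have pos: "0 < N h" using N_ge0[of h] by simp
    define v where "v = (1 / N h) *\<^sub>R h"
    have v: "v \<in> Rd d" "N v \<le> 1" "h = N h *\<^sub>R v" using h pos by (auto simp: v_def N_scale)
    have "\<bar>F (replicate k v)\<bar> \<le> form_norm d N k F"
      unfolding form_norm_def using v by (intro cSup_upper bdd) auto
    moreover have "F (replicate k h) = N h ^ k * F (replicate k v)"
      using multilin_homogeneous[OF F v(1), of "N h"] v(3) by simp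
    ultimately show ?thesis using pos by (simp add: abs_mult mult.commute)
  qed
qed

text \<open>The Lagrange form of the remainder along the segment leaves the difference of the
  \<open>q\<close>-th derivatives at an intermediate point and at \<open>x\<close>, evaluated on the
  diagonal at \<open>h\<close>. This is what the form norm controls. The factor
  \<open>1 / fact q\<close> is given away.\<close>

lemma taylor_remainder:
  assumes f: "times_differentiable d q f" "holder_deriv d N q L \<nu> f" and q: "1 \<le> q" "0 < \<nu>" "0 \<le> L"
    and x: "x \<in> Rd d" "h \<in> Rd d"
  shows "\<bar>f (x + h) - taylor f q x h\<bar> \<le> L * N h powr (real q + \<nu>)"
proof -
  have "\<exists>t>0. t < 1 \<and> f (x + 1 *\<^sub>R h) = (\<Sum>m<q. Dn f (replicate m h) (x + 0 *\<^sub>R h) / fact m * 1 ^ m) + Dn f (replicate q h) (x + t *\<^sub>R h) / fact q * 1 ^ q"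
  proof (rule Maclaurin)
    show "\<forall>m t. m < q \<and> 0 \<le> t \<and> t \<le> 1 \<longrightarrow> ((\<lambda>t. Dn f (replicate m h) (x + t *\<^sub>R h)) has_real_derivative Dn f (replicate (Suc m) h) (x + t *\<^sub>R h)) (at t)"
    proof (intro allI impI)
      fix m t assume "m < q \<and> 0 \<le> t \<and> t \<le> (1::real)"
      then show "((\<lambda>t. Dn f (replicate m h) (x + t *\<^sub>R h)) has_real_derivative Dn f (replicate (Suc m) h) (x + t *\<^sub>R h)) (at t)"
        using Dn_line[OF f(1), of "replicate m h" x h t] x by (simp add: set_replicate_conv_if del: Dn.simps)
    qed
  qed (use q in auto)
  then obtain t where t: "0 < t" "t < 1"
    and eq: "f (x + h) = (\<Sum>m<q. Dn f (replicate m h) x / fact m) + Dn f (replicate q h) (x + t *\<^sub>R h) / fact q"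
    by auto
  have "taylor f q x h = (\<Sum>m<q. Dn f (replicate m h) x / fact m) + Dn f (replicate q h) x / fact q"
    unfolding taylor_def lessThan_Suc_atMost[symmetric] by (simp only: sum.lessThan_Suc)
  then have "\<bar>f (x + h) - taylor f q x h\<bar> = \<bar>Dn f (replicate q h) (x + t *\<^sub>R h) - Dn f (replicate q h) x\<bar> / fact q"
    by (simp add: eq flip: diff_divide_distrib)
  also have "\<dots> \<le> \<bar>Dn f (replicate q h) (x + t *\<^sub>R h) - Dn f (replicate q h) x\<bar> / 1"
    by (intro divide_left_mono) (auto simp: fact_ge_1)
  also have "\<dots> \<le> form_norm d N q (\<lambda>vs. Dn f vs (x + t *\<^sub>R h) - Dn f vs x) * N h ^ q"
    using form_norm_le[OF multilin_diff[OF Dn_multilin[OF f(1)] Dn_multilin[OF f(1)]], of q "x + t *\<^sub>R h" x h] x q by simp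
  also have "\<dots> \<le> L * N (x + t *\<^sub>R h - x) powr \<nu> * N h ^ q"
    using f(2)[unfolded holder_deriv_def, rule_format, of "x + t *\<^sub>R h" x] x N_ge0 by (intro mult_right_mono) auto
  also have "\<dots> \<le> L * N h powr \<nu> * N h ^ q"
  proof (intro mult_right_mono mult_left_mono powr_mono2)
    show "N (x + t *\<^sub>R h - x) \<le> N h" using t N_ge0[of h] mult_right_mono[of t 1 "N h"] by (simp add: N_scale)
  qed (use q N_ge0 in auto)
  also have "\<dots> = L * N h powr (real q + \<nu>)"
    using q N_ge0[of h] by (cases "N h = 0") (auto simp: powr_add powr_realpow)
  finally show ?thesis .
qed

text \<open>
  The form norm controls derivatives on the diagonal only. The error of the gradient in direction
  $v$ is therefore read off as the linear coefficient of a polynomial in $t$ that is small on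
  $[0,1]$: the difference of the Taylor polynomials at $x + h$ and at $x$, both evaluated at $x +
  h + t v$.
\<close>

lemma taylor_grad_error:
  assumes C: "\<And>b M. (\<forall>t\<in>{0..1}. \<bar>\<Sum>j\<le>q. b j * t ^ j\<bar> \<le> M) \<Longrightarrow> (\<forall>j\<le>q. \<bar>b j\<bar> \<le> C * M)"
    and f: "times_differentiable d q f" "holder_deriv d N q L \<nu> f" and q: "1 \<le> q" "0 < \<nu>" "0 \<le> L"
    and x: "x \<in> Rd d" "h \<in> Rd d" "v \<in> Rd d"
    and g: "\<And>u. u \<in> Rd d \<Longrightarrow> ((\<lambda>t. taylor f q x (h + t *\<^sub>R u)) has_real_derivative dotp d g u) (at 0)"
  shows "\<bar>dotp d (grad d f (x + h) - g) v\<bar> \<le> C * (2 * L * (N h + N v) powr (real q + \<nu>))"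
proof -
  define s where "s = real q + \<nu>"
  obtain P where P: "polyfun d q P" "\<And>h. h \<in> Rd d \<Longrightarrow> taylor f q x h = P h"
    using taylor_polyfun[OF f(1) x(1)] by blast
  obtain c where c: "\<And>t. P (h + t *\<^sub>R v) = (\<Sum>j\<le>q. c j * t ^ j)" using polyfun_line[OF P(1)] by blast
  define b where "b j = Dn f (replicate j v) (x + h) / fact j - c j" for j
  have "((\<lambda>t. \<Sum>j\<le>q. c j * t ^ j) has_real_derivative (\<Sum>j\<le>q. c j * (real j * 0 ^ (j - 1)))) (at 0)"
    by (auto intro!: derivative_eq_intros sum.cong)
  moreover have "(\<Sum>j\<le>q. c j * (real j * 0 ^ (j - 1))) = (\<Sum>j\<in>{1}. c j * (real j * 0 ^ (j - 1)))"
    using q by (intro sum.mono_neutral_right) (auto simp: power_0_left)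
  moreover have "(\<lambda>t. taylor f q x (h + t *\<^sub>R v)) = (\<lambda>t. \<Sum>j\<le>q. c j * t ^ j)"
    using P(2) x c by auto
  ultimately have "((\<lambda>t. taylor f q x (h + t *\<^sub>R v)) has_real_derivative c 1) (at 0)" by simp
  then have c1: "c 1 = dotp d g v" using g[OF x(3)] DERIV_unique by blast
  have b1: "b 1 = dotp d (grad d f (x + h) - g) v"
    using Dn_single[OF f(1) q(1), of "x + h" v] x c1 by (simp add: b_def dotp_simps del: Dn.simps)
  have "\<bar>\<Sum>j\<le>q. b j * t ^ j\<bar> \<le> 2 * L * (N h + N v) powr s" if t: "t \<in> {0..1}" for t
  proof -
    have tv: "N (t *\<^sub>R v) \<le> N v" using t N_ge0[of v] mult_right_mono[of t 1 "N v"] by (simp add: N_scale)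
    have T: "taylor f q (x + h) (t *\<^sub>R v) = (\<Sum>j\<le>q. Dn f (replicate j v) (x + h) / fact j * t ^ j)"
      unfolding taylor_def
    proof (rule sum.cong[OF refl])
      fix k assume "k \<in> {..q}"
      then have "multilin d k (\<lambda>vs. Dn f vs (x + h))" using Dn_multilin[OF f(1)] x by simp
      from multilin_homogeneous[OF this x(3), of t]
      show "Dn f (replicate k (t *\<^sub>R v)) (x + h) / fact k = Dn f (replicate k v) (x + h) / fact k * t ^ k" by simp
    qed
    have "(\<Sum>j\<le>q. b j * t ^ j) = taylor f q (x + h) (t *\<^sub>R v) - taylor f q x (h + t *\<^sub>R v)"
      using P(2)[of "h + t *\<^sub>R v"] x by (simp add: T c b_def left_diff_distrib sum_subtractf)
    moreover have "\<bar>f (x + h + t *\<^sub>R v) - taylor f q (x + h) (t *\<^sub>R v)\<bar> \<le> L * N (t *\<^sub>R v) powr s"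
      using taylor_remainder[OF f q, of "x + h" "t *\<^sub>R v"] x by (simp add: s_def)
    moreover have "\<bar>f (x + (h + t *\<^sub>R v)) - taylor f q x (h + t *\<^sub>R v)\<bar> \<le> L * N (h + t *\<^sub>R v) powr s"
      using taylor_remainder[OF f q, of x "h + t *\<^sub>R v"] x by (simp add: s_def)
    moreover have "L * N (t *\<^sub>R v) powr s \<le> L * (N h + N v) powr s"
      using add_increasing[OF N_ge0[of h] tv] N_ge0 q by (intro mult_left_mono powr_mono2) (auto simp: s_def)
    moreover have "L * N (h + t *\<^sub>R v) powr s \<le> L * (N h + N v) powr s"
      using order.trans[OF N_triangle[of h "t *\<^sub>R v"] add_left_mono[OF tv]] N_ge0 q by (intro mult_left_mono powr_mono2) (auto simp: s_def)
    ultimately show ?thesis by (simp add: add.assoc)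
  qed
  then have "\<bar>b 1\<bar> \<le> C * (2 * L * (N h + N v) powr s)" using C q by blast
  then show ?thesis unfolding b1 s_def .
qed

text \<open>The preceding bound is not homogeneous in the direction, so the direction is rescaled
  first: to length \<open>N h\<close>, or, if \<open>N h = 0\<close>, by factors \<open>t\<close>
  tending to \<open>0\<close>, where the surplus power \<open>t powr (s - 1)\<close> vanishes in the
  limit.\<close>

lemma taylor_grad_error_dual:
  assumes C: "\<And>b M. (\<forall>t\<in>{0..1}. \<bar>\<Sum>j\<le>q. b j * t ^ j\<bar> \<le> M) \<Longrightarrow> (\<forall>j\<le>q. \<bar>b j\<bar> \<le> C * M)" "0 \<le> C"
    and f: "times_differentiable d q f" "holder_deriv d N q L \<nu> f" and q: "1 \<le> q" "0 < \<nu>" "0 \<le> L"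
    and x: "x \<in> Rd d" "h \<in> Rd d" "u \<in> Rd d"
    and g: "\<And>u. u \<in> Rd d \<Longrightarrow> ((\<lambda>t. taylor f q x (h + t *\<^sub>R u)) has_real_derivative dotp d g u) (at 0)"
  shows "dotp d (grad d f (x + h) - g) u \<le> C * 2 * 2 powr (real q + \<nu>) * L * N h powr (real q + \<nu> - 1) * N u"
proof -
  define s where "s = real q + \<nu>"
  define D where "D = dotp d (grad d f (x + h) - g) u"
  have s: "1 < s" using q by (simp add: s_def)
  note err = taylor_grad_error[OF C(1) f q x(1,2) _ g, folded s_def]
  show ?thesis
  proof (cases "N u = 0")
    case True
    then show ?thesis using x by (simp add: N_eq_0 dotp_simps N_0)
  next
    case False
    then have u: "0 < N u" using N_ge0[of u] by simp
    have scaled: "t * D \<le> C * (2 * L * (N h + t * N u) powr s)" if "0 < t" for t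
      using err[of "t *\<^sub>R u"] that x by (simp add: dotp_simps N_scale D_def abs_le_iff)
    show ?thesis
    proof (cases "N h = 0")
      case True
      have "D \<le> 0"
      proof (rule le_limit_at_right)
        fix t :: real assume t: "0 < t" "t < 1"
        have "t powr s = t * t powr (s - 1)" using t by (simp add: powr_mult_base)
        then have "t * D \<le> t * (C * (2 * L * (t powr (s - 1) * N u powr s)))"
          using scaled[OF t(1)] True t u by (simp add: powr_mult mult_ac)
        then show "D \<le> C * (2 * L * (t powr (s - 1) * N u powr s))" using t by (simp only: mult_le_cancel_left_pos)
      next
        have "((\<lambda>t::real. t powr (s - 1)) \<longlongrightarrow> 0 powr (s - 1)) (at_right 0)"
          using s by (intro tendsto_powr2 tendsto_ident_at tendsto_const) (auto simp: eventually_at_right_field intro!: exI[of _ 1])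
        then have "((\<lambda>t. C * (2 * L * (t powr (s - 1) * N u powr s))) \<longlongrightarrow> C * (2 * L * (0 * N u powr s))) (at_right 0)"
          by (intro tendsto_mult tendsto_const) simp
        then show "((\<lambda>t. C * (2 * L * (t powr (s - 1) * N u powr s))) \<longlongrightarrow> 0) (at_right 0)" by simp
      qed
      then show ?thesis using True by (simp add: D_def)
    next
      case False
      then have h: "0 < N h" using N_ge0[of h] by simp
      have "N h / N u * D \<le> C * (2 * L * (2 * N h) powr s)"
        using scaled[of "N h / N u"] h u by simp
      also have "(2 * N h) powr s = 2 powr s * (N h * N h powr (s - 1))"
        using h by (simp add: powr_mult powr_mult_base)
      finally have "N h * D \<le> N h * (C * 2 * 2 powr s * L * N h powr (s - 1) * N u)"
        using u by (simp add: field_simps)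
      then show ?thesis using h by (simp add: D_def s_def)
    qed
  qed
qed

end

section \<open>Proximal steps from Taylor models\<close>

context coord_norm
begin

text \<open>The form in which the potential argument consumes an oracle answer. By
  \<open>subgrad_norm_power\<close> the exact proximal direction is aligned with
  \<open>x - y\<close> and has a known dual bound; the tolerance changes the two constants to
  \<open>1 - \<sigma>\<close> and \<open>1 + \<sigma>\<close>.\<close>

lemma prox_answerE:
  assumes ans: "prox_answer d N f r \<sigma> \<sigma>' x lam y v" and r: "1 < r" and lam: "0 < lam" and x: "x \<in> Rd d"
  obtains \<epsilon> where "y \<in> Rd d" "v \<in> Rd d" "\<And>z. z \<in> Rd d \<Longrightarrow> f y + dotp d v (z - y) - \<epsilon> \<le> f z"
    "\<epsilon> \<le> \<sigma>' * N (x - y) powr r / lam"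
    "(1 - \<sigma>) * N (x - y) powr r / lam \<le> dotp d v (x - y)"
    "\<And>u. u \<in> Rd d \<Longrightarrow> dotp d v u \<le> (1 + \<sigma>) * N (x - y) powr (r - 1) / lam * N u"
proof -
  from ans obtain \<epsilon> g where y: "y \<in> Rd d" and g: "g \<in> eps_subdiff d (\<lambda>u. 1 / (r * lam) * N (u - x) powr r) 0 y"
    and v: "v \<in> eps_subdiff d f \<epsilon> y" and dn: "dual_norm d N (v - - g) \<le> \<sigma> / lam * N (x - y) powr (r - 1)"
    and \<epsilon>: "\<epsilon> \<le> \<sigma>' / lam * N (x - y) powr r"
    unfolding prox_answer_def by blast
  define \<rho> where "\<rho> = N (x - y)"
  have \<rho>: "N (y - x) = \<rho>" "0 \<le> \<rho>" by (simp_all add: \<rho>_def N_minus_commute N_ge0)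
  have h: "y - x \<in> Rd d" using x y by simp
  have sub: "1 / lam / r * N (y - x) powr r + dotp d g (z - (y - x)) \<le> 1 / lam / r * N z powr r" if z: "z \<in> Rd d" for z
  proof -
    have "1 / (r * lam) * N (z + x - x) powr r \<ge> 1 / (r * lam) * N (y - x) powr r + dotp d g (z + x - y) - 0"
      using g z x unfolding eps_subdiff_def by blast
    moreover have "z + x - y = z - (y - x)" by simp
    ultimately show ?thesis by (simp add: mult.commute)
  qed
  have lam': "0 \<le> 1 / lam" using lam by simp
  have geq: "dotp d g (y - x) = 1 / lam * \<rho> powr r"
    using subgrad_norm_power(1)[OF r lam' h sub] by (simp add: \<rho>)
  have gle: "dotp d g u \<le> 1 / lam * \<rho> powr (r - 1) * N u" if "u \<in> Rd d" for u
    using subgrad_norm_power(2)[OF r lam' h sub that] by (simp add: \<rho>)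
  have err: "dotp d (v + g) u \<le> \<sigma> / lam * \<rho> powr (r - 1) * N u" if "u \<in> Rd d" for u
  proof -
    have "dotp d (v + g) u \<le> dual_norm d N (v + g) * N u" by (rule dotp_le_dual_norm[OF that])
    also have "\<dots> \<le> \<sigma> / lam * \<rho> powr (r - 1) * N u"
      using dn N_ge0 by (intro mult_right_mono) (auto simp: \<rho>_def)
    finally show ?thesis .
  qed
  have abs_powr: "\<rho> powr (r - 1) * \<rho> = \<rho> powr r" using \<rho> by (simp add: powr_mult_base mult.commute)
  show thesis
  proof (rule that[of \<epsilon>])
    show "y \<in> Rd d" "v \<in> Rd d" using y v by (auto simp: eps_subdiff_def)
    show "f y + dotp d v (z - y) - \<epsilon> \<le> f z" if "z \<in> Rd d" for z
      using v that by (simp add: eps_subdiff_def)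
    show "\<epsilon> \<le> \<sigma>' * N (x - y) powr r / lam" using \<epsilon> by simp
    have "dotp d v (x - y) = dotp d g (y - x) - dotp d (v + g) (y - x)"
      by (simp add: dotp_simps)
    moreover have "dotp d (v + g) (y - x) \<le> \<sigma> / lam * (\<rho> powr (r - 1) * \<rho>)"
      using err[OF h] by (simp add: \<rho> mult.assoc)
    ultimately show "(1 - \<sigma>) * N (x - y) powr r / lam \<le> dotp d v (x - y)"
      unfolding abs_powr geq by (simp add: \<rho>_def left_diff_distrib diff_divide_distrib)
    show "dotp d v u \<le> (1 + \<sigma>) * N (x - y) powr (r - 1) / lam * N u" if u: "u \<in> Rd d" for u
    proof -
      have "dotp d v u = dotp d (v + g) u + dotp d g (- u)" by (simp add: dotp_simps)
      also have "\<dots> \<le> \<sigma> / lam * \<rho> powr (r - 1) * N u + 1 / lam * \<rho> powr (r - 1) * N u"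
        using err[OF u] gle[of "- u"] u by (intro add_mono) (auto simp: N_minus)
      also have "\<dots> = (1 + \<sigma>) * \<rho> powr (r - 1) / lam * N u"
        by (simp add: distrib_right add_divide_distrib)
      finally show ?thesis by (simp add: \<rho>_def)
    qed
  qed
qed

text \<open>\<open>g\<close> is the subgradient of the proximal power at \<open>h\<close>, described
  by the two conditions of \<open>norm_power_subgradI\<close>. The oracle asks for closeness to
  \<open>- g\<close>, hence the sum \<open>v + g\<close> in the error bound.\<close>

lemma prox_answerI:
  assumes r: "1 < r" and lam: "0 < lam" and x: "x \<in> Rd d" and h: "h \<in> Rd d" and g: "g \<in> Rd d"
    and eq: "dotp d g h = N h powr r / lam"
    and le: "\<And>u. u \<in> Rd d \<Longrightarrow> dotp d g u \<le> N h powr (r - 1) / lam * N u"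
    and v: "v \<in> Rd d" "0 \<le> \<epsilon>" "\<And>z. z \<in> Rd d \<Longrightarrow> f (x + h) + dotp d v (z - (x + h)) - \<epsilon> \<le> f z"
    and err: "\<And>u. u \<in> Rd d \<Longrightarrow> dotp d (v + g) u \<le> \<sigma> / lam * N h powr (r - 1) * N u"
    and \<sigma>: "0 \<le> \<sigma>" and \<epsilon>: "\<epsilon> \<le> \<sigma>' / lam * N h powr r"
  shows "prox_answer d N f r \<sigma> \<sigma>' x lam (x + h) v"
proof -
  have Nh: "N (x - (x + h)) = N h" using N_minus[of h] by simp
  have lam': "0 \<le> 1 / lam" using lam by simp
  have "g \<in> eps_subdiff d (\<lambda>u. 1 / (r * lam) * N (u - x) powr r) 0 (x + h)"
    unfolding eps_subdiff_def
  proof (intro CollectI conjI ballI g)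
    fix z assume z: "z \<in> Rd d"
    have "1 / lam / r * N h powr r + dotp d g (z - x - h) \<le> 1 / lam / r * N (z - x) powr r"
      using norm_power_subgradI[OF r lam' h, of "z - x" g] eq le z x by simp
    moreover have "z - x - h = z - (x + h)" by simp
    ultimately show "1 / (r * lam) * N (z - x) powr r \<ge> 1 / (r * lam) * N (x + h - x) powr r + dotp d g (z - (x + h)) - 0"
      by (simp add: mult.commute)
  qed
  moreover have "dual_norm d N (v - - g) \<le> \<sigma> / lam * N h powr (r - 1)"
  proof (rule dual_norm_leI)
    fix u assume u: "u \<in> Rd d" "N u \<le> 1"
    have "dotp d (v - - g) u \<le> \<sigma> / lam * N h powr (r - 1) * N u" using err u by simp
    also have "\<dots> \<le> \<sigma> / lam * N h powr (r - 1) * 1"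
      using u lam \<sigma> by (intro mult_left_mono) auto
    finally show "dotp d (v - - g) u \<le> \<sigma> / lam * N h powr (r - 1)" by simp
  qed
  moreover have "v \<in> eps_subdiff d f \<epsilon> (x + h)" using v by (auto simp: eps_subdiff_def)
  ultimately show ?thesis
    unfolding prox_answer_def Nh using x h v \<epsilon> by (intro conjI exI[of _ \<epsilon>] bexI[of _ "- g"] imageI) auto
qed

lemma exists_min_poly_plus_power:
  assumes P: "polyfun d n P" and s: "real n < s" and c: "0 < c"
  shows "\<exists>x\<in>Rd d. \<forall>z\<in>Rd d. P x + c * N x powr s \<le> P z + c * N z powr s"
proof -
  obtain B where B: "0 \<le> B" "\<And>h. \<bar>P h\<bar> \<le> B * max 1 (N h) ^ n" using polyfun_growth[OF P] by blast
  \<comment> \<open>Beyond this radius the power exceeds \<open>2 * B * N h ^ n\<close>: one half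
    compensates the polynomial at \<open>h\<close>, the other its value at \<open>0\<close>.\<close>
  define \<rho> where "\<rho> = max 1 ((2 * B / c) powr (1 / (s - real n)))"
  show ?thesis
  proof (rule exists_min[where \<rho> = \<rho>])
    have "continuous_on UNIV (\<lambda>x. N x powr s)"
      using s N_ge0 by (intro continuous_on_powr'[OF N_cont continuous_on_const]) auto
    then show "continuous_on UNIV (\<lambda>x. P x + c * N x powr s)"
      by (intro continuous_on_add continuous_on_mult_left polyfun_cont[OF P])
  next
    fix h assume h: "h \<in> Rd d" "\<rho> < N h"
    have N1: "1 < N h" and "(2 * B / c) powr (1 / (s - real n)) \<le> N h" using h by (auto simp: \<rho>_def)
    then have "((2 * B / c) powr (1 / (s - real n))) powr (s - real n) \<le> N h powr (s - real n)"
      using s by (intro powr_mono2) auto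
    then have "2 * B \<le> c * N h powr (s - real n)"
      using s c B by (simp add: powr_powr field_simps)
    then have "2 * B * N h ^ n \<le> c * N h powr (s - real n) * N h ^ n"
      using N1 by (intro mult_right_mono) auto
    also have "\<dots> = c * N h powr s"
      using N1 by (simp add: powr_diff powr_realpow)
    finally have big: "2 * B * N h ^ n \<le> c * N h powr s" .
    have "P 0 \<le> B" using B(2)[of 0] by (simp add: N_0)
    moreover have "B * 1 \<le> B * N h ^ n" using B N1 by (intro mult_left_mono one_le_power) auto
    moreover have "- (B * N h ^ n) \<le> P h" using B(2)[of h] N1 by (simp add: max_def)
    ultimately show "P 0 + c * N 0 powr s \<le> P h + c * N h powr s"
      using big by (simp add: N_0)
  qed
qed

text \<open>The model is evaluated through \<open>ans\<close> alone, so the step is a legitimate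
  ingredient of the map \<open>Y\<close>. Minimizers exist but need not be unique, which the choice
  operator settles once and for all.\<close>

definition taylor_step :: "real \<Rightarrow> real \<Rightarrow> nat \<Rightarrow> (pt list \<Rightarrow> real) \<Rightarrow> pt"
  where "taylor_step M s q ans = (SOME h. h \<in> Rd d \<and> (\<forall>z\<in>Rd d.
    (\<Sum>k\<le>q. ans (replicate k h) / fact k) + M / s * N h powr s
      \<le> (\<Sum>k\<le>q. ans (replicate k z) / fact k) + M / s * N z powr s))"

definition ans_grad :: "(pt list \<Rightarrow> real) \<Rightarrow> pt"
  where "ans_grad ans = (\<lambda>i. if i < d then ans [unit_vec i] else 0)"

lemma ans_grad_oracle: "1 \<le> k \<Longrightarrow> ans_grad (order_oracle d f k x) = grad d f x"
  by (auto simp: ans_grad_def order_oracle_def grad_def fun_eq_iff unit_vec_def[symmetric] simp del: Dn.simps)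

text \<open>The Taylor polynomial need not be convex, so global minimality is used only
  infinitesimally. Moving from \<open>h\<close> a fraction \<open>t\<close> towards
  \<open>z\<close>, the power term changes by at most \<open>t\<close> times its total difference,
  by convexity, while the polynomial is differentiated. The result is a global subgradient
  inequality for the power.\<close>

lemma taylor_step_stationary:
  assumes f: "times_differentiable d q f" and x: "x \<in> Rd d" and s: "real q < s" "1 < s" and M: "0 < M"
  defines "h \<equiv> taylor_step M s q (order_oracle d f q x)"
  obtains g where "h \<in> Rd d" "g \<in> Rd d"
    "\<And>u. u \<in> Rd d \<Longrightarrow> ((\<lambda>t. taylor f q x (h + t *\<^sub>R u)) has_real_derivative dotp d g u) (at 0)"
    "dotp d (- g) h = M * N h powr s"
    "\<And>u. u \<in> Rd d \<Longrightarrow> dotp d (- g) u \<le> M * N h powr (s - 1) * N u"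
proof -
  obtain P where P: "polyfun d q P" "\<And>h. h \<in> Rd d \<Longrightarrow> taylor f q x h = P h"
    using taylor_polyfun[OF f x] by blast
  have T: "(\<Sum>k\<le>q. order_oracle d f q x (replicate k z) / fact k) = P z" if "z \<in> Rd d" for z
  proof -
    have "set (replicate k z) \<subseteq> Rd d" for k using that by auto
    then show ?thesis using P(2)[OF that] by (simp add: taylor_def order_oracle_def)
  qed
  have "\<exists>h. h \<in> Rd d \<and> (\<forall>z\<in>Rd d. P h + M / s * N h powr s \<le> P z + M / s * N z powr s)"
    using exists_min_poly_plus_power[OF P(1) s(1), of "M / s"] M s by auto
  then have "\<exists>h. h \<in> Rd d \<and> (\<forall>z\<in>Rd d.
    (\<Sum>k\<le>q. order_oracle d f q x (replicate k h) / fact k) + M / s * N h powr s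
      \<le> (\<Sum>k\<le>q. order_oracle d f q x (replicate k z) / fact k) + M / s * N z powr s)"
    using T by auto
  from someI_ex[OF this]
  have hR: "h \<in> Rd d" and hm: "\<And>z. z \<in> Rd d \<Longrightarrow> P h + M / s * N h powr s \<le> P z + M / s * N z powr s"
    unfolding h_def taylor_step_def[symmetric] using T by auto
  obtain g where g: "g \<in> Rd d" "\<And>u. ((\<lambda>t. P (h + t *\<^sub>R u)) has_real_derivative dotp d g u) (at 0)"
    using polyfun_deriv[OF P(1)] by blast
  have sub: "M / s * N h powr s + dotp d (- g) (z - h) \<le> M / s * N z powr s" if z: "z \<in> Rd d" for z
  proof -
    have "((\<lambda>t. - P (h + t *\<^sub>R (z - h))) has_real_derivative - dotp d g (z - h)) (at 0)"
      by (intro DERIV_minus g)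
    then have "- dotp d g (z - h) \<le> M / s * N z powr s - M / s * N h powr s"
    proof (rule deriv_le_if_slope_le)
      fix t :: real assume t: "0 < t" "t < 1"
      define w where "w = h + t *\<^sub>R (z - h)"
      have w: "w = t *\<^sub>R z + (1 - t) *\<^sub>R h" by (simp add: w_def algebra_simps)
      have "N w \<le> t * N z + (1 - t) * N h"
        using N_triangle[of "t *\<^sub>R z" "(1 - t) *\<^sub>R h"] t unfolding w by (simp add: N_scale)
      then have "N w powr s \<le> (t * N z + (1 - t) * N h) powr s"
        using s N_ge0 by (intro powr_mono2) auto
      also have "\<dots> \<le> t * N z powr s + (1 - t) * N h powr s"
        using s t N_ge0 by (intro powr_convex_comb) auto
      finally have "M / s * N w powr s \<le> M / s * (t * N z powr s + (1 - t) * N h powr s)"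
        using M s by (intro mult_left_mono) auto
      moreover have "P h + M / s * N h powr s \<le> P w + M / s * N w powr s"
        using hm[of w] hR z by (simp add: w_def)
      ultimately show "- P (h + t *\<^sub>R (z - h)) - - P (h + 0 *\<^sub>R (z - h)) \<le> t * (M / s * N z powr s - M / s * N h powr s)"
        unfolding w_def[symmetric] by (simp add: algebra_simps)
    qed
    then show ?thesis by (simp add: dotp_simps)
  qed
  have M': "0 \<le> M" using M by simp
  have "((\<lambda>t. taylor f q x (h + t *\<^sub>R u)) has_real_derivative dotp d g u) (at 0)" if "u \<in> Rd d" for u
    using g(2)[of u] P(2) hR that by simp
  then show thesis
    using that[of g] hR g(1) subgrad_norm_power[OF s(2) M' hR sub] by blast
qed

text \<open>The parameter \<open>lam\<close> is chosen so that \<open>M * N h powr (s - 1)\<close>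
  and \<open>N h powr (r - 1) / lam\<close> agree. If \<open>N h = 0\<close> both vanish, so any
  positive \<open>lam\<close> is admissible; it is prescribed only for a step that moves.\<close>

lemma taylor_prox_answer:
  assumes f: "times_differentiable d q f" "holder_deriv d N q L \<nu> f" "convex_on (Rd d) f"
    and q: "1 \<le> q" "0 < \<nu>" "0 \<le> L" and x: "x \<in> Rd d" and r: "1 < r" and \<sigma>: "0 \<le> \<sigma>"
    and C: "\<And>b M. (\<forall>t\<in>{0..1}. \<bar>\<Sum>j\<le>q. b j * t ^ j\<bar> \<le> M) \<Longrightarrow> (\<forall>j\<le>q. \<bar>b j\<bar> \<le> C * M)" "0 \<le> C"
    and M: "0 < M" "C * 2 * 2 powr (real q + \<nu>) * L \<le> \<sigma> * M" "L \<le> \<sigma>' * M"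
  defines "h \<equiv> taylor_step M (real q + \<nu>) q (order_oracle d f q x)"
  assumes lam: "0 < lam" "N h \<noteq> 0 \<Longrightarrow> lam = N h powr (r - (real q + \<nu>)) / M"
  shows "h \<in> Rd d" "prox_answer d N f r \<sigma> \<sigma>' x lam (x + h)
    (ans_grad (if q = 1 then order_oracle d f q x else order_oracle d f (min 1 (q - 1)) (x + h)))"
proof -
  define s where "s = real q + \<nu>"
  have s: "real q < s" "1 < s" using q by (auto simp: s_def)
  obtain g where hR: "h \<in> Rd d" and g: "g \<in> Rd d"
    "\<And>u. u \<in> Rd d \<Longrightarrow> ((\<lambda>t. taylor f q x (h + t *\<^sub>R u)) has_real_derivative dotp d g u) (at 0)"
    "dotp d (- g) h = M * N h powr s"
    "\<And>u. u \<in> Rd d \<Longrightarrow> dotp d (- g) u \<le> M * N h powr (s - 1) * N u"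
    using taylor_step_stationary[OF f(1) x s M(1)] unfolding h_def s_def by metis
  show "h \<in> Rd d" by (rule hR)
  have Ms: "M * N h powr s = N h powr r / lam" "M * N h powr (s - 1) = N h powr (r - 1) / lam"
  proof -
    have "M * N h powr s = N h powr r / lam \<and> M * N h powr (s - 1) = N h powr (r - 1) / lam"
    proof (cases "N h = 0")
      case False
      then have "0 < N h" using N_ge0[of h] by simp
      then have "N h powr (r - s) * N h powr s = N h powr r" "N h powr (r - s) * N h powr (s - 1) = N h powr (r - 1)"
        by (simp_all flip: powr_add)
      moreover have "N h powr (r - s) = M * lam"
        using lam(2)[OF False] M unfolding s_def[symmetric] by simp
      ultimately show ?thesis using lam(1) by (simp add: eq_divide_eq mult_ac)
    qed simp
    then show "M * N h powr s = N h powr r / lam" "M * N h powr (s - 1) = N h powr (r - 1) / lam" by auto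
  qed
  define v where "v = ans_grad (if q = 1 then order_oracle d f q x else order_oracle d f (min 1 (q - 1)) (x + h))"
  have "prox_answer d N f r \<sigma> \<sigma>' x lam (x + h) v"
  proof (cases "q = 1")
    case True
    \<comment> \<open>For \<open>q = 1\<close> the information at the new point has order
      \<open>0\<close>, so no gradient is available there. The gradient at \<open>x\<close> is the
      gradient of the model itself: the direction has no error, and the Taylor remainder becomes
      \<open>\<epsilon>\<close>.\<close>
    have v: "v = grad d f x" using True by (simp add: v_def ans_grad_oracle)
    have T: "taylor f q x w = f x + dotp d v w" if "w \<in> Rd d" for w
      using Dn_single[OF f(1) q(1) x that] True by (simp add: taylor_def v del: Dn.simps(2))
    have gv: "dotp d g u = dotp d v u" if u: "u \<in> Rd d" for u
    proof -
      have "(\<lambda>t. taylor f q x (h + t *\<^sub>R u)) = (\<lambda>t. f x + (dotp d v h + t * dotp d v u))"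
        using T hR u by (simp add: dotp_simps fun_eq_iff)
      moreover have "((\<lambda>t. f x + (dotp d v h + t * dotp d v u)) has_real_derivative dotp d v u) (at 0)"
        by (auto intro!: derivative_eq_intros)
      ultimately show ?thesis using g(2)[OF u] DERIV_unique by metis
    qed
    have rem: "f (x + h) - (f x + dotp d v h) \<le> L * N h powr s"
      using taylor_remainder[OF f(1,2) q x hR] T[OF hR] unfolding s_def by simp
    show ?thesis
    proof (rule prox_answerI[OF r lam(1) x hR, of "- g"])
      show "dotp d (- g) h = N h powr r / lam" using g(3) Ms by simp
      show "dotp d (- g) u \<le> N h powr (r - 1) / lam * N u" if "u \<in> Rd d" for u using g(4)[OF that] Ms by simp
      show "0 \<le> L * N h powr s" using q by simp
      have "L * N h powr s \<le> \<sigma>' * M * N h powr s" using M by (intro mult_right_mono) auto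
      also have "\<dots> = \<sigma>' / lam * N h powr r" using Ms by (simp add: mult.assoc)
      finally show "L * N h powr s \<le> \<sigma>' / lam * N h powr r" .
      show "f (x + h) + dotp d v (z - (x + h)) - L * N h powr s \<le> f z" if "z \<in> Rd d" for z
        using rem convex_grad[OF f(1) q(1) f(3) x that] by (simp add: v dotp_simps)
      show "dotp d (v + - g) u \<le> \<sigma> / lam * N h powr (r - 1) * N u" if "u \<in> Rd d" for u
        using gv[OF that] \<sigma> lam N_ge0[of u] by (simp add: dotp_simps)
    qed (use g v \<sigma> in auto)
  next
    case False
    then have v: "v = grad d f (x + h)" using q by (simp add: v_def ans_grad_oracle)
    have y: "x + h \<in> Rd d" using x hR by simp
    show ?thesis
    proof (rule prox_answerI[OF r lam(1) x hR, of "- g" _ 0])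
      show "dotp d (- g) h = N h powr r / lam" using g(3) Ms by simp
      show "dotp d (- g) u \<le> N h powr (r - 1) / lam * N u" if "u \<in> Rd d" for u using g(4)[OF that] Ms by simp
      have "0 \<le> \<sigma>'"
        using M q zero_le_mult_iff[of \<sigma>' M] by auto
      then show "0 \<le> \<sigma>' / lam * N h powr r" using lam by simp
      show "f (x + h) + dotp d v (z - (x + h)) - 0 \<le> f z" if "z \<in> Rd d" for z
        using convex_grad[OF f(1) q(1) f(3) y that] by (simp add: v)
      show "dotp d (v + - g) u \<le> \<sigma> / lam * N h powr (r - 1) * N u" if u: "u \<in> Rd d" for u
      proof -
        have "dotp d (v - g) u \<le> C * 2 * 2 powr s * L * N h powr (s - 1) * N u"
          using taylor_grad_error_dual[OF C f(1,2) q x hR u g(2)] unfolding v s_def by simp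
        also have "\<dots> \<le> \<sigma> * M * N h powr (s - 1) * N u"
          using M N_ge0 by (intro mult_right_mono) (auto simp: s_def)
        also have "\<dots> = \<sigma> / lam * N h powr (r - 1) * N u"
          using Ms by (simp add: mult.assoc)
        finally show ?thesis by simp
      qed
    qed (use g v \<sigma> in auto)
  qed
  then show "prox_answer d N f r \<sigma> \<sigma>' x lam (x + h)
    (ans_grad (if q = 1 then order_oracle d f q x else order_oracle d f (min 1 (q - 1)) (x + h)))"
    by (simp add: v_def)
qed

end

section \<open>The regularizer\<close>

definition abs_powr :: "real \<Rightarrow> real \<Rightarrow> real"
  where "abs_powr p t = \<bar>t\<bar> powr p"

definition abs_powr_deriv :: "real \<Rightarrow> real \<Rightarrow> real"
  where "abs_powr_deriv p t = p * (sgn t * \<bar>t\<bar> powr (p - 1))"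

lemma DERIV_abs_powr:
  assumes p: "1 < p"
  shows "(abs_powr p has_real_derivative abs_powr_deriv p t) (at t)"
proof -
  consider "0 < t" | "t < 0" | "t = 0" by linarith
  then show ?thesis
  proof cases
    case 1
    have "((\<lambda>t. t powr p) has_real_derivative p * t powr (p - 1)) (at t)"
      using 1 by (rule has_real_derivative_powr)
    then have "((\<lambda>t. t powr p) has_real_derivative abs_powr_deriv p t) (at t)" using 1 by (simp add: abs_powr_deriv_def)
    then show ?thesis
      by (rule has_field_derivative_transform_within_open[of _ _ _ "{0<..}"]) (use 1 in \<open>auto simp: abs_powr_def\<close>)
  next
    case 2
    have "((\<lambda>t. t powr p) has_real_derivative p * (- t) powr (p - 1)) (at (- t))"
      using 2 by (intro has_real_derivative_powr) auto
    then have "((\<lambda>t. (- t) powr p) has_real_derivative p * (- t) powr (p - 1) * (- 1)) (at t)"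
      by (rule DERIV_chain2) (auto intro!: derivative_eq_intros)
    then have "((\<lambda>t. (- t) powr p) has_real_derivative abs_powr_deriv p t) (at t)" using 2 by (simp add: abs_powr_deriv_def)
    then show ?thesis
      by (rule has_field_derivative_transform_within_open[of _ _ _ "{..<0}"]) (use 2 in \<open>auto simp: abs_powr_def\<close>)
  next
    case 3
    have "((\<lambda>h::real. sgn h * \<bar>h\<bar> powr (p - 1)) \<longlongrightarrow> 0) (at 0)"
    proof (rule tendsto_rabs_zero_cancel)
      have "((\<lambda>h::real. \<bar>h\<bar> powr (p - 1)) \<longlongrightarrow> \<bar>0\<bar> powr (p - 1)) (at 0)"
        using p by (intro tendsto_powr2 tendsto_rabs tendsto_ident_at tendsto_const) auto
      then have "((\<lambda>h::real. \<bar>h\<bar> powr (p - 1)) \<longlongrightarrow> 0) (at 0)" by simp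
      then show "((\<lambda>h::real. \<bar>sgn h * \<bar>h\<bar> powr (p - 1)\<bar>) \<longlongrightarrow> 0) (at 0)"
        by (rule Lim_transform_eventually) (auto simp: eventually_at_filter abs_mult sgn_if)
    qed
    then have "((\<lambda>h. (abs_powr p (0 + h) - abs_powr p 0) / h) \<longlongrightarrow> 0) (at 0)"
    proof (rule Lim_transform_eventually)
      have "sgn h * \<bar>h\<bar> powr (p - 1) = (abs_powr p (0 + h) - abs_powr p 0) / h" if "h \<noteq> 0" for h
      proof -
        have "\<bar>h\<bar> powr p = \<bar>h\<bar> * \<bar>h\<bar> powr (p - 1)" by (simp add: powr_mult_base)
        then show ?thesis using that by (auto simp: abs_powr_def sgn_if)
      qed
      then show "\<forall>\<^sub>F h in at 0. sgn h * \<bar>h\<bar> powr (p - 1) = (abs_powr p (0 + h) - abs_powr p 0) / h"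
        by (auto simp: eventually_at_filter)
    qed
    then show ?thesis using 3 by (simp add: DERIV_def abs_powr_deriv_def)
  qed
qed

lemma abs_powr_ge_tangent:
  assumes p: "1 < p"
  shows "abs_powr p y + abs_powr_deriv p y * (z - y) \<le> abs_powr p z"
proof -
  have "sgn y * (z - y) \<le> \<bar>z\<bar> - \<bar>y\<bar>" by (auto simp: sgn_if)
  then have "p * \<bar>y\<bar> powr (p - 1) * (sgn y * (z - y)) \<le> p * \<bar>y\<bar> powr (p - 1) * (\<bar>z\<bar> - \<bar>y\<bar>)"
    using p by (intro mult_left_mono) auto
  then show ?thesis using powr_ge_tangent[OF p, of "\<bar>z\<bar>" "\<bar>y\<bar>"] by (simp add: abs_powr_def abs_powr_deriv_def mult_ac)
qed

text \<open>With \<open>e = p / 2\<close>, powers of exponent \<open>e \<ge> 1\<close> are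
  superadditive on the squares of the half sum and the half difference. By the parallelogram law
  these squares add up to the mean of the squares of \<open>x\<close> and \<open>y\<close>, and
  convexity of the power finishes.\<close>

lemma clarkson_scalar:
  assumes p: "2 \<le> p"
  shows "abs_powr p ((x + y) / 2) + abs_powr p ((x - y) / 2) \<le> (abs_powr p x + abs_powr p y) / 2"
proof -
  define e where "e = p / 2"
  have e: "1 \<le> e" using p by (simp add: e_def)
  have sq: "abs_powr p t = (t\<^sup>2) powr e" for t
  proof -
    have "\<bar>t\<bar> powr 2 = t\<^sup>2" by (cases "t = 0") simp_all
    then have "(t\<^sup>2) powr e = \<bar>t\<bar> powr (2 * e)" by (metis powr_powr)
    then show ?thesis by (simp add: abs_powr_def e_def)
  qed
  define u w where "u = ((x + y) / 2)\<^sup>2" and "w = ((x - y) / 2)\<^sup>2"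
  have uw: "0 \<le> u" "0 \<le> w" by (simp_all add: u_def w_def)
  have uw_sum: "u + w = 1 / 2 * x\<^sup>2 + (1 - 1 / 2) * y\<^sup>2"
    by (simp add: u_def w_def power2_eq_square field_simps)
  have pe: "a powr e = a * a powr (e - 1)" if "0 \<le> a" for a :: real using that by (simp add: powr_mult_base)
  have "u powr e + w powr e \<le> u * (u + w) powr (e - 1) + w * (u + w) powr (e - 1)"
    unfolding pe[OF uw(1)] pe[OF uw(2)] using uw e by (intro add_mono mult_left_mono powr_mono2) auto
  also have "\<dots> = (u + w) powr e" using pe[of "u + w"] uw by (simp add: distrib_right)
  also have "\<dots> \<le> 1 / 2 * (x\<^sup>2) powr e + (1 - 1 / 2) * (y\<^sup>2) powr e"
  proof (cases "e = 1")
    case False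
    then show ?thesis unfolding uw_sum using e by (intro powr_convex_comb) auto
  qed (use uw uw_sum in simp)
  finally show ?thesis by (simp add: sq u_def w_def)
qed

text \<open>The tangent at \<open>y\<close> is compared with the function at the midpoint only; the
  Clarkson inequality supplies the gap.\<close>

lemma abs_powr_uniform_convex_ge2:
  assumes p: "2 \<le> p"
  shows "2 powr (1 - p) * abs_powr p (x - y) \<le> abs_powr p x - abs_powr p y - abs_powr_deriv p y * (x - y)"
proof -
  have "abs_powr p y + abs_powr_deriv p y * ((x + y) / 2 - y) \<le> abs_powr p ((x + y) / 2)" using p by (intro abs_powr_ge_tangent) auto
  then have "abs_powr p y + abs_powr_deriv p y * (x - y) / 2 \<le> abs_powr p ((x + y) / 2)" by (simp add: field_simps)
  moreover have "abs_powr p ((x - y) / 2) = 2 powr (1 - p) / 2 * abs_powr p (x - y)"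
    using p by (simp add: abs_powr_def powr_divide powr_diff)
  ultimately show ?thesis using clarkson_scalar[OF p, of x y] by simp
qed

text \<open>On \<open>\<bar>t\<bar> \<le> M\<close> the second derivative
  \<open>p * (p - 1) * \<bar>t\<bar> powr (p - 2)\<close> is smallest at the ends. It blows up at
  \<open>0\<close>, so the argument stays with first derivatives: after subtraction of a quadratic
  the derivative is \<open>p * j\<close>, and \<open>j\<close> is monotone by concavity of the power
  \<open>p - 1\<close>.\<close>

lemma abs_powr_uniform_convex_lt2:
  assumes p: "1 < p" "p < 2"
  shows "p * (p - 1) / 2 * ((x - y)\<^sup>2 * (\<bar>x\<bar> + \<bar>y\<bar>) powr (p - 2)) \<le> abs_powr p x - abs_powr p y - abs_powr_deriv p y * (x - y)"
proof (cases "x = y")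
  case False
  define M where "M = \<bar>x\<bar> + \<bar>y\<bar>"
  have M: "0 < M" using False by (auto simp: M_def)
  define K where "K = (p - 1) * M powr (p - 2)"
  define j where "j t = sgn t * \<bar>t\<bar> powr (p - 1) - K * t" for t
  have jpos: "j s \<le> j t" if st: "0 \<le> s" "s < t" "t \<le> M" for s t
  proof -
    have "s powr (p - 1) \<le> t powr (p - 1) + (p - 1) * t powr (p - 1 - 1) * (s - t)"
      using p st by (intro powr_le_tangent) auto
    moreover have "(p - 1) * M powr (p - 2) * (t - s) \<le> (p - 1) * t powr (p - 2) * (t - s)"
      using p st by (intro mult_right_mono mult_left_mono powr_mono2') auto
    ultimately have "s powr (p - 1) + K * (t - s) \<le> t powr (p - 1)"
      by (simp add: K_def algebra_simps)
    then show ?thesis using st by (auto simp: j_def sgn_if algebra_simps)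
  qed
  have jneg: "j (- t) = - j t" for t by (simp add: j_def)
  have j0: "j 0 = 0" by (simp add: j_def)
  have mono: "j s \<le> j t" if st: "s \<le> t" "\<bar>s\<bar> \<le> M" "\<bar>t\<bar> \<le> M" for s t
  proof -
    consider "s = t" | "0 \<le> s" "s < t" | "s < 0" "0 \<le> t" | "s < t" "t < 0" using st by linarith
    then show ?thesis
    proof cases
      case 2
      then show ?thesis using jpos st by auto
    next
      case 3
      have "0 \<le> j t" using jpos[of 0 t] 3 st j0 by (cases "t = 0") auto
      moreover have "0 \<le> j (- s)" using jpos[of 0 "- s"] 3 st j0 by auto
      ultimately show ?thesis by (simp add: jneg)
    next
      case 4
      then have "j (- t) \<le> j (- s)" using st by (intro jpos) auto
      then show ?thesis by (simp add: jneg)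
    qed simp
  qed
  define k where "k t = abs_powr p t - p * K / 2 * t\<^sup>2" for t
  have D: "(k has_real_derivative p * j t) (at t)" for t
    unfolding k_def j_def by (auto intro!: derivative_eq_intros DERIV_abs_powr p simp: abs_powr_deriv_def algebra_simps)
  have "k x - k y \<ge> p * j y * (x - y)"
  proof (cases "y < x")
    case True
    obtain \<xi> where \<xi>: "y < \<xi>" "\<xi> < x" "k x - k y = (x - y) * (p * j \<xi>)"
      using MVT2[of y x k "\<lambda>t. p * j t"] True D by auto
    have "j y \<le> j \<xi>" using \<xi> by (intro mono) (auto simp: M_def)
    then have "(x - y) * (p * j y) \<le> (x - y) * (p * j \<xi>)" using p \<xi> by (intro mult_left_mono) auto
    then show ?thesis using \<xi> by (simp add: mult_ac)
  next
    case False
    then have lt: "x < y" using \<open>x \<noteq> y\<close> by simp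
    obtain \<xi> where \<xi>: "x < \<xi>" "\<xi> < y" "k y - k x = (y - x) * (p * j \<xi>)"
      using MVT2[of x y k "\<lambda>t. p * j t"] lt D by auto
    have "j \<xi> \<le> j y" using \<xi> by (intro mono) (auto simp: M_def)
    then have "(y - x) * (p * j \<xi>) \<le> (y - x) * (p * j y)" using p \<xi> by (intro mult_left_mono) auto
    then show ?thesis using \<xi> by (simp add: algebra_simps)
  qed
  then show ?thesis
    by (simp add: k_def j_def abs_powr_deriv_def K_def M_def power2_eq_square field_simps)
qed (simp)

section \<open>Frechet derivatives of separable sums and compositions\<close>

lemma frechet_separable:
  fixes g :: "nat \<Rightarrow> real \<Rightarrow> real"
  assumes D: "\<And>i. i < d \<Longrightarrow> (g i has_real_derivative g' i) (at (x i))"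
  shows "frechet_at d (\<lambda>x. \<Sum>i<d. g i (x i)) (\<lambda>h. \<Sum>i<d. g' i * h i) x"
  unfolding frechet_at_def
proof (intro conjI ballI allI impI)
  fix u w a b
  show "(\<Sum>i<d. g' i * (a *\<^sub>R u + b *\<^sub>R w) i) = a * (\<Sum>i<d. g' i * u i) + b * (\<Sum>i<d. g' i * w i)"
    by (simp add: pt_apply algebra_simps sum.distrib sum_distrib_left)
next
  fix e :: real assume e: "0 < e"
  define e' where "e' = e / (real d + 1)"
  have e': "0 < e'" "real d * e' \<le> e" using e by (auto simp: e'_def field_simps)
  have "\<exists>\<delta>>0. \<forall>t. \<bar>t\<bar> < \<delta> \<longrightarrow> \<bar>g i (x i + t) - g i (x i) - g' i * t\<bar> \<le> e' * \<bar>t\<bar>" if "i < d" for i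
  proof -
    have "(g i has_derivative (*) (g' i)) (at (x i))"
      using D[OF that] by (simp add: has_field_derivative_def)
    then obtain \<delta> where \<delta>: "\<delta> > 0" "\<And>y. norm (y - x i) < \<delta> \<Longrightarrow> norm (g i y - g i (x i) - g' i * (y - x i)) \<le> e' * norm (y - x i)"
      using e'(1) unfolding has_derivative_at_alt by metis
    show ?thesis
      using \<delta>(1) \<delta>(2)[of "x i + t" for t] by (intro exI[of _ \<delta>]) auto
  qed
  then obtain \<delta> where \<delta>: "\<And>i. i < d \<Longrightarrow> \<delta> i > 0"
    "\<And>i t. i < d \<Longrightarrow> \<bar>t\<bar> < \<delta> i \<Longrightarrow> \<bar>g i (x i + t) - g i (x i) - g' i * t\<bar> \<le> e' * \<bar>t\<bar>" by metis
  define \<Delta> where "\<Delta> = Min (insert 1 (\<delta> ` {..<d}))"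
  have \<Delta>: "0 < \<Delta>" using \<delta>(1) by (auto simp: \<Delta>_def)
  have \<Delta>i: "\<Delta> \<le> \<delta> i" if "i < d" for i using that by (auto simp: \<Delta>_def)
  have "\<bar>(\<Sum>i<d. g i ((x + h) i)) - (\<Sum>i<d. g i (x i)) - (\<Sum>i<d. g' i * h i)\<bar> \<le> e * L2_set h {..<d}"
    if h: "L2_set h {..<d} < \<Delta>" for h
  proof -
    have hi: "\<bar>h i\<bar> \<le> L2_set h {..<d}" if "i < d" for i
    proof -
      have "\<bar>h i\<bar> \<le> L2_set (\<lambda>i. \<bar>h i\<bar>) {..<d}" using that by (intro member_le_L2_set) auto
      then show ?thesis by (simp add: L2_set_def)
    qed
    have "\<bar>(\<Sum>i<d. g i ((x + h) i)) - (\<Sum>i<d. g i (x i)) - (\<Sum>i<d. g' i * h i)\<bar>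
        = \<bar>\<Sum>i<d. g i (x i + h i) - g i (x i) - g' i * h i\<bar>"
      by (simp add: sum_subtractf pt_apply)
    also have "\<dots> \<le> (\<Sum>i<d. \<bar>g i (x i + h i) - g i (x i) - g' i * h i\<bar>)" by (rule sum_abs)
    also have "\<dots> \<le> (\<Sum>i<d. e' * L2_set h {..<d})"
    proof (rule sum_mono)
      fix i assume "i \<in> {..<d}"
      then have i: "i < d" by simp
      have "\<bar>h i\<bar> < \<delta> i" using hi[OF i] h \<Delta>i[OF i] by linarith
      then have "\<bar>g i (x i + h i) - g i (x i) - g' i * h i\<bar> \<le> e' * \<bar>h i\<bar>" using \<delta>(2) i by blast
      also have "\<dots> \<le> e' * L2_set h {..<d}" using hi[OF i] e' by (intro mult_left_mono) auto
      finally show "\<bar>g i (x i + h i) - g i (x i) - g' i * h i\<bar> \<le> e' * L2_set h {..<d}" .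
    qed
    also have "\<dots> = real d * e' * L2_set h {..<d}" by simp
    also have "\<dots> \<le> e * L2_set h {..<d}" using e' by (intro mult_right_mono) (auto simp: L2_set_nonneg)
    finally show ?thesis .
  qed
  then show "\<exists>\<delta>>0. \<forall>h\<in>Rd d. L2_set h {..<d} < \<delta> \<longrightarrow>
      \<bar>(\<Sum>i<d. g i ((x + h) i)) - (\<Sum>i<d. g i (x i)) - (\<Sum>i<d. g' i * h i)\<bar> \<le> e * L2_set h {..<d}"
    using \<Delta> by blast
qed

text \<open>\<open>G\<close> is differentiated within \<open>{0..}\<close> because the outer
  function will be a multiple of \<open>u powr (2 / p)\<close>, and the inner sum reaches the
  boundary value \<open>0\<close> at the center.\<close>

lemma frechet_compose:
  assumes F: "frechet_at d F F' x" and K: "0 \<le> K" "\<And>h. h \<in> Rd d \<Longrightarrow> \<bar>F' h\<bar> \<le> K * L2_set h {..<d}"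
    and nn: "\<And>z. 0 \<le> F z" and G: "(G has_real_derivative G') (at (F x) within {0..})"
  shows "frechet_at d (\<lambda>x. G (F x)) (\<lambda>h. G' * F' h) x"
  unfolding frechet_at_def
proof (intro conjI ballI allI impI)
  fix u w a b assume uw: "u \<in> Rd d" "w \<in> Rd d"
  have "F' (a *\<^sub>R u + b *\<^sub>R w) = a * F' u + b * F' w"
    using F uw unfolding frechet_at_def by blast
  then show "G' * F' (a *\<^sub>R u + b *\<^sub>R w) = a * (G' * F' u) + b * (G' * F' w)" by (simp add: algebra_simps)
next
  fix e :: real assume e: "0 < e"
  define e1 where "e1 = min 1 (e / (2 * (\<bar>G'\<bar> + 1)))"
  define e2 where "e2 = e / (2 * (K + 1))"
  have e1: "0 < e1" "e1 \<le> 1" "\<bar>G'\<bar> * e1 \<le> e / 2"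
  proof -
    show "0 < e1" "e1 \<le> 1" using e by (auto simp: e1_def)
    have "\<bar>G'\<bar> * e1 \<le> (\<bar>G'\<bar> + 1) * (e / (2 * (\<bar>G'\<bar> + 1)))"
      using e by (intro mult_mono) (auto simp: e1_def)
    also have "\<dots> = e / 2" by (simp add: field_simps add_nonneg_eq_0_iff)
    finally show "\<bar>G'\<bar> * e1 \<le> e / 2" .
  qed
  have e2: "0 < e2" "e2 * (K + 1) = e / 2" using e K by (auto simp: e2_def field_simps)
  obtain \<delta>1 where \<delta>1: "\<delta>1 > 0" "\<And>h. h \<in> Rd d \<Longrightarrow> L2_set h {..<d} < \<delta>1 \<Longrightarrow> \<bar>F (x + h) - F x - F' h\<bar> \<le> e1 * L2_set h {..<d}"
    using F e1(1) unfolding frechet_at_def by metis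
  have "(G has_derivative (*) G') (at (F x) within {0..})" using G by (simp add: has_field_derivative_def)
  then obtain \<delta>2 where \<delta>2: "\<delta>2 > 0" "\<And>y. y \<in> {0..} \<Longrightarrow> norm (y - F x) < \<delta>2 \<Longrightarrow> norm (G y - G (F x) - G' * (y - F x)) \<le> e2 * norm (y - F x)"
    using e2(1) unfolding has_derivative_within_alt by metis
  define \<Delta> where "\<Delta> = min \<delta>1 (\<delta>2 / (K + 1))"
  have \<Delta>: "0 < \<Delta>" using \<delta>1 \<delta>2 K by (simp add: \<Delta>_def)
  have "\<bar>G (F (x + h)) - G (F x) - G' * F' h\<bar> \<le> e * L2_set h {..<d}" if h: "h \<in> Rd d" "L2_set h {..<d} < \<Delta>" for h
  proof -
    define l where "l = L2_set h {..<d}"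
    have l: "0 \<le> l" "l < \<delta>1" "l < \<delta>2 / (K + 1)" using h by (auto simp: l_def \<Delta>_def L2_set_nonneg)
    define u where "u = F (x + h) - F x"
    have u1: "\<bar>u - F' h\<bar> \<le> e1 * l" using \<delta>1(2)[OF h(1)] l by (simp add: l_def u_def)
    also have "\<dots> \<le> 1 * l" using e1 l by (intro mult_right_mono) auto
    finally have ul: "\<bar>u\<bar> \<le> (K + 1) * l" using K(2)[OF h(1)] by (simp add: l_def distrib_right)
    also have "(K + 1) * l < \<delta>2" using l K by (simp add: field_simps)
    finally have "\<bar>G (F (x + h)) - G (F x) - G' * u\<bar> \<le> e2 * \<bar>u\<bar>"
      using \<delta>2(2)[of "F (x + h)"] nn by (simp add: u_def)
    also have "\<dots> \<le> e2 * ((K + 1) * l)" using ul e2 by (intro mult_left_mono) auto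
    also have "\<dots> = e / 2 * l" using e2(2) by (metis mult.assoc)
    finally have a: "\<bar>G (F (x + h)) - G (F x) - G' * u\<bar> \<le> e / 2 * l" .
    have "\<bar>G' * (u - F' h)\<bar> \<le> \<bar>G'\<bar> * (e1 * l)" using u1 by (simp add: abs_mult mult_left_mono)
    also have "\<dots> \<le> e / 2 * l" using e1 l mult_right_mono[of "\<bar>G'\<bar> * e1" "e / 2" l] by (simp add: mult.assoc)
    finally have b: "\<bar>G' * (u - F' h)\<bar> \<le> e / 2 * l" .
    have "G (F (x + h)) - G (F x) - G' * F' h = (G (F (x + h)) - G (F x) - G' * u) + G' * (u - F' h)"
      by (simp add: algebra_simps)
    then have "\<bar>G (F (x + h)) - G (F x) - G' * F' h\<bar> \<le> e / 2 * l + e / 2 * l"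
      using abs_triangle_ineq[of "G (F (x + h)) - G (F x) - G' * u" "G' * (u - F' h)"] a b by linarith
    then show ?thesis by (simp add: l_def)
  qed
  then show "\<exists>\<delta>>0. \<forall>h\<in>Rd d. L2_set h {..<d} < \<delta> \<longrightarrow> \<bar>G (F (x + h)) - G (F x) - G' * F' h\<bar> \<le> e * L2_set h {..<d}"
    using \<Delta> by blast
qed

lemma frechet_times_differentiable:
  assumes F: "\<And>x. x \<in> Rd d \<Longrightarrow> frechet_at d F (F' x) x"
  shows "times_differentiable d 1 F" "x \<in> Rd d \<Longrightarrow> u \<in> Rd d \<Longrightarrow> dotp d (grad d F x) u = F' x u"
proof -
  have Dn: "Dn F [h] x = F' x h" if "x \<in> Rd d" "h \<in> Rd d" for x h
    using DERIV_imp_deriv[OF frechet_line[OF F[OF that(1)] that(2)]] by simp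
  show td: "times_differentiable d 1 F"
    unfolding times_differentiable_def
  proof (intro allI impI)
    fix vs :: "pt list" and x assume "length vs < 1" and x: "x \<in> Rd d"
    then have vs: "vs = []" by simp
    have "frechet_at d F (\<lambda>h. Dn F [h] x) x"
      unfolding frechet_at_def
    proof (intro conjI ballI allI)
      fix u w a b assume "u \<in> Rd d" "w \<in> Rd d"
      then show "Dn F [a *\<^sub>R u + b *\<^sub>R w] x = a * Dn F [u] x + b * Dn F [w] x"
        using F[OF x] x unfolding frechet_at_def by (simp add: Dn del: Dn.simps)
    next
      fix e :: real
      show "0 < e \<longrightarrow> (\<exists>\<delta>>0. \<forall>h\<in>Rd d. L2_set h {..<d} < \<delta> \<longrightarrow> \<bar>F (x + h) - F x - Dn F [h] x\<bar> \<le> e * L2_set h {..<d})"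
        using F[OF x] x unfolding frechet_at_def by (simp add: Dn del: Dn.simps)
    qed
    then show "frechet_at d (Dn F vs) (\<lambda>h. Dn F (h # vs) x) x"
      unfolding vs using Dn.simps(1)[of F] by (metis ext)
  qed
  show "dotp d (grad d F x) u = F' x u" if "x \<in> Rd d" "u \<in> Rd d"
    using Dn_single[OF td order.refl that] Dn[OF that] by simp
qed

section \<open>The regularizer and its gradient\<close>

definition reg_sum :: "nat \<Rightarrow> real \<Rightarrow> pt \<Rightarrow> pt \<Rightarrow> real"
  where "reg_sum d p x0 x = (\<Sum>i<d. abs_powr p (x i - x0 i))"

definition reg_sum_deriv :: "nat \<Rightarrow> real \<Rightarrow> pt \<Rightarrow> pt \<Rightarrow> pt \<Rightarrow> real"
  where "reg_sum_deriv d p x0 x h = (\<Sum>i<d. abs_powr_deriv p (x i - x0 i) * h i)"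

lemma reg_sum_pnorm: "0 < p \<Longrightarrow> reg_sum d p x0 x = pnorm d p (x - x0) powr p"
  by (simp add: pnorm_powr reg_sum_def abs_powr_def)

lemma frechet_reg_sum:
  assumes p: "1 < p"
  shows "frechet_at d (reg_sum d p x0) (reg_sum_deriv d p x0 x) x"
proof -
  have "((\<lambda>t. abs_powr p (t - x0 i)) has_real_derivative abs_powr_deriv p (x i - x0 i) * 1) (at (x i))" for i
    by (rule DERIV_chain2[OF DERIV_abs_powr[OF p]]) (auto intro!: derivative_eq_intros)
  then have "frechet_at d (\<lambda>x. \<Sum>i<d. abs_powr p (x i - x0 i)) (\<lambda>h. \<Sum>i<d. abs_powr_deriv p (x i - x0 i) * h i) x"
    by (intro frechet_separable) auto
  then show ?thesis by (simp add: reg_sum_def[abs_def] reg_sum_deriv_def[abs_def])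
qed

lemma reg_sum_deriv_bound: "\<bar>reg_sum_deriv d p x0 x h\<bar> \<le> (\<Sum>i<d. \<bar>abs_powr_deriv p (x i - x0 i)\<bar>) * L2_set h {..<d}"
  unfolding reg_sum_deriv_def sum_distrib_right
proof (rule order.trans[OF sum_abs sum_mono])
  fix i assume "i \<in> {..<d}"
  then have "\<bar>h i\<bar> \<le> L2_set (\<lambda>i. \<bar>h i\<bar>) {..<d}" by (intro member_le_L2_set) auto
  then have "\<bar>h i\<bar> \<le> L2_set h {..<d}" by (simp add: L2_set_def)
  then show "\<bar>abs_powr_deriv p (x i - x0 i) * h i\<bar> \<le> \<bar>abs_powr_deriv p (x i - x0 i)\<bar> * L2_set h {..<d}"
    by (simp add: abs_mult mult_left_mono)
qed

definition regularizer :: "nat \<Rightarrow> real \<Rightarrow> real \<Rightarrow> pt \<Rightarrow> pt \<Rightarrow> real"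
  where "regularizer d p c x0 x = c * pnorm d p (x - x0) powr max 2 p"

lemma regularizer_frechet_ge2:
  assumes p: "2 \<le> p"
  shows "frechet_at d (regularizer d p c x0) (\<lambda>h. c * reg_sum_deriv d p x0 x h) x"
proof -
  have "frechet_at d (\<lambda>x. (\<lambda>u. c * u) (reg_sum d p x0 x)) (\<lambda>h. c * reg_sum_deriv d p x0 x h) x"
  proof (rule frechet_compose[OF frechet_reg_sum _ reg_sum_deriv_bound])
    show "((*) c has_real_derivative c) (at (reg_sum d p x0 x) within {0..})"
      by (auto intro!: derivative_eq_intros)
  qed (use p in \<open>auto simp: reg_sum_def abs_powr_def intro!: sum_nonneg\<close>)
  moreover have "(\<lambda>x. c * reg_sum d p x0 x) = regularizer d p c x0"
    using p by (auto simp: regularizer_def reg_sum_pnorm)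
  ultimately show ?thesis by simp
qed

lemma DERIV_powr_nonneg:
  fixes e u :: real
  assumes e: "1 < e" and u: "0 \<le> u"
  shows "((\<lambda>u. u powr e) has_real_derivative e * u powr (e - 1)) (at u within {0..})"
proof (cases "u = 0")
  case False
  then have "((\<lambda>u. u powr e) has_real_derivative e * u powr (e - 1)) (at u)"
    using u by (intro has_real_derivative_powr) auto
  then show ?thesis by (rule has_field_derivative_at_within)
next
  case True
  have "(abs_powr e has_real_derivative abs_powr_deriv e 0) (at 0 within {0..})"
    by (rule has_field_derivative_at_within[OF DERIV_abs_powr[OF e]])
  then have "((\<lambda>u. u powr e) has_real_derivative abs_powr_deriv e 0) (at 0 within {0..})"
    by (rule has_field_derivative_transform_within[of _ _ _ _ 1]) (auto simp: abs_powr_def)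
  then show ?thesis using True by (simp add: abs_powr_deriv_def)
qed

lemma regularizer_frechet_lt2:
  assumes p: "1 < p" "p < 2"
  shows "frechet_at d (regularizer d p c x0)
    (\<lambda>h. c * (2 / p * pnorm d p (x - x0) powr (2 - p)) * reg_sum_deriv d p x0 x h) x"
proof -
  have "frechet_at d (\<lambda>x. c * (reg_sum d p x0 x) powr (2 / p))
    (\<lambda>h. c * (2 / p * pnorm d p (x - x0) powr (2 - p)) * reg_sum_deriv d p x0 x h) x"
  proof (rule frechet_compose[OF frechet_reg_sum _ reg_sum_deriv_bound, where G = "\<lambda>u. c * u powr (2 / p)"])
    have "reg_sum d p x0 x powr (2 / p - 1) = pnorm d p (x - x0) powr (2 - p)"
      using p by (simp add: reg_sum_pnorm powr_powr right_diff_distrib)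
    then show "((\<lambda>u. c * u powr (2 / p)) has_real_derivative c * (2 / p * pnorm d p (x - x0) powr (2 - p)))
        (at (reg_sum d p x0 x) within {0..})"
      using DERIV_cmult[OF DERIV_powr_nonneg[of "2 / p" "reg_sum d p x0 x"], of c] p
      by (simp add: reg_sum_pnorm)
  qed (use p in \<open>auto simp: reg_sum_def abs_powr_def intro!: sum_nonneg\<close>)
  moreover have "(\<lambda>x. c * (reg_sum d p x0 x) powr (2 / p)) = regularizer d p c x0"
    using p by (auto simp: regularizer_def reg_sum_pnorm powr_powr)
  ultimately show ?thesis by simp
qed

lemma reg_sum_deriv_center: "reg_sum_deriv d p x0 x0 h = 0"
  by (simp add: reg_sum_deriv_def abs_powr_deriv_def)

section \<open>Uniform convexity of the regularizer\<close>

text \<open>Hoelder's inequality for the factorization of \<open>\<bar>D i\<bar> powr p\<close> into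
  the power \<open>p / 2\<close> of \<open>(D i)\<^sup>2 * W i powr (p - 2)\<close> and the power
  \<open>1 - p / 2\<close> of \<open>W i powr p\<close>, proved by weighted Young for each
  normalized summand. The bound on \<open>D\<close> makes \<open>W i\<close> positive wherever
  \<open>D i\<close> is nonzero.\<close>

lemma holder_sum_lt2:
  fixes D W :: "nat \<Rightarrow> real" and p :: real
  assumes p: "1 < p" "p < 2" and W: "\<And>i. i < d \<Longrightarrow> \<bar>D i\<bar> \<le> W i"
  shows "(\<Sum>i<d. \<bar>D i\<bar> powr p) powr (2 / p)
    \<le> (\<Sum>i<d. (D i)\<^sup>2 * W i powr (p - 2)) * (\<Sum>i<d. W i powr p) powr ((2 - p) / p)"
proof -
  define Q where "Q = (\<Sum>i<d. (D i)\<^sup>2 * W i powr (p - 2))"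
  define V where "V = (\<Sum>i<d. W i powr p)"
  have nn: "0 \<le> Q" "0 \<le> V" by (auto simp: Q_def V_def intro!: sum_nonneg)
  show ?thesis
  proof (cases "Q = 0")
    case True
    have "D i = 0" if i: "i < d" for i
    proof (rule ccontr)
      assume "D i \<noteq> 0"
      then have "0 < (D i)\<^sup>2 * W i powr (p - 2)" using W[OF i] by auto
      moreover have "(D i)\<^sup>2 * W i powr (p - 2) \<le> Q" unfolding Q_def using i by (intro member_le_sum) auto
      ultimately show False using True by simp
    qed
    then show ?thesis using True by (simp add: Q_def)
  next
    case False
    then have Q: "0 < Q" using nn by simp
    have V: "0 < V"
    proof (rule ccontr)
      assume "\<not> 0 < V"
      then have "V = 0" using nn by simp
      then have "W i = 0" if "i < d" for i using that by (simp add: V_def sum_nonneg_eq_0_iff)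
      then have "Q = 0" by (simp add: Q_def)
      then show False using Q by simp
    qed
    have each: "\<bar>D i\<bar> powr p / (Q powr (p / 2) * V powr (1 - p / 2))
        \<le> p / 2 * ((D i)\<^sup>2 * W i powr (p - 2) / Q) + (1 - p / 2) * (W i powr p / V)" if i: "i < d" for i
    proof (cases "D i = 0")
      case True
      then show ?thesis using p V by simp
    next
      case False
      then have Di: "0 < \<bar>D i\<bar>" and Wi: "0 < W i" using W[OF i] by auto
      have "((D i)\<^sup>2 * W i powr (p - 2) / Q) powr (p / 2) * (W i powr p / V) powr (1 - p / 2)
          \<le> p / 2 * ((D i)\<^sup>2 * W i powr (p - 2) / Q) + (1 - p / 2) * (W i powr p / V)"
        using p Di Wi Q V by (intro Youngs_inequality_0) auto
      moreover have "((D i)\<^sup>2 * W i powr (p - 2)) powr (p / 2) * (W i powr p) powr (1 - p / 2) = \<bar>D i\<bar> powr p"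
      proof -
        have "(\<bar>D i\<bar> powr 2) powr (p / 2) = \<bar>D i\<bar> powr (2 * (p / 2))" by (rule powr_powr)
        then have "((D i)\<^sup>2) powr (p / 2) = \<bar>D i\<bar> powr p" using Di by simp
        then have "((D i)\<^sup>2 * W i powr (p - 2)) powr (p / 2) = \<bar>D i\<bar> powr p * W i powr ((p - 2) * (p / 2))"
          by (simp only: powr_mult powr_powr)
        moreover have "(W i powr p) powr (1 - p / 2) = W i powr (p * (1 - p / 2))" by (simp add: powr_powr)
        moreover have "W i powr ((p - 2) * (p / 2)) * W i powr (p * (1 - p / 2)) = W i powr 0"
          by (simp flip: powr_add add: field_simps)
        ultimately show ?thesis using Wi by (simp add: mult.assoc)
      qed
      ultimately show ?thesis by (simp add: powr_divide)
    qed
    have "(\<Sum>i<d. \<bar>D i\<bar> powr p) / (Q powr (p / 2) * V powr (1 - p / 2))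
        \<le> (\<Sum>i<d. p / 2 * ((D i)\<^sup>2 * W i powr (p - 2) / Q) + (1 - p / 2) * (W i powr p / V))"
      unfolding sum_divide_distrib by (intro sum_mono each) auto
    also have "\<dots> = p / 2 * (Q / Q) + (1 - p / 2) * (V / V)"
      by (simp only: Q_def V_def sum.distrib sum_divide_distrib flip: sum_distrib_left)
    also have "\<dots> = 1" using Q V by simp
    finally have "(\<Sum>i<d. \<bar>D i\<bar> powr p) \<le> Q powr (p / 2) * V powr (1 - p / 2)"
      using Q V by (simp add: divide_le_eq)
    then have "(\<Sum>i<d. \<bar>D i\<bar> powr p) powr (2 / p) \<le> (Q powr (p / 2) * V powr (1 - p / 2)) powr (2 / p)"
      using p by (intro powr_mono2 sum_nonneg) auto
    also have "\<dots> = Q * V powr ((2 - p) / p)"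
    proof -
      have "(1 - p / 2) * (2 / p) = (2 - p) / p" using p by (simp add: field_simps)
      moreover have "p / 2 * (2 / p) = 1" using p by simp
      ultimately show ?thesis using Q by (simp only: powr_mult powr_powr) simp
    qed
    finally show ?thesis by (simp add: Q_def V_def)
  qed
qed

text \<open>
  Here $A$, $B$, $n$ are the norms of $x - x_0$, $y - x_0$, $x - y$, and \<open>DS\<close> is the
  Bregman distance of $\sum_i |x_i|^p$, so that the right-hand side is the Bregman distance of the
  squared norm. For $A > K B$ it is of order $A^2$; otherwise \<open>DS\<close> gives the bound.
\<close>

lemma square_norm_uniform_convex:
  fixes A B n DS p :: real
  assumes p: "1 < p" "p < 2" and nn: "0 \<le> A" "0 \<le> B" "0 \<le> n" "n \<le> A + B"
    and DS: "n\<^sup>2 * (p * (p - 1) / 2) \<le> DS * (A + B) powr (2 - p)" "0 \<le> DS"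
  defines "K \<equiv> (4 / p) powr (1 / (2 - p))"
  shows "min (1 / 8) ((p - 1) * (1 + K) powr (p - 2)) * n\<^sup>2
    \<le> A powr 2 - B powr 2 - 2 / p * B powr (2 - p) * (A powr p - B powr p - DS)"
proof -
  have K: "0 < K" using p by (simp add: K_def)
  have Bp: "B powr (2 - p) * B powr p = B powr 2" if "0 < B"
    using that by (simp flip: powr_add)
  define br where "br = A powr 2 - B powr 2 - 2 / p * B powr (2 - p) * (A powr p - B powr p)"
  have split: "A powr 2 - B powr 2 - 2 / p * B powr (2 - p) * (A powr p - B powr p - DS)
     = br + 2 / p * B powr (2 - p) * DS" unfolding br_def right_diff_distrib by linarith
  show ?thesis
  proof (cases "A \<le> K * B")
    case True
    show ?thesis
    proof (cases "B = 0")
      case True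
      then have "A = 0" using \<open>A \<le> K * B\<close> nn by simp
      then have "n = 0" using nn True by simp
      then show ?thesis using True \<open>A = 0\<close> by simp
    next
      case False
      then have B: "0 < B" using nn by simp
      \<comment> \<open>Convexity of \<open>u powr (2 / p)\<close> in \<open>u = A powr p\<close>
        makes \<open>br\<close> nonnegative, so the whole bound may come from \<open>DS\<close>;
        this costs only a factor since \<open>A + B \<le> (1 + K) * B\<close>.\<close>
      have "(B powr p) powr (2 / p) + 2 / p * (B powr p) powr (2 / p - 1) * (A powr p - B powr p) \<le> (A powr p) powr (2 / p)"
        using p by (intro powr_ge_tangent) auto
      moreover have "p * (2 / p - 1) = 2 - p" using p by (simp add: field_simps)
      ultimately have br: "0 \<le> br" using p nn B by (simp add: br_def powr_powr)
      have AB: "0 < A + B" "A + B \<le> (1 + K) * B" using True nn B by (auto simp: distrib_right)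
      have "n\<^sup>2 * (p * (p - 1) / 2) \<le> DS * ((1 + K) * B) powr (2 - p)"
        using DS AB p by (intro order.trans[OF DS(1)] mult_left_mono powr_mono2) auto
      also have "\<dots> = DS * ((1 + K) powr (2 - p) * B powr (2 - p))" by (simp add: powr_mult)
      finally have "2 / p * (1 + K) powr (p - 2) * (n\<^sup>2 * (p * (p - 1) / 2))
          \<le> 2 / p * (1 + K) powr (p - 2) * (DS * ((1 + K) powr (2 - p) * B powr (2 - p)))"
        using p by (intro mult_left_mono) auto
      also have "\<dots> = 2 / p * B powr (2 - p) * DS * ((1 + K) powr (p - 2) * (1 + K) powr (2 - p))"
        by (simp add: mult_ac)
      also have "(1 + K) powr (p - 2) * (1 + K) powr (2 - p) = 1" using K by (simp flip: powr_add)
      also have "2 / p * (1 + K) powr (p - 2) * (n\<^sup>2 * (p * (p - 1) / 2)) = (p - 1) * (1 + K) powr (p - 2) * n\<^sup>2"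
        using p by (simp add: field_simps)
      finally have main: "(p - 1) * (1 + K) powr (p - 2) * n\<^sup>2 \<le> 2 / p * B powr (2 - p) * DS" by simp
      have "min (1 / 8) ((p - 1) * (1 + K) powr (p - 2)) * n\<^sup>2 \<le> (p - 1) * (1 + K) powr (p - 2) * n\<^sup>2"
        by (intro mult_right_mono) auto
      then show ?thesis unfolding split using main br by linarith
    qed
  next
    case False
    then have A: "0 < A" "K * B < A" using nn K mult_nonneg_nonneg[of K B] by linarith+
    have "1 powr (1 / (2 - p)) \<le> K" unfolding K_def using p by (intro powr_mono2) auto
    then have "1 * B \<le> K * B" using nn by (intro mult_right_mono) auto
    then have BA: "B \<le> A" using A by simp
    \<comment> \<open>\<open>K powr (2 - p) = 4 / p\<close> is the threshold beyond which the mixed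
      term takes at most half of \<open>A powr 2\<close>.\<close>
    have "(K * B) powr (2 - p) \<le> A powr (2 - p)" using A K nn p by (intro powr_mono2) auto
    moreover have "(K * B) powr (2 - p) = 4 / p * B powr (2 - p)"
      using p by (simp add: powr_mult K_def powr_powr)
    ultimately have "4 / p * B powr (2 - p) * A powr p \<le> A powr (2 - p) * A powr p"
      by (intro mult_right_mono) auto
    also have "A powr (2 - p) * A powr p = A powr 2" using A by (simp flip: powr_add)
    finally have h1: "2 / p * B powr (2 - p) * A powr p \<le> A powr 2 / 2" by simp
    have h2: "B powr 2 \<le> 2 / p * B powr (2 - p) * B powr p"
    proof (cases "B = 0")
      case False
      then have "B powr (2 - p) * B powr p = B powr 2" using Bp nn by simp
      then have "2 / p * B powr (2 - p) * B powr p = 2 / p * B powr 2" by (simp only: mult.assoc)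
      moreover have "1 * B powr 2 \<le> 2 / p * B powr 2" using p by (intro mult_right_mono) auto
      ultimately show ?thesis by linarith
    qed simp
    have "A powr 2 / 2 \<le> br" using h1 h2 by (simp add: br_def right_diff_distrib)
    moreover have "0 \<le> 2 / p * B powr (2 - p) * DS" using p DS by simp
    moreover have "n\<^sup>2 \<le> (2 * A)\<^sup>2" using nn BA by (intro power_mono) auto
    moreover have "A powr 2 = A\<^sup>2" using A by simp
    ultimately have "1 / 8 * n\<^sup>2 \<le> br + 2 / p * B powr (2 - p) * DS" by (simp add: power2_eq_square)
    moreover have "min (1 / 8) ((p - 1) * (1 + K) powr (p - 2)) * n\<^sup>2 \<le> 1 / 8 * n\<^sup>2"
      by (intro mult_right_mono) auto
    ultimately show ?thesis unfolding split by linarith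
  qed
qed

text \<open>\<open>c\<close> is chosen before \<open>d\<close> and \<open>x0\<close>, which makes
  the rate dimension-free. The gradient vanishes at the center, so the Bregman distance from
  \<open>x0\<close> is the regularizer itself and the initial distance becomes
  \<open>c * R powr m\<close>.\<close>

lemma exists_regularizer:
  assumes p: "1 < p"
  shows "\<exists>c>0. \<forall>d x0. uniformly_convex d (pnorm d p) 1 (max 2 p) (regularizer d p c x0) \<and>
    (x0 \<in> Rd d \<longrightarrow> (\<forall>z\<in>Rd d. bregman d (regularizer d p c x0) z x0 = c * pnorm d p (z - x0) powr max 2 p))"
proof (cases "2 \<le> p")
  case True
  \<comment> \<open>Cancels the modulus \<open>2 powr (1 - p)\<close> of the scalar inequality and
    leaves the required \<open>1 / p\<close>.\<close>
  define c where "c = 2 powr (p - 1) / p"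
  have c: "0 < c" using p by (simp add: c_def)
  show ?thesis
  proof (intro exI[of _ c] conjI allI impI ballI c)
    fix d :: nat and x0 :: pt
    note diff = frechet_times_differentiable[OF regularizer_frechet_ge2[OF True, of d c x0]]
    have reg: "regularizer d p c x0 x = c * reg_sum d p x0 x" for x
      using True by (simp add: regularizer_def reg_sum_pnorm)
    have "1 / max 2 p * pnorm d p (x - y) powr max 2 p - 0 \<le> bregman d (regularizer d p c x0) x y"
      if xy: "x \<in> Rd d" "y \<in> Rd d" for x y
    proof -
      have "bregman d (regularizer d p c x0) x y = c * (reg_sum d p x0 x - reg_sum d p x0 y - reg_sum_deriv d p x0 y (x - y))"
        using diff(2)[of y "x - y"] xy by (simp add: bregman_def reg algebra_simps)
      also have "reg_sum d p x0 x - reg_sum d p x0 y - reg_sum_deriv d p x0 y (x - y)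
          = (\<Sum>i<d. abs_powr p (x i - x0 i) - abs_powr p (y i - x0 i) - abs_powr_deriv p (y i - x0 i) * ((x i - x0 i) - (y i - x0 i)))"
        by (simp add: reg_sum_def reg_sum_deriv_def sum_subtractf)
      also have "c * \<dots> \<ge> c * (\<Sum>i<d. 2 powr (1 - p) * abs_powr p ((x i - x0 i) - (y i - x0 i)))"
        using c True by (intro mult_left_mono sum_mono abs_powr_uniform_convex_ge2) auto
      also have "c * (\<Sum>i<d. 2 powr (1 - p) * abs_powr p ((x i - x0 i) - (y i - x0 i)))
          = c * 2 powr (1 - p) * pnorm d p (x - y) powr p"
        using p by (simp add: pnorm_powr abs_powr_def sum_distrib_left mult.assoc)
      also have "c * 2 powr (1 - p) = 1 / p" by (simp add: c_def powr_diff)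
      finally show ?thesis using True by (simp add: max_def del: minus_apply)
    qed
    then show "uniformly_convex d (pnorm d p) 1 (max 2 p) (regularizer d p c x0)"
      using diff(1) by (simp add: uniformly_convex_def inexact_uniformly_convex_def)
    show "bregman d (regularizer d p c x0) z x0 = c * pnorm d p (z - x0) powr max 2 p"
      if "x0 \<in> Rd d" "z \<in> Rd d" for z
      using diff(2)[of x0 "z - x0"] that p
      by (simp add: bregman_def reg_sum_deriv_center) (simp add: regularizer_def pnorm_def pt_apply)
  qed
next
  case False
  then have p2: "p < 2" by simp
  define K where "K = (4 / p) powr (1 / (2 - p))"
  define c2 where "c2 = min (1 / 8) ((p - 1) * (1 + K) powr (p - 2))"
  \<comment> \<open>Normalizes the modulus \<open>c2\<close> of the squared norm to
    \<open>1 / 2\<close>.\<close>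
  define c where "c = 1 / (2 * c2)"
  have K: "0 < K" using p by (simp add: K_def)
  have c2: "0 < c2" using p K by (simp add: c2_def)
  then have c: "0 < c" by (simp add: c_def)
  show ?thesis
  proof (intro exI[of _ c] conjI allI impI ballI c)
    fix d :: nat and x0 :: pt
    interpret coord_norm d "pnorm d p" by (rule coord_norm_pnorm[OF p])
    note diff = frechet_times_differentiable[OF regularizer_frechet_lt2[OF p p2, of d c x0]]
    have max2: "max 2 p = 2" using p2 by simp
    have "1 / max 2 p * pnorm d p (x - y) powr max 2 p - 0 \<le> bregman d (regularizer d p c x0) x y"
      if xy: "x \<in> Rd d" "y \<in> Rd d" for x y
    proof -
      define A B n where "A = pnorm d p (x - x0)" and "B = pnorm d p (y - x0)" and "n = pnorm d p (x - y)"
      define DS where "DS = reg_sum d p x0 x - reg_sum d p x0 y - reg_sum_deriv d p x0 y (x - y)"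
      define D W where "D i = x i - y i" and "W i = \<bar>x i - x0 i\<bar> + \<bar>y i - x0 i\<bar>" for i
      have DS_eq: "DS = (\<Sum>i<d. abs_powr p (x i - x0 i) - abs_powr p (y i - x0 i) - abs_powr_deriv p (y i - x0 i) * ((x i - x0 i) - (y i - x0 i)))"
        by (simp add: DS_def reg_sum_def reg_sum_deriv_def sum_subtractf)
      have DS_ge: "p * (p - 1) / 2 * (\<Sum>i<d. (D i)\<^sup>2 * W i powr (p - 2)) \<le> DS"
        unfolding DS_eq sum_distrib_left
      proof (rule sum_mono)
        fix i
        show "p * (p - 1) / 2 * ((D i)\<^sup>2 * W i powr (p - 2))
            \<le> abs_powr p (x i - x0 i) - abs_powr p (y i - x0 i) - abs_powr_deriv p (y i - x0 i) * ((x i - x0 i) - (y i - x0 i))"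
          using abs_powr_uniform_convex_lt2[OF p p2, of "x i - x0 i" "y i - x0 i"] by (simp add: D_def W_def)
      qed
      have "0 \<le> p * (p - 1) / 2 * (\<Sum>i<d. (D i)\<^sup>2 * W i powr (p - 2))"
        using p by (intro mult_nonneg_nonneg sum_nonneg) auto
      then have DS0: "0 \<le> DS" using DS_ge by linarith
      have n2: "n\<^sup>2 = (\<Sum>i<d. \<bar>D i\<bar> powr p) powr (2 / p)"
      proof -
        have "n powr 2 = (\<Sum>i<d. \<bar>D i\<bar> powr p) powr (1 / p * 2)"
          unfolding n_def pnorm_def powr_powr by (simp add: D_def)
        then show ?thesis using N_ge0 by (simp add: n_def)
      qed
      have V: "(\<Sum>i<d. W i powr p) powr ((2 - p) / p) \<le> (A + B) powr (2 - p)"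
      proof -
        \<comment> \<open>\<open>W\<close> is the sum of these vectors of absolute values, which
          have the norms \<open>A\<close> and \<open>B\<close>; the triangle inequality bounds its
          norm.\<close>
        define X Y :: pt where "X i = \<bar>x i - x0 i\<bar>" and "Y i = \<bar>y i - x0 i\<bar>" for i
        have "pnorm d p (X + Y) \<le> pnorm d p X + pnorm d p Y" by (rule N_triangle)
        also have "\<dots> = A + B" by (simp add: A_def B_def pnorm_def X_def Y_def)
        finally have le: "pnorm d p (X + Y) \<le> A + B" .
        have "(\<Sum>i<d. W i powr p) = pnorm d p (X + Y) powr p"
          using p by (simp add: pnorm_powr X_def Y_def W_def pt_apply)
        then have "(\<Sum>i<d. W i powr p) powr ((2 - p) / p) = pnorm d p (X + Y) powr (2 - p)"
          using p by (simp add: powr_powr)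
        also have "\<dots> \<le> (A + B) powr (2 - p)" using le p2 by (intro powr_mono2) auto
        finally show ?thesis .
      qed
      have "n\<^sup>2 \<le> (\<Sum>i<d. (D i)\<^sup>2 * W i powr (p - 2)) * (\<Sum>i<d. W i powr p) powr ((2 - p) / p)"
        unfolding n2 by (rule holder_sum_lt2[OF p p2]) (auto simp: D_def W_def)
      then have "n\<^sup>2 * (p * (p - 1) / 2) \<le> p * (p - 1) / 2 * ((\<Sum>i<d. (D i)\<^sup>2 * W i powr (p - 2)) * (\<Sum>i<d. W i powr p) powr ((2 - p) / p))"
        using p mult_left_mono[of "n\<^sup>2" _ "p * (p - 1) / 2"] by (simp add: mult.commute)
      also have "\<dots> = p * (p - 1) / 2 * (\<Sum>i<d. (D i)\<^sup>2 * W i powr (p - 2)) * (\<Sum>i<d. W i powr p) powr ((2 - p) / p)"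
        by (simp only: mult.assoc)
      also have "\<dots> \<le> DS * (A + B) powr (2 - p)"
        using DS_ge DS0 V by (intro mult_mono) auto
      finally have main: "n\<^sup>2 * (p * (p - 1) / 2) \<le> DS * (A + B) powr (2 - p)" .
      have nAB: "n \<le> A + B"
        using N_triangle[of "x - x0" "x0 - y"] N_minus_commute[of x0 y] by (simp add: n_def A_def B_def)
      have "c2 * n\<^sup>2 \<le> A powr 2 - B powr 2 - 2 / p * B powr (2 - p) * (A powr p - B powr p - DS)"
        unfolding c2_def K_def using main DS0 nAB
        by (intro square_norm_uniform_convex[OF p p2]) (auto simp: A_def B_def n_def)
      also have "A powr p - B powr p - DS = reg_sum_deriv d p x0 y (x - y)"
        using p by (simp add: DS_def reg_sum_pnorm A_def B_def)
      finally have "c * (c2 * n\<^sup>2) \<le> c * (A powr 2 - B powr 2 - 2 / p * B powr (2 - p) * reg_sum_deriv d p x0 y (x - y))"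
        using c by (intro mult_left_mono) auto
      also have "\<dots> = bregman d (regularizer d p c x0) x y"
        using diff(2)[of y "x - y"] xy unfolding bregman_def
        by (simp add: regularizer_def max2 A_def B_def algebra_simps)
      also have "c * (c2 * n\<^sup>2) = n\<^sup>2 / 2" using c2 by (simp add: c_def)
      finally show ?thesis using N_ge0 by (simp add: max2 n_def)
    qed
    then show "uniformly_convex d (pnorm d p) 1 (max 2 p) (regularizer d p c x0)"
      using diff(1) by (simp add: uniformly_convex_def inexact_uniformly_convex_def)
    show "bregman d (regularizer d p c x0) z x0 = c * pnorm d p (z - x0) powr max 2 p"
      if "x0 \<in> Rd d" "z \<in> Rd d" for z
      using diff(2)[of x0 "z - x0"] that p
      by (simp add: bregman_def reg_sum_deriv_center) (simp add: regularizer_def N_0)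
  qed
qed

section \<open>The potential argument\<close>

text \<open>Iteration \<open>k\<close> of algorithm B; algorithm A is the case \<open>lamh = lam\<close>, \<open>\<gamma> = 1\<close>, \<open>yt = y\<close>.\<close>

definition accel_step ::
    "nat \<Rightarrow> (pt \<Rightarrow> real) \<Rightarrow> (pt \<Rightarrow> real) \<Rightarrow> (pt \<Rightarrow> real) \<Rightarrow> real \<Rightarrow> real \<Rightarrow> pt \<Rightarrow> (nat \<Rightarrow> pt) \<Rightarrow>
     (nat \<Rightarrow> pt) \<Rightarrow> (nat \<Rightarrow> pt) \<Rightarrow> (nat \<Rightarrow> pt) \<Rightarrow> (nat \<Rightarrow> real) \<Rightarrow> (nat \<Rightarrow> real) \<Rightarrow> (nat \<Rightarrow> real) \<Rightarrow>
     (nat \<Rightarrow> real) \<Rightarrow> (nat \<Rightarrow> real) \<Rightarrow> (nat \<Rightarrow> real) \<Rightarrow> (nat \<Rightarrow> real) \<Rightarrow> (nat \<Rightarrow> pt) \<Rightarrow> nat \<Rightarrow> bool"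
  where "accel_step d N f \<psi> \<mu> r x0 x yt z v lam lamh ah Ah a A \<gamma> y k \<longleftrightarrow>
      0 < ah k \<and> Ah k = ah k + A (k - 1) \<and> 0 < lam k \<and> 0 < lamh k \<and>
      ah k = (step_const \<mu> r (prox_tol r) (1/4) * Ah k powr (r - 1) * lamh k) powr (1 / r) \<and>
      x k = (A (k - 1) / Ah k) *\<^sub>R y (k - 1) + (ah k / Ah k) *\<^sub>R z (k - 1) \<and>
      \<gamma> k = min (lam k / lamh k) 1 \<and> a k = \<gamma> k * ah k \<and> A k = a k + A (k - 1) \<and>
      prox_answer d N f r (prox_tol r) (1/4) (x k) (lam k) (yt k) (v k) \<and>
      (is_arg_min f (\<lambda>u. u \<in> {yt k, y (k - 1)}) (y k) \<or>
       y k = ((1 - \<gamma> k) * A (k - 1) / A k) *\<^sub>R y (k - 1) + (\<gamma> k * Ah k / A k) *\<^sub>R yt k) \<and>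
      mirror_step d \<psi> x0 a v k (z k)"

context coord_norm
begin

lemma bregman_line:
  assumes \<psi>: "times_differentiable d 1 \<psi>" and z: "z \<in> Rd d" "u \<in> Rd d"
  shows "((\<lambda>t. bregman d \<psi> (z + t *\<^sub>R u) x0) has_real_derivative
    dotp d (grad d \<psi> z) u - dotp d (grad d \<psi> x0) u) (at 0)"
proof -
  have "((\<lambda>t. \<psi> (z + t *\<^sub>R u)) has_real_derivative dotp d (grad d \<psi> z) u) (at 0)"
    using grad_line[OF \<psi> _ z, of 0] by simp
  moreover have "(\<lambda>t. bregman d \<psi> (z + t *\<^sub>R u) x0)
      = (\<lambda>t. \<psi> (z + t *\<^sub>R u) - \<psi> x0 - (dotp d (grad d \<psi> x0) z + t * dotp d (grad d \<psi> x0) u - dotp d (grad d \<psi> x0) x0))"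
    by (simp add: bregman_def dotp_simps)
  ultimately show ?thesis by (auto intro!: derivative_eq_intros)
qed

text \<open>The objective is linear plus \<open>\<psi>\<close>, so its own Bregman distance is that
  of \<open>\<psi>\<close>. As the minimization is over the whole space, the gradient vanishes at
  \<open>z\<close> and the three-point relation is an equality.\<close>

lemma mirror_step_optimal:
  assumes \<psi>: "times_differentiable d 1 \<psi>" and z: "mirror_step d \<psi> x0 a v k z"
  shows "z \<in> Rd d"
    and "w \<in> Rd d \<Longrightarrow> (\<Sum>i=1..k. a i * dotp d (v i) w) + bregman d \<psi> w x0
      = (\<Sum>i=1..k. a i * dotp d (v i) z) + bregman d \<psi> z x0 + bregman d \<psi> w z"
proof -
  define H where "H w = (\<Sum>i=1..k. a i * dotp d (v i) w) + bregman d \<psi> w x0" for w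
  have zR: "z \<in> Rd d" and min: "\<And>w. w \<in> Rd d \<Longrightarrow> H z \<le> H w"
    using z unfolding mirror_step_def is_arg_min_linorder H_def by auto
  show "z \<in> Rd d" by (rule zR)
  assume w: "w \<in> Rd d"
  define u where "u = w - z"
  have u: "u \<in> Rd d" using w zR by (simp add: u_def)
  define l where "l y = (\<Sum>i=1..k. a i * dotp d (v i) y)" for y
  have l_add: "l (y + t *\<^sub>R u) = l y + t * l u" for y t
    by (simp add: l_def dotp_simps algebra_simps sum.distrib sum_distrib_left)
  have "((\<lambda>t. H (z + t *\<^sub>R u)) has_real_derivative l u + (dotp d (grad d \<psi> z) u - dotp d (grad d \<psi> x0) u)) (at 0)"
    unfolding H_def l_def[symmetric] l_add
    by (intro DERIV_add bregman_line[OF \<psi> zR u]) (auto intro!: derivative_eq_intros)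
  then have "l u + (dotp d (grad d \<psi> z) u - dotp d (grad d \<psi> x0) u) = 0"
    by (rule DERIV_local_min[where d = 1]) (use min zR u in auto)
  moreover have "l w = l z + l u" using l_add[of z 1] by (simp add: u_def)
  ultimately have "l w + bregman d \<psi> w x0 = l z + bregman d \<psi> z x0 + bregman d \<psi> w z"
    by (simp add: bregman_def dotp_simps u_def algebra_simps)
  then show "(\<Sum>i=1..k. a i * dotp d (v i) w) + bregman d \<psi> w x0
      = (\<Sum>i=1..k. a i * dotp d (v i) z) + bregman d \<psi> z x0 + bregman d \<psi> w z"
    by (simp add: l_def)
qed

text \<open>Convexity bounds \<open>A * f y\<close> by the values at \<open>y0\<close> and
  \<open>yt\<close> for either choice of \<open>y\<close>, because
  \<open>A = (1 - g) * A0 + g * Ah\<close>. The inexact minorant at \<open>yt\<close> is then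
  compared with \<open>f y0\<close>, and \<open>prox_step_balance\<close> pays for the rest. The
  hypotheses \<open>sub\<close> are the facts of \<open>prox_answerE\<close>, with the same
  \<open>\<epsilon>\<close> that enters the lower model.\<close>

lemma potential_step:
  assumes r: "1 < r" and \<mu>: "0 < \<mu>" and f: "convex_on (Rd d) f"
    and R: "y0 \<in> Rd d" "z0 \<in> Rd d" "z \<in> Rd d"
    and w: "0 \<le> A0" "0 < ah" "Ah = ah + A0" "0 < lam" "0 < lamh"
    and ah: "ah = (step_const \<mu> r (prox_tol r) (1/4) * Ah powr (r - 1) * lamh) powr (1 / r)"
    and x: "x = (A0 / Ah) *\<^sub>R y0 + (ah / Ah) *\<^sub>R z0"
    and g: "g = min (lam / lamh) 1" and a: "a = g * ah" and A: "A = a + A0"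
    and ans: "prox_answer d N f r (prox_tol r) (1/4) x lam yt v"
    and y: "is_arg_min f (\<lambda>u. u \<in> {yt, y0}) y \<or> y = ((1 - g) * A0 / A) *\<^sub>R y0 + (g * Ah / A) *\<^sub>R yt"
    and sub: "\<And>z. z \<in> Rd d \<Longrightarrow> f yt + dotp d v (z - yt) - \<epsilon> \<le> f z" "\<epsilon> \<le> 1 / 4 * N (x - yt) powr r / lam"
      "(1 - prox_tol r) * N (x - yt) powr r / lam \<le> dotp d v (x - yt)"
      "\<And>u. u \<in> Rd d \<Longrightarrow> dotp d v u \<le> (1 + prox_tol r) * N (x - yt) powr (r - 1) / lam * N u"
  shows "y \<in> Rd d" "0 < A"
    "A * f y + prox_gain r * (g * Ah * N (x - yt) powr r / lam)
      \<le> A0 * f y0 + \<mu> / r * N (z - z0) powr r + a * (f yt + dotp d v (z - yt) - \<epsilon>)"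
proof -
  have ytR: "yt \<in> Rd d" using ans unfolding prox_answer_def by blast
  have Ah: "0 < Ah" using w by simp
  have g1: "0 < g" "g \<le> 1" using w by (auto simp: g)
  have a0: "0 < a" using g1 w by (simp add: a)
  show A0: "0 < A" using a0 w by (simp add: A)
  have Aeq: "A = (1 - g) * A0 + g * Ah" by (simp add: A a w algebra_simps)
  have w1: "(1 - g) * A0 / A + g * Ah / A = 1" using A0 by (simp add: Aeq flip: add_divide_distrib)
  show "y \<in> Rd d" using y ytR R by (auto simp: is_arg_min_def)
  have yle: "A * f y \<le> (1 - g) * A0 * f y0 + g * Ah * f yt"
    using y
  proof
    assume "is_arg_min f (\<lambda>u. u \<in> {yt, y0}) y"
    then have "f y \<le> f yt" "f y \<le> f y0" by (auto simp: is_arg_min_linorder)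
    then have "(1 - g) * A0 * f y + g * Ah * f y \<le> (1 - g) * A0 * f y0 + g * Ah * f yt"
      using g1 w Ah by (intro add_mono mult_left_mono) auto
    then show ?thesis by (simp only: Aeq distrib_right)
  next
    assume y: "y = ((1 - g) * A0 / A) *\<^sub>R y0 + (g * Ah / A) *\<^sub>R yt"
    have t: "0 \<le> g * Ah / A" "g * Ah / A \<le> 1" "1 - g * Ah / A = (1 - g) * A0 / A"
    proof -
      have "0 \<le> (1 - g) * A0 / A" using g1 w(1) A0 by simp
      then show "g * Ah / A \<le> 1" "1 - g * Ah / A = (1 - g) * A0 / A" using w1 by linarith+
      show "0 \<le> g * Ah / A" using g1 Ah A0 by simp
    qed
    then have "f y \<le> (1 - g) * A0 / A * f y0 + g * Ah / A * f yt"
      using convex_onD[OF f t(1,2) R(1) ytR] unfolding y t(3) by simp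
    then have "A * f y \<le> A * ((1 - g) * A0 / A * f y0 + g * Ah / A * f yt)"
      using A0 by (intro mult_left_mono) auto
    also have "\<dots> = (1 - g) * A0 * f y0 + g * Ah * f yt" using A0 by (simp add: distrib_left)
    finally show ?thesis .
  qed
  define \<rho> where "\<rho> = N (x - yt)"
  define t where "t = N (z - z0)"
  have nn: "0 \<le> \<rho>" "0 \<le> t" by (simp_all add: \<rho>_def t_def N_ge0)
  have Ahx: "Ah *\<^sub>R x = A0 *\<^sub>R y0 + ah *\<^sub>R z0"
    using Ah by (simp add: x scaleR_add_right)
  \<comment> \<open>The purpose of the extrapolation \<open>x\<close>: the displacements of
    \<open>y0\<close> and \<open>z\<close> from \<open>yt\<close> combine into the proximal
    displacement \<open>x - yt\<close> and the mirror displacement \<open>z - z0\<close>.\<close>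
  have lin: "A0 * dotp d v (y0 - yt) + ah * dotp d v (z - yt) = Ah * dotp d v (x - yt) + ah * dotp d v (z - z0)"
  proof -
    have "A0 * dotp d v (y0 - yt) + ah * dotp d v (z - yt)
        = dotp d v (A0 *\<^sub>R y0 + ah *\<^sub>R z0) + ah * dotp d v (z - z0) - Ah * dotp d v yt"
      by (simp add: dotp_simps w algebra_simps)
    also have "\<dots> = Ah * dotp d v (x - yt) + ah * dotp d v (z - z0)"
      unfolding Ahx[symmetric] by (simp add: dotp_simps algebra_simps)
    finally show ?thesis .
  qed
  have "- dotp d v (z - z0) = dotp d v (z0 - z)" by (simp add: dotp_simps)
  also have "\<dots> \<le> (1 + prox_tol r) * \<rho> powr (r - 1) / lam * t"
    using sub(4)[of "z0 - z"] R by (simp add: \<rho>_def t_def N_minus_commute)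
  finally have "ah * - dotp d v (z - z0) \<le> ah * ((1 + prox_tol r) * \<rho> powr (r - 1) / lam * t)"
    using w by (intro mult_left_mono) auto
  then have b1: "- (ah * ((1 + prox_tol r) * \<rho> powr (r - 1) / lam) * t) \<le> ah * dotp d v (z - z0)"
    by (simp add: mult.assoc)
  have "(1 - prox_tol r) * \<rho> powr r / lam - 1 / 4 * \<rho> powr r / lam \<le> dotp d v (x - yt) - \<epsilon>"
    using sub(2,3) by (simp add: \<rho>_def)
  then have "(1 - prox_tol r - 1/4) * \<rho> powr r / lam \<le> dotp d v (x - yt) - \<epsilon>"
    by (simp only: left_diff_distrib diff_divide_distrib)
  then have b2: "Ah * ((1 - prox_tol r - 1/4) * \<rho> powr r / lam) \<le> Ah * (dotp d v (x - yt) - \<epsilon>)"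
    using Ah by (intro mult_left_mono) auto
  have "prox_gain r * (g * Ah * \<rho> powr r / lam)
    \<le> \<mu> / r * t powr r + g * (Ah * ((1 - prox_tol r - 1/4) * \<rho> powr r / lam)
        - ah * ((1 + prox_tol r) * \<rho> powr (r - 1) / lam) * t)"
    using prox_step_balance[OF r \<mu> w(4,5) Ah nn ah g] .
  also have "g * (Ah * ((1 - prox_tol r - 1/4) * \<rho> powr r / lam) - ah * ((1 + prox_tol r) * \<rho> powr (r - 1) / lam) * t)
      \<le> g * (Ah * (dotp d v (x - yt) - \<epsilon>) + ah * dotp d v (z - z0))"
    using b1 b2 g1 by (intro mult_left_mono) auto
  also have "Ah * (dotp d v (x - yt) - \<epsilon>) + ah * dotp d v (z - z0)
      = A0 * (dotp d v (y0 - yt) - \<epsilon>) + ah * (dotp d v (z - yt) - \<epsilon>)"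
    using lin by (simp add: w algebra_simps)
  finally have bal: "prox_gain r * (g * Ah * \<rho> powr r / lam)
    \<le> \<mu> / r * t powr r + g * (A0 * (dotp d v (y0 - yt) - \<epsilon>) + ah * (dotp d v (z - yt) - \<epsilon>))" by simp
  have "g * A0 * (f yt + dotp d v (y0 - yt) - \<epsilon>) \<le> g * A0 * f y0"
    using sub(1)[OF R(1)] g1 w by (intro mult_left_mono) auto
  moreover have "g * (A0 * (dotp d v (y0 - yt) - \<epsilon>) + ah * (dotp d v (z - yt) - \<epsilon>)) + g * Ah * f yt
      = g * A0 * (f yt + dotp d v (y0 - yt) - \<epsilon>) + a * (f yt + dotp d v (z - yt) - \<epsilon>)"
    by (simp add: w a algebra_simps)
  moreover have "(1 - g) * A0 * f y0 = A0 * f y0 - g * A0 * f y0" by (simp add: algebra_simps)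
  ultimately show "A * f y + prox_gain r * (g * Ah * N (x - yt) powr r / lam)
      \<le> A0 * f y0 + \<mu> / r * N (z - z0) powr r + a * (f yt + dotp d v (z - yt) - \<epsilon>)"
    using bal yle unfolding \<rho>_def t_def by linarith
qed

text \<open>An estimate sequence: \<open>\<Psi> n\<close> is the weighted sum of inexact linear
  minorants of \<open>f\<close> plus the Bregman distance. Its minimum, attained at
  \<open>z n\<close>, stays above \<open>A n * f (y n)\<close> plus the proximal sum up to
  \<open>n * \<delta>\<close>, while its value at \<open>xs\<close> is at most
  \<open>A n * f xs\<close> plus the initial distance. Comparing the two at \<open>T\<close> gives
  the bound.\<close>

lemma accelerated_bound:
  assumes r: "1 < r" and \<mu>: "0 < \<mu>" and f: "convex_on (Rd d) f"
    and UC: "inexact_uniformly_convex d N \<delta> \<mu> r \<psi>"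
    and R: "x0 \<in> Rd d" "xs \<in> Rd d" and init: "z 0 = x0" "y 0 = x0" "A 0 = 0"
    and run: "\<forall>k\<in>{1..T}. accel_step d N f \<psi> \<mu> r x0 x yt z v lam lamh ah Ah a A \<gamma> y k"
  shows "A T * (f (y T) - f xs) + (\<Sum>k=1..T. prox_gain r * (\<gamma> k * Ah k * N (x k - yt k) powr r / lam k))
      \<le> bregman d \<psi> xs x0 + (real T + 1) * \<delta>"
    and "\<forall>k\<in>{1..T}. 0 < A k \<and> A (k - 1) \<le> A k"
proof -
  have \<psi>: "times_differentiable d 1 \<psi>"
    and D: "\<And>x y. x \<in> Rd d \<Longrightarrow> y \<in> Rd d \<Longrightarrow> \<mu> / r * N (x - y) powr r - \<delta> \<le> bregman d \<psi> x y"
    using UC unfolding inexact_uniformly_convex_def by auto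
  define S where "S n = (\<Sum>k=1..n. prox_gain r * (\<gamma> k * Ah k * N (x k - yt k) powr r / lam k))" for n
  define good where "good n \<epsilon> \<longleftrightarrow> (\<forall>z\<in>Rd d. f (yt n) + dotp d (v n) (z - yt n) - \<epsilon> \<le> f z)
      \<and> \<epsilon> \<le> 1 / 4 * N (x n - yt n) powr r / lam n
      \<and> (1 - prox_tol r) * N (x n - yt n) powr r / lam n \<le> dotp d (v n) (x n - yt n)
      \<and> (\<forall>u\<in>Rd d. dotp d (v n) u \<le> (1 + prox_tol r) * N (x n - yt n) powr (r - 1) / lam n * N u)" for n \<epsilon>
  \<comment> \<open>The oracle promises only some \<open>\<epsilon>\<close>; one choice per
    iteration is fixed so that the lower model is a definite function.\<close>
  define eps where "eps n = (SOME \<epsilon>. good n \<epsilon>)" for n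
  define \<Psi> where "\<Psi> n w = (\<Sum>i=1..n. a i * (f (yt i) + dotp d (v i) (w - yt i) - eps i)) + bregman d \<psi> w x0" for n w
  have inv: "y n \<in> Rd d \<and> z n \<in> Rd d \<and> 0 \<le> A n \<and> (\<forall>w\<in>Rd d. \<Psi> n w = \<Psi> n (z n) + bregman d \<psi> w (z n)) \<and>
      A n * f (y n) + S n \<le> \<Psi> n (z n) + real n * \<delta> \<and> \<Psi> n xs \<le> A n * f xs + bregman d \<psi> xs x0 \<and>
      (1 \<le> n \<longrightarrow> 0 < A n \<and> A (n - 1) \<le> A n)" if "n \<le> T" for n
    using that
  proof (induction n)
    case 0
    show ?case using init R by (simp add: \<Psi>_def S_def bregman_def dotp_simps)
  next
    case (Suc n)
    let ?k = "Suc n"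
    note IHn = Suc.IH[OF Suc_leD[OF Suc.prems]]
    have IH: "y n \<in> Rd d" "z n \<in> Rd d" "0 \<le> A n" "\<And>w. w \<in> Rd d \<Longrightarrow> \<Psi> n w = \<Psi> n (z n) + bregman d \<psi> w (z n)"
      "A n * f (y n) + S n \<le> \<Psi> n (z n) + real n * \<delta>" "\<Psi> n xs \<le> A n * f xs + bregman d \<psi> xs x0"
      using IHn by blast+
    have "?k \<in> {1..T}" using Suc.prems by simp
    note rk0 = bspec[OF run this, unfolded accel_step_def diff_Suc_1]
    have rk: "0 < ah ?k" "Ah ?k = ah ?k + A n" "0 < lam ?k" "0 < lamh ?k"
      "ah ?k = (step_const \<mu> r (prox_tol r) (1/4) * Ah ?k powr (r - 1) * lamh ?k) powr (1 / r)"
      "x ?k = (A n / Ah ?k) *\<^sub>R y n + (ah ?k / Ah ?k) *\<^sub>R z n"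
      "\<gamma> ?k = min (lam ?k / lamh ?k) 1" "a ?k = \<gamma> ?k * ah ?k" "A ?k = a ?k + A n"
      using rk0 by blast+
    have ans: "prox_answer d N f r (prox_tol r) (1/4) (x ?k) (lam ?k) (yt ?k) (v ?k)"
      and yk: "is_arg_min f (\<lambda>u. u \<in> {yt ?k, y n}) (y ?k) \<or>
        y ?k = ((1 - \<gamma> ?k) * A n / A ?k) *\<^sub>R y n + (\<gamma> ?k * Ah ?k / A ?k) *\<^sub>R yt ?k"
      and mk: "mirror_step d \<psi> x0 a v ?k (z ?k)"
      using rk0 by blast+
    have xR: "x ?k \<in> Rd d" unfolding rk(6) by (intro Rd_closed IH)
    have a0: "0 < a ?k" unfolding rk(8) rk(7) using rk(1,3,4) by simp
    obtain \<epsilon> where "good ?k \<epsilon>"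
    proof -
      from prox_answerE[OF ans r rk(3) xR] obtain \<epsilon> where
        "\<And>z. z \<in> Rd d \<Longrightarrow> f (yt ?k) + dotp d (v ?k) (z - yt ?k) - \<epsilon> \<le> f z"
        "\<epsilon> \<le> 1 / 4 * N (x ?k - yt ?k) powr r / lam ?k"
        "(1 - prox_tol r) * N (x ?k - yt ?k) powr r / lam ?k \<le> dotp d (v ?k) (x ?k - yt ?k)"
        "\<And>u. u \<in> Rd d \<Longrightarrow> dotp d (v ?k) u \<le> (1 + prox_tol r) * N (x ?k - yt ?k) powr (r - 1) / lam ?k * N u"
        by metis
      then have "good ?k \<epsilon>" unfolding good_def by blast
      then show thesis by (rule that)
    qed
    then have good: "good ?k (eps ?k)" unfolding eps_def by (rule someI)
    have zk: "z ?k \<in> Rd d" and opt: "\<And>w. w \<in> Rd d \<Longrightarrow> (\<Sum>i=1..?k. a i * dotp d (v i) w) + bregman d \<psi> w x0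
      = (\<Sum>i=1..?k. a i * dotp d (v i) (z ?k)) + bregman d \<psi> (z ?k) x0 + bregman d \<psi> w (z ?k)"
      using mirror_step_optimal[OF \<psi> mk] by blast+
    have \<Psi>_lin: "\<Psi> m w = (\<Sum>i=1..m. a i * dotp d (v i) w) + bregman d \<psi> w x0
        + (\<Sum>i=1..m. a i * (f (yt i) - dotp d (v i) (yt i) - eps i))" for m w
      unfolding \<Psi>_def by (simp add: dotp_simps algebra_simps sum.distrib sum_subtractf)
    have \<Psi>_Suc: "\<Psi> ?k w = \<Psi> n w + a ?k * (f (yt ?k) + dotp d (v ?k) (w - yt ?k) - eps ?k)" for w
      by (simp add: \<Psi>_def)
    have step: "y ?k \<in> Rd d" "0 < A ?k"
      "A ?k * f (y ?k) + prox_gain r * (\<gamma> ?k * Ah ?k * N (x ?k - yt ?k) powr r / lam ?k)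
        \<le> A n * f (y n) + \<mu> / r * N (z ?k - z n) powr r + a ?k * (f (yt ?k) + dotp d (v ?k) (z ?k - yt ?k) - eps ?k)"
      using potential_step[OF r \<mu> f IH(1,2) zk IH(3) rk(1-9) ans yk] good
      unfolding good_def by blast+
    have "A ?k * f (y ?k) + S ?k \<le> \<Psi> ?k (z ?k) + real ?k * \<delta>"
    proof -
      have "S ?k = S n + prox_gain r * (\<gamma> ?k * Ah ?k * N (x ?k - yt ?k) powr r / lam ?k)" by (simp add: S_def)
      moreover have "real ?k * \<delta> = real n * \<delta> + \<delta>" by (simp add: algebra_simps)
      ultimately show ?thesis
        using step(3) IH(5) D[OF zk IH(2)] IH(4)[OF zk] \<Psi>_Suc[of "z ?k"] by linarith
    qed
    moreover have "\<Psi> ?k xs \<le> A ?k * f xs + bregman d \<psi> xs x0"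
    proof -
      have "f (yt ?k) + dotp d (v ?k) (xs - yt ?k) - eps ?k \<le> f xs"
        using good R(2) unfolding good_def by blast
      then have "a ?k * (f (yt ?k) + dotp d (v ?k) (xs - yt ?k) - eps ?k) \<le> a ?k * f xs"
        using a0 by (intro mult_left_mono) auto
      moreover have "A ?k * f xs = a ?k * f xs + A n * f xs" unfolding rk(9) by (simp add: distrib_right)
      ultimately show ?thesis using IH(6) \<Psi>_Suc[of xs] by linarith
    qed
    moreover have "A n \<le> A ?k" using rk(9) a0 by linarith
    moreover have "\<forall>w\<in>Rd d. \<Psi> ?k w = \<Psi> ?k (z ?k) + bregman d \<psi> w (z ?k)"
      using opt by (simp only: \<Psi>_lin) (simp add: algebra_simps)
    moreover have "0 \<le> A ?k" using step(2) by simp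
    ultimately show ?case unfolding diff_Suc_1 using step(1,2) zk by blast
  qed
  have "A T * f (y T) + S T \<le> \<Psi> T (z T) + real T * \<delta>" "\<Psi> T xs \<le> A T * f xs + bregman d \<psi> xs x0"
    "\<Psi> T xs = \<Psi> T (z T) + bregman d \<psi> xs (z T)" "z T \<in> Rd d"
    using inv[OF order.refl] R by blast+
  \<comment> \<open>Source of the last \<open>\<delta>\<close> in \<open>T + 1\<close>: an inexactly
    convex Bregman distance may be negative.\<close>
  moreover have "- \<delta> \<le> bregman d \<psi> xs (z T)"
  proof -
    have "0 \<le> \<mu> / r * N (xs - z T) powr r" using \<mu> r by simp
    then show ?thesis using D[OF R(2) \<open>z T \<in> Rd d\<close>] by linarith
  qed
  ultimately show "A T * (f (y T) - f xs) + (\<Sum>k=1..T. prox_gain r * (\<gamma> k * Ah k * N (x k - yt k) powr r / lam k))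
      \<le> bregman d \<psi> xs x0 + (real T + 1) * \<delta>"
    by (simp add: S_def algebra_simps)
  show "\<forall>k\<in>{1..T}. 0 < A k \<and> A (k - 1) \<le> A k" using inv by force
qed

end

section \<open>Existence of runs\<close>

text \<open>For \<open>A > 0\<close> the intermediate value theorem applies, as the right-hand side
  is positive at \<open>a = 0\<close> and grows more slowly than \<open>a\<close>. For
  \<open>A = 0\<close> the value \<open>0\<close> is a spurious root, so the solution
  \<open>c\<close> is given directly.\<close>

lemma exists_weight:
  fixes A c r :: real
  assumes r: "1 < r" and A: "0 \<le> A" and c: "0 < c"
  shows "\<exists>a>0. a = (c * (a + A) powr (r - 1)) powr (1 / r)"
proof (cases "A = 0")
  case True
  have "(c * c powr (r - 1)) powr (1 / r) = (c powr r) powr (1 / r)"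
    using c by (simp add: powr_mult_base)
  also have "\<dots> = c" using c r by (simp add: powr_powr)
  finally show ?thesis using c True by (intro exI[of _ c]) simp
next
  case False
  then have A0: "0 < A" using A by simp
  define \<phi> where "\<phi> a = a - (c * (a + A) powr (r - 1)) powr (1 / r)" for a
  \<comment> \<open>Large enough that \<open>c * (B + A) powr (r - 1) \<le> c * (2 * B) powr (r - 1)
    \<le> B powr r\<close>.\<close>
  define B where "B = max A (c * 2 powr (r - 1))"
  have B: "A \<le> B" "c * 2 powr (r - 1) \<le> B" "0 < B" using A0 by (auto simp: B_def)
  have "c * (B + A) powr (r - 1) \<le> c * (2 * B) powr (r - 1)"
    using B A0 c r by (intro mult_left_mono powr_mono2) auto
  also have "\<dots> = c * 2 powr (r - 1) * B powr (r - 1)" by (simp add: powr_mult)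
  also have "\<dots> \<le> B * B powr (r - 1)" using B by (intro mult_right_mono) auto
  also have "\<dots> = B powr r" using B by (simp add: powr_mult_base)
  finally have "(c * (B + A) powr (r - 1)) powr (1 / r) \<le> (B powr r) powr (1 / r)"
    using c r by (intro powr_mono2) auto
  then have "0 \<le> \<phi> B" using r B by (simp add: \<phi>_def powr_powr)
  moreover have \<phi>0: "\<phi> 0 < 0" using A0 c by (simp add: \<phi>_def)
  moreover have "continuous_on {0..B} \<phi>"
    unfolding \<phi>_def using A0 c
    by (intro continuous_on_diff continuous_on_id continuous_on_powr continuous_on_mult_left
        continuous_on_add continuous_on_const) auto
  ultimately obtain a where a: "0 \<le> a" "\<phi> a = 0" using IVT'[of \<phi> 0 0 B] B by auto
  have "a \<noteq> 0" using a \<phi>0 by auto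
  then show ?thesis using a by (intro exI[of _ a]) (auto simp: \<phi>_def)
qed

text \<open>An infinite run that serves both algorithms. \<open>Orc\<close> sees the iteration
  number because the first call of algorithm B uses its own initial guess; \<open>upd\<close> is the
  rule for the next guess. The averaged variant of \<open>y\<close> is taken, which reduces to
  \<open>yt\<close> when there is no damping.\<close>

definition accel_run ::
    "nat \<Rightarrow> (pt \<Rightarrow> real) \<Rightarrow> pt \<Rightarrow> real \<Rightarrow> real \<Rightarrow> (nat \<Rightarrow> pt \<Rightarrow> real \<Rightarrow> pt \<times> pt \<times> real) \<Rightarrow>
     (nat \<Rightarrow> real \<Rightarrow> real \<Rightarrow> real) \<Rightarrow> real \<Rightarrow> (nat \<Rightarrow> pt) \<Rightarrow> (nat \<Rightarrow> pt) \<Rightarrow> (nat \<Rightarrow> pt) \<Rightarrow> (nat \<Rightarrow> pt) \<Rightarrow>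
     (nat \<Rightarrow> real) \<Rightarrow> (nat \<Rightarrow> real) \<Rightarrow> (nat \<Rightarrow> real) \<Rightarrow> (nat \<Rightarrow> real) \<Rightarrow> (nat \<Rightarrow> real) \<Rightarrow> (nat \<Rightarrow> real) \<Rightarrow>
     (nat \<Rightarrow> real) \<Rightarrow> (nat \<Rightarrow> pt) \<Rightarrow> bool"
  where "accel_run d \<psi> x0 r C Orc upd l1 x yt z v lam lamh ah Ah a A \<gamma> y \<longleftrightarrow>
    z 0 = x0 \<and> y 0 = x0 \<and> A 0 = 0 \<and> lamh 1 = l1 \<and>
    (\<forall>k\<ge>1. 0 < ah k \<and>
      Ah k = ah k + A (k - 1) \<and>
      0 < lam k \<and>
      0 < lamh k \<and>
      ah k = (C * Ah k powr (r - 1) * lamh k) powr (1 / r) \<and>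
      x k = (A (k - 1) / Ah k) *\<^sub>R y (k - 1) + (ah k / Ah k) *\<^sub>R z (k - 1) \<and>
      x k \<in> Rd d \<and>
      (yt k, v k, lam k) = Orc k (x k) (lamh k) \<and>
      \<gamma> k = min (lam k / lamh k) 1 \<and>
      a k = \<gamma> k * ah k \<and>
      A k = a k + A (k - 1) \<and>
      y k = ((1 - \<gamma> k) * A (k - 1) / A k) *\<^sub>R y (k - 1) + (\<gamma> k * Ah k / A k) *\<^sub>R yt k \<and>
      mirror_step d \<psi> x0 a v k (z k) \<and>
      lamh (Suc k) = upd k (lamh k) (lam k) \<and>
      0 \<le> A (k - 1))"

lemma accel_runD:
  assumes "accel_run d \<psi> x0 r C Orc upd l1 x yt z v lam lamh ah Ah a A \<gamma> y"
  shows "z 0 = x0"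
    and "y 0 = x0"
    and "A 0 = 0"
    and "lamh 1 = l1"
    and "\<And>k. 1 \<le> k \<Longrightarrow> 0 < ah k"
    and "\<And>k. 1 \<le> k \<Longrightarrow> Ah k = ah k + A (k - 1)"
    and "\<And>k. 1 \<le> k \<Longrightarrow> 0 < lam k"
    and "\<And>k. 1 \<le> k \<Longrightarrow> 0 < lamh k"
    and "\<And>k. 1 \<le> k \<Longrightarrow> ah k = (C * Ah k powr (r - 1) * lamh k) powr (1 / r)"
    and "\<And>k. 1 \<le> k \<Longrightarrow> x k = (A (k - 1) / Ah k) *\<^sub>R y (k - 1) + (ah k / Ah k) *\<^sub>R z (k - 1)"
    and "\<And>k. 1 \<le> k \<Longrightarrow> x k \<in> Rd d"
    and "\<And>k. 1 \<le> k \<Longrightarrow> (yt k, v k, lam k) = Orc k (x k) (lamh k)"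
    and "\<And>k. 1 \<le> k \<Longrightarrow> \<gamma> k = min (lam k / lamh k) 1"
    and "\<And>k. 1 \<le> k \<Longrightarrow> a k = \<gamma> k * ah k"
    and "\<And>k. 1 \<le> k \<Longrightarrow> A k = a k + A (k - 1)"
    and "\<And>k. 1 \<le> k \<Longrightarrow> y k = ((1 - \<gamma> k) * A (k - 1) / A k) *\<^sub>R y (k - 1) + (\<gamma> k * Ah k / A k) *\<^sub>R yt k"
    and "\<And>k. 1 \<le> k \<Longrightarrow> mirror_step d \<psi> x0 a v k (z k)"
    and "\<And>k. 1 \<le> k \<Longrightarrow> lamh (Suc k) = upd k (lamh k) (lam k)"
    and "\<And>k. 1 \<le> k \<Longrightarrow> 0 \<le> A (k - 1)"
  using assms unfolding accel_run_def by blast+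

context coord_norm
begin

text \<open>Primitive recursion over states consisting of \<open>y\<close>, \<open>z\<close>,
  \<open>A\<close>, the weighted sum of all subgradients so far, and the current guess. Carrying
  that sum makes the mirror step a function of the state although it refers to the whole
  history.\<close>

lemma exists_run:
  fixes Orc :: "nat \<Rightarrow> pt \<Rightarrow> real \<Rightarrow> pt \<times> pt \<times> real" and upd :: "nat \<Rightarrow> real \<Rightarrow> real \<Rightarrow> real"
  assumes r: "1 < r" and C: "0 < C" and l1: "0 < l1" and x0: "x0 \<in> Rd d"
    and Orc: "\<And>k x l. x \<in> Rd d \<Longrightarrow> 0 < l \<Longrightarrow> fst (Orc k x l) \<in> Rd d \<and> 0 < snd (snd (Orc k x l))"
    and upd: "\<And>k l lm. 0 < l \<Longrightarrow> 0 < lm \<Longrightarrow> 0 < upd k l lm"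
    and mirror: "\<And>G. \<exists>z. is_arg_min (\<lambda>z. dotp d G z + bregman d \<psi> z x0) (\<lambda>z. z \<in> Rd d) z"
  shows "\<exists>x yt z v lam lamh ah Ah a A \<gamma> y. accel_run d \<psi> x0 r C Orc upd l1 x yt z v lam lamh ah Ah a A \<gamma> y"
proof -
  define sy :: "pt \<times> pt \<times> real \<times> pt \<times> real \<Rightarrow> pt" where "sy s = fst s" for s
  define sz :: "pt \<times> pt \<times> real \<times> pt \<times> real \<Rightarrow> pt" where "sz s = fst (snd s)" for s
  define sA :: "pt \<times> pt \<times> real \<times> pt \<times> real \<Rightarrow> real" where "sA s = fst (snd (snd s))" for s
  define sG :: "pt \<times> pt \<times> real \<times> pt \<times> real \<Rightarrow> pt" where "sG s = fst (snd (snd (snd s)))" for s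
  define sl :: "pt \<times> pt \<times> real \<times> pt \<times> real \<Rightarrow> real" where "sl s = snd (snd (snd (snd s)))" for s
  define fah where "fah s = (SOME a. 0 < a \<and> a = (C * (a + sA s) powr (r - 1) * sl s) powr (1 / r))" for s
  define fAh where "fAh s = fah s + sA s" for s
  define fx where "fx s = (sA s / fAh s) *\<^sub>R sy s + (fah s / fAh s) *\<^sub>R sz s" for s
  define fo where "fo k s = Orc k (fx s) (sl s)" for k s
  define fg where "fg k s = min (snd (snd (fo k s)) / sl s) 1" for k s
  define fa where "fa k s = fg k s * fah s" for k s
  define fA where "fA k s = fa k s + sA s" for k s
  define fG where "fG k s = sG s + fa k s *\<^sub>R fst (snd (fo k s))" for k s
  define fy where "fy k s = ((1 - fg k s) * sA s / fA k s) *\<^sub>R sy s + (fg k s * fAh s / fA k s) *\<^sub>R fst (fo k s)" for k s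
  define fz where "fz k s = (SOME z. is_arg_min (\<lambda>z. dotp d (fG k s) z + bregman d \<psi> z x0) (\<lambda>z. z \<in> Rd d) z)" for k s
  define st where "st = rec_nat (x0, x0, 0, 0, l1)
    (\<lambda>n s. (fy (Suc n) s, fz (Suc n) s, fA (Suc n) s, fG (Suc n) s, upd (Suc n) (sl s) (snd (snd (fo (Suc n) s)))))"
  have st_0: "sy (st 0) = x0" "sz (st 0) = x0" "sA (st 0) = 0" "sG (st 0) = 0" "sl (st 0) = l1"
    by (simp_all add: st_def sy_def sz_def sA_def sG_def sl_def)
  have st_Suc: "sy (st (Suc n)) = fy (Suc n) (st n)" "sz (st (Suc n)) = fz (Suc n) (st n)"
    "sA (st (Suc n)) = fA (Suc n) (st n)" "sG (st (Suc n)) = fG (Suc n) (st n)"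
    "sl (st (Suc n)) = upd (Suc n) (sl (st n)) (snd (snd (fo (Suc n) (st n))))" for n
    by (simp_all add: st_def sy_def sz_def sA_def sG_def sl_def)
  have ah: "0 < fah s \<and> fah s = (C * (fah s + sA s) powr (r - 1) * sl s) powr (1 / r)"
    if "0 \<le> sA s" "0 < sl s" for s
  proof -
    have "\<exists>a>0. a = (C * (a + sA s) powr (r - 1) * sl s) powr (1 / r)"
      using exists_weight[OF r that(1), of "C * sl s"] C that(2) by (simp add: mult.assoc mult.left_commute mult.commute)
    then show ?thesis unfolding fah_def by (rule someI_ex)
  qed
  have inv: "sy (st n) \<in> Rd d \<and> sz (st n) \<in> Rd d \<and> 0 \<le> sA (st n) \<and> 0 < sl (st n)" for n
  proof (induction n)
    case 0
    then show ?case by (simp add: st_0 x0 l1)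
  next
    case (Suc n)
    define s where "s = st n"
    have s: "sy s \<in> Rd d" "sz s \<in> Rd d" "0 \<le> sA s" "0 < sl s" using Suc by (auto simp: s_def)
    have xR: "fx s \<in> Rd d" using s by (auto simp: fx_def)
    have o: "fst (fo (Suc n) s) \<in> Rd d" "0 < snd (snd (fo (Suc n) s))"
      using Orc[OF xR s(4)] by (auto simp: fo_def)
    have "fy (Suc n) s \<in> Rd d" using s o by (auto simp: fy_def)
    moreover have "is_arg_min (\<lambda>z. dotp d (fG (Suc n) s) z + bregman d \<psi> z x0) (\<lambda>z. z \<in> Rd d) (fz (Suc n) s)"
      unfolding fz_def by (rule someI_ex[OF mirror])
    then have "fz (Suc n) s \<in> Rd d" by (simp add: is_arg_min_def)
    moreover have "0 \<le> fA (Suc n) s" using ah[OF s(3,4)] s o by (simp add: fA_def fa_def fg_def)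
    moreover have "0 < upd (Suc n) (sl s) (snd (snd (fo (Suc n) s)))" using upd s o by simp
    ultimately show ?case unfolding st_Suc s_def by simp
  qed
  \<comment> \<open>Iteration \<open>i\<close> is computed from the state with index
    \<open>i - 1\<close>.\<close>
  have G_sum: "dotp d (sG (st n)) w = (\<Sum>i=1..n. fa i (st (i - 1)) * dotp d (fst (snd (fo i (st (i - 1))))) w)" for n w
    by (induction n) (simp_all add: st_0 st_Suc fG_def dotp_simps)
  have "accel_run d \<psi> x0 r C Orc upd l1 (\<lambda>k. fx (st (k - 1))) (\<lambda>k. fst (fo k (st (k - 1)))) (\<lambda>k. sz (st k))
    (\<lambda>k. fst (snd (fo k (st (k - 1))))) (\<lambda>k. snd (snd (fo k (st (k - 1))))) (\<lambda>k. sl (st (k - 1)))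
    (\<lambda>k. fah (st (k - 1))) (\<lambda>k. fAh (st (k - 1))) (\<lambda>k. fa k (st (k - 1))) (\<lambda>k. sA (st k))
    (\<lambda>k. fg k (st (k - 1))) (\<lambda>k. sy (st k))"
    unfolding accel_run_def
  proof (intro conjI allI impI)
    fix k :: nat assume k: "1 \<le> k"
    then obtain n where n: "k = Suc n" by (cases k) auto
    note s = inv[of n]
    have xR: "fx (st n) \<in> Rd d" using s by (auto simp: fx_def)
    note o = Orc[OF xR, of "sl (st n)" k]
    show "0 < fah (st (k - 1))" using ah s n by simp
    show "fAh (st (k - 1)) = fah (st (k - 1)) + sA (st (k - 1))" by (simp add: fAh_def)
    show "0 < snd (snd (fo k (st (k - 1))))" using o s n by (simp add: fo_def)
    show "0 < sl (st (k - 1))" using s n by simp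
    show "fah (st (k - 1)) = (C * fAh (st (k - 1)) powr (r - 1) * sl (st (k - 1))) powr (1 / r)"
      unfolding fAh_def using ah[of "st n"] s n by simp
    show "fx (st (k - 1)) = (sA (st (k - 1)) / fAh (st (k - 1))) *\<^sub>R sy (st (k - 1)) + (fah (st (k - 1)) / fAh (st (k - 1))) *\<^sub>R sz (st (k - 1))"
      by (simp add: fx_def)
    show "fx (st (k - 1)) \<in> Rd d" using xR n by simp
    show "(fst (fo k (st (k - 1))), fst (snd (fo k (st (k - 1)))), snd (snd (fo k (st (k - 1))))) = Orc k (fx (st (k - 1))) (sl (st (k - 1)))"
      by (simp add: fo_def)
    show "fg k (st (k - 1)) = min (snd (snd (fo k (st (k - 1)))) / sl (st (k - 1))) 1" by (simp add: fg_def)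
    show "fa k (st (k - 1)) = fg k (st (k - 1)) * fah (st (k - 1))" by (simp add: fa_def)
    show "sA (st k) = fa k (st (k - 1)) + sA (st (k - 1))" using n by (simp add: st_Suc fA_def)
    show "sy (st k) = ((1 - fg k (st (k - 1))) * sA (st (k - 1)) / sA (st k)) *\<^sub>R sy (st (k - 1)) + (fg k (st (k - 1)) * fAh (st (k - 1)) / sA (st k)) *\<^sub>R fst (fo k (st (k - 1)))"
      using n by (simp add: st_Suc fy_def)
    have "is_arg_min (\<lambda>z. dotp d (sG (st k)) z + bregman d \<psi> z x0) (\<lambda>z. z \<in> Rd d) (sz (st k))"
      unfolding n st_Suc fz_def by (rule someI_ex[OF mirror])
    then show "mirror_step d \<psi> x0 (\<lambda>k. fa k (st (k - 1))) (\<lambda>k. fst (snd (fo k (st (k - 1))))) k (sz (st k))"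
      unfolding mirror_step_def G_sum .
    show "sl (st (Suc k - 1)) = upd k (sl (st (k - 1))) (snd (snd (fo k (st (k - 1)))))"
      using n by (simp add: st_Suc)
    show "0 \<le> sA (st (k - 1))" using s n by simp
  qed (simp_all add: st_0)
  then show ?thesis by blast
qed

end

text \<open>After translation by \<open>x0\<close> the objective is a linear function plus a power
  of degree at least \<open>2\<close> of the norm, hence coercive.\<close>

lemma exists_mirror_step:
  assumes p: "1 < p" and c: "0 < c" and x0: "x0 \<in> Rd d"
    and breg: "\<And>z. z \<in> Rd d \<Longrightarrow> bregman d \<psi> z x0 = c * pnorm d p (z - x0) powr max 2 p"
  shows "\<exists>z. is_arg_min (\<lambda>z. dotp d G z + bregman d \<psi> z x0) (\<lambda>z. z \<in> Rd d) z"
proof -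
  interpret coord_norm d "pnorm d p" by (rule coord_norm_pnorm[OF p])
  have P: "polyfun d (Suc 0) (\<lambda>h. \<Sum>i<d. h i * G i)"
    by (intro polyfun_sum polyfun.coord polyfun.const) auto
  have "\<exists>h\<in>Rd d. \<forall>z\<in>Rd d. (\<Sum>i<d. h i * G i) + c * pnorm d p h powr max 2 p
      \<le> (\<Sum>i<d. z i * G i) + c * pnorm d p z powr max 2 p"
    by (rule exists_min_poly_plus_power[OF P]) (use c in auto)
  then obtain h where h: "h \<in> Rd d" "\<And>z. z \<in> Rd d \<Longrightarrow>
      (\<Sum>i<d. h i * G i) + c * pnorm d p h powr max 2 p \<le> (\<Sum>i<d. z i * G i) + c * pnorm d p z powr max 2 p"
    by blast
  have dp: "(\<Sum>i<d. w i * G i) = dotp d G w" for w by (simp add: dotp_def mult.commute)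
  have "dotp d G (x0 + h) + bregman d \<psi> (x0 + h) x0 \<le> dotp d G z + bregman d \<psi> z x0" if "z \<in> Rd d" for z
    using h(2)[of "z - x0"] that x0 h(1) unfolding dp by (simp add: breg dotp_simps del: minus_apply)
  then show ?thesis using h(1) x0 unfolding is_arg_min_linorder by blast
qed

section \<open>Growth of the weights\<close>

text \<open>
  With $u_k = A_k l_k^{-\theta}$, the potential $A_k l_{k+1}^{-\theta} + K A_k^{1-\theta}$ bounds
  the sum of all $u_k$ by the sum over the steps outside \<open>U\<close>, and the potential
  $A_k^{-\kappa} l_{k+1}^{1/r}$ bounds the sum of all $u_k^{-\kappa}$ by the sum over
  \<open>U\<close>, where $A_k^{1/s}$ grows by a multiple of $u_k^{-\kappa}$.
\<close>

lemma adaptive_growth: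
  fixes r s C \<alpha> :: real
  assumes r: "1 < r" "r < s" and C: "0 < C" and \<alpha>: "1 < \<alpha>"
  defines "\<theta> \<equiv> s / (s - r)"
  shows "\<exists>c>0. \<forall>T (U :: nat set) A l G. 1 \<le> T \<longrightarrow> 0 < G \<longrightarrow> 1 \<in> U \<longrightarrow> A 0 = 0 \<longrightarrow>
    (\<forall>k\<in>{1..T}. 0 < l k \<and> 0 < A k \<and> A (k - 1) \<le> A k) \<longrightarrow>
    (\<forall>k\<in>{1..T} \<inter> U. A k - A (k - 1) = (C * A k powr (r - 1) * l k) powr (1 / r)) \<longrightarrow>
    (\<forall>k\<in>{1..T}. l (k + 1) = (if k \<in> U then \<alpha> * l k else inverse \<alpha> * l k)) \<longrightarrow>
    (\<Sum>k\<in>{1..T} - U. A k * l k powr (- \<theta>)) \<le> G \<longrightarrow>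
    A 1 * l 1 powr (- \<theta>) \<le> G \<longrightarrow>
    c * real T powr (s + s / r - 1) * G powr (- ((s - r) / r)) \<le> A T"
proof -
  \<comment> \<open>\<open>\<theta> * \<kappa> = 1 / r\<close>, so
    \<open>u k powr (- \<kappa>)\<close> contains \<open>l k powr (1 / r)\<close>, the power with
    which \<open>l\<close> enters the weight equation.\<close>
  define \<kappa> where "\<kappa> = 1 / r - 1 / s"
  define q where "q = \<alpha> powr (- \<theta>)"
  define Q where "Q = \<alpha> powr \<theta>"
  define b where "b = \<alpha> powr (1 / r)"
  \<comment> \<open>Half of the loss \<open>1 - q\<close> of an increasing step; the other half is
    spent on the growth of \<open>A\<close>.\<close>
  define \<eta> where "\<eta> = (1 - q) / 2"
  define K where "K = (\<eta> powr r / C) powr (- \<theta>) / (\<theta> - 1)"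
  define c1 where "c1 = (Q + 1 + K * C powr (- \<theta>)) / \<eta> + 2"
  define c2 where "c2 = 1 + b / (1 - 1 / b)"
  define c3 where "c3 = 1 / s * C powr (1 / r)"
  define c where "c = (c3 / c2 * c1 powr (- \<kappa>)) powr s"
  have \<theta>: "1 < \<theta>" using r by (simp add: \<theta>_def)
  have \<kappa>: "0 < \<kappa>" using r by (simp add: \<kappa>_def field_simps)
  have \<theta>\<kappa>: "\<theta> * \<kappa> = 1 / r" using r by (simp add: \<theta>_def \<kappa>_def field_simps)
  have q: "0 < q" "q < 1" using \<alpha> \<theta> powr_less_mono[of "- \<theta>" 0 \<alpha>] by (auto simp: q_def)
  have Q: "0 < Q" using \<alpha> by (simp add: Q_def)
  have b: "1 < b" using \<alpha> r powr_less_mono[of 0 "1/r" \<alpha>] by (simp add: b_def)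
  have \<eta>: "0 < \<eta>" "\<eta> < 1" using q by (auto simp: \<eta>_def)
  have K: "0 < K" using \<theta> \<eta> C by (simp add: K_def)
  have c1: "0 < c1" unfolding c1_def using Q K \<eta> by (intro add_pos_pos divide_pos_pos add_pos_nonneg mult_nonneg_nonneg) auto
  have c2: "0 < c2" using b by (simp add: c2_def add_pos_pos)
  have c3: "0 < c3" using r C by (simp add: c3_def)
  have c: "0 < c" using c1 c2 c3 by (simp add: c_def)
  show ?thesis
  proof (intro exI[of _ c] conjI c allI impI)
    fix T :: nat and U :: "nat set" and A l :: "nat \<Rightarrow> real" and G :: real
    assume T: "1 \<le> T" and G: "0 < G" and U1: "1 \<in> U" and A0: "A 0 = 0"
      and pos: "\<forall>k\<in>{1..T}. 0 < l k \<and> 0 < A k \<and> A (k - 1) \<le> A k"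
      and up: "\<forall>k\<in>{1..T} \<inter> U. A k - A (k - 1) = (C * A k powr (r - 1) * l k) powr (1 / r)"
      and lstep: "\<forall>k\<in>{1..T}. l (k + 1) = (if k \<in> U then \<alpha> * l k else inverse \<alpha> * l k)"
      and down: "(\<Sum>k\<in>{1..T} - U. A k * l k powr (- \<theta>)) \<le> G"
      and first: "A 1 * l 1 powr (- \<theta>) \<le> G"
    define u where "u k = A k * l k powr (- \<theta>)" for k
    define f where "f k = u k powr (- \<kappa>)" for k
    have u: "0 < u k" if "k \<in> {1..T}" for k using pos that unfolding u_def by (intro mult_pos_pos) force+
    have f: "0 < f k" if "k \<in> {1..T}" for k using u[OF that] by (simp add: f_def)
    have f_eq: "f k = A k powr (- \<kappa>) * l k powr (1 / r)" if "k \<in> {1..T}" for k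
      using pos that by (simp add: f_def u_def powr_mult powr_powr \<theta>\<kappa>)
    have up_l: "l (Suc k) = \<alpha> * l k" if "k \<in> {1..T}" "k \<in> U" for k using lstep that by simp
    have down_l: "l (Suc k) = inverse \<alpha> * l k" if "k \<in> {1..T}" "k \<notin> U" for k using lstep that by simp
    have up_pow: "l (Suc k) powr (- \<theta>) = q * l k powr (- \<theta>)" "l (Suc k) powr (1 / r) = b * l k powr (1 / r)"
      if "k \<in> {1..T}" "k \<in> U" for k
      using up_l[OF that] \<alpha> pos that by (auto simp: powr_mult q_def b_def)
    have down_pow: "l (Suc k) powr (- \<theta>) = Q * l k powr (- \<theta>)" "l (Suc k) powr (1 / r) = 1 / b * l k powr (1 / r)"
      if "k \<in> {1..T}" "k \<notin> U" for k
      using down_l[OF that] \<alpha> pos that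
      by (auto simp: powr_mult Q_def b_def powr_divide inverse_eq_divide powr_minus)
    \<comment> \<open>An increasing step multiplies \<open>l powr (- \<theta>)\<close> by
      \<open>q < 1\<close>, but \<open>A\<close> may jump at the same time. The second term
      decreases in \<open>A\<close> and pays for a jump.\<close>
    define \<Phi> where "\<Phi> k = A k * l (Suc k) powr (- \<theta>) + K * A k powr (1 - \<theta>)" for k
    have \<Phi>: "0 \<le> \<Phi> k" if "k \<in> {1..T}" for k
      unfolding \<Phi>_def using pos K that by (intro add_nonneg_nonneg mult_nonneg_nonneg) (force intro: less_imp_le)+
    define su where "su n = (\<Sum>k\<in>{1..n} \<inter> U. u k)" for n
    define sd where "sd n = (\<Sum>k\<in>{1..n} - U. u k)" for n
    have su_Suc: "su (Suc n) = su n + (if Suc n \<in> U then u (Suc n) else 0)" for n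
      unfolding su_def by (simp add: atLeastAtMostSuc_conv Int_insert_left)
    have sd_Suc: "sd (Suc n) = sd n + (if Suc n \<in> U then 0 else u (Suc n))" for n
      unfolding sd_def by (simp add: atLeastAtMostSuc_conv insert_Diff_if)
    have step1: "\<eta> * (su n - u 1) + \<Phi> n \<le> \<Phi> 1 + Q * sd n" if "1 \<le> n" "n \<le> T" for n
      using that
    proof (induction n rule: nat_induct_at_least)
      case base
      show ?case using U1 su_Suc[of 0] sd_Suc[of 0] by (simp add: su_def sd_def)
    next
      case (Suc n)
      let ?k = "Suc n"
      have k: "?k \<in> {1..T}" "n \<in> {1..T}" using Suc by auto
      have IH: "\<eta> * (su n - u 1) + \<Phi> n \<le> \<Phi> 1 + Q * sd n" using Suc by simp
      have An: "0 < A n" "A n \<le> A ?k" "0 < A ?k" "0 < l ?k" using pos k by force+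
      have mono: "A ?k powr (1 - \<theta>) + (\<theta> - 1) * A ?k powr (- \<theta>) * (A ?k - A n) \<le> A n powr (1 - \<theta>)"
        using powr_neg_ge_tangent[of "\<theta> - 1" "A n" "A ?k"] An \<theta> by (simp add: algebra_simps)
      show ?case
      proof (cases "?k \<in> U")
        case True
        define a where "a = A ?k - A n"
        have a: "a = (C * A ?k powr (r - 1) * l ?k) powr (1 / r)" "0 \<le> a"
          using up[rule_format, of ?k] k True An by (simp_all add: a_def)
        \<comment> \<open>A relative increase of at most \<open>\<eta>\<close> is absorbed by
          \<open>\<eta> * u ?k\<close>. A larger one forces \<open>l\<close> to be at least a
          multiple of \<open>A\<close>, by the weight equation; then
          \<open>l powr (- \<theta>)\<close> is at most a multiple of
          \<open>A powr (- \<theta>)\<close>, which the tangent of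
          \<open>K * A powr (1 - \<theta>)\<close> covers.\<close>
        have key: "a * l ?k powr (- \<theta>) \<le> \<eta> * u ?k + K * ((\<theta> - 1) * A ?k powr (- \<theta>) * a)"
        proof (cases "a \<le> \<eta> * A ?k")
          case True
          then have "a * l ?k powr (- \<theta>) \<le> \<eta> * A ?k * l ?k powr (- \<theta>)"
            by (intro mult_right_mono) auto
          moreover have "0 \<le> K * ((\<theta> - 1) * A ?k powr (- \<theta>) * a)" using K \<theta> a by simp
          ultimately show ?thesis by (simp add: u_def)
        next
          case False
          have "(\<eta> * A ?k) powr r \<le> a powr r" using False \<eta> An r by (intro powr_mono2) auto
          also have "a powr r = C * A ?k powr (r - 1) * l ?k"
            unfolding a(1) using C An r by (simp add: powr_powr)
          also have "(\<eta> * A ?k) powr r = \<eta> powr r * (A ?k powr (r - 1) * A ?k)"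
            using \<eta> An by (simp add: powr_mult powr_mult_base mult.commute)
          finally have "A ?k powr (r - 1) * (\<eta> powr r * A ?k) \<le> A ?k powr (r - 1) * (C * l ?k)"
            by (simp add: mult_ac)
          then have "\<eta> powr r * A ?k \<le> C * l ?k" using An by (simp add: mult_le_cancel_left_pos)
          then have "\<eta> powr r / C * A ?k \<le> l ?k" using C by (simp add: field_simps)
          then have "l ?k powr (- \<theta>) \<le> (\<eta> powr r / C * A ?k) powr (- \<theta>)"
            using An \<eta> C \<theta> by (intro powr_mono2') auto
          also have "\<dots> = K * (\<theta> - 1) * A ?k powr (- \<theta>)"
            using An \<eta> C \<theta> by (subst powr_mult) (simp_all add: K_def)
          finally have "a * l ?k powr (- \<theta>) \<le> a * (K * (\<theta> - 1) * A ?k powr (- \<theta>))"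
            using a by (intro mult_left_mono) auto
          moreover have "0 \<le> \<eta> * u ?k" using \<eta> u[OF k(1)] by simp
          ultimately show ?thesis by (simp add: mult_ac)
        qed
        have "\<Phi> ?k - \<Phi> n = q * u ?k - A n * l ?k powr (- \<theta>) + K * (A ?k powr (1 - \<theta>) - A n powr (1 - \<theta>))"
          using up_pow[OF k(1) True] by (simp add: \<Phi>_def u_def algebra_simps)
        also have "A n * l ?k powr (- \<theta>) = u ?k - a * l ?k powr (- \<theta>)" by (simp add: u_def a_def algebra_simps)
        also have "K * (A ?k powr (1 - \<theta>) - A n powr (1 - \<theta>)) \<le> K * (- ((\<theta> - 1) * A ?k powr (- \<theta>) * a))"
          using mono K by (intro mult_left_mono) (auto simp: a_def)
        also have "q * u ?k - (u ?k - a * l ?k powr (- \<theta>)) + K * (- ((\<theta> - 1) * A ?k powr (- \<theta>) * a))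
            \<le> q * u ?k - u ?k + \<eta> * u ?k" using key by simp
        also have "\<dots> = - (\<eta> * u ?k)" by (simp add: \<eta>_def field_simps)
        finally have "\<Phi> ?k - \<Phi> n \<le> - (\<eta> * u ?k)" by simp
        then show ?thesis using IH True by (simp add: su_Suc sd_Suc algebra_simps)
      next
        case False
        have "K * A ?k powr (1 - \<theta>) \<le> K * A n powr (1 - \<theta>)"
          using K An \<theta> by (intro mult_left_mono powr_mono2') auto
        moreover have "0 \<le> A n * l ?k powr (- \<theta>)" using An by simp
        ultimately have "\<Phi> ?k \<le> \<Phi> n + Q * u ?k"
          using down_pow[OF k(1) False] by (simp add: \<Phi>_def u_def algebra_simps)
        then show ?thesis using IH False by (simp add: su_Suc sd_Suc algebra_simps)
      qed
    qed
    have T1: "1 \<in> {1..T}" using T by simp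
    have A1: "A 1 = C * l 1"
    proof (rule weight_from_zero[OF r(1) _ C])
      show "A 1 = (C * A 1 powr (r - 1) * l 1) powr (1 / r)" using up U1 T1 A0 by force
    qed (use bspec[OF pos T1] in auto)
    have "su T + sd T \<le> c1 * G"
    proof -
      have sd: "sd T \<le> G" using down by (simp add: sd_def u_def)
      have "A 1 powr (1 - \<theta>) = C powr (- \<theta>) * u 1"
      proof -
        have "l 1 powr (1 - \<theta>) = l 1 * l 1 powr (- \<theta>)" "C powr (1 - \<theta>) = C * C powr (- \<theta>)"
          using bspec[OF pos T1] C by (simp_all add: powr_mult_base)
        then show ?thesis
          using bspec[OF pos T1] C unfolding u_def A1 by (simp add: powr_mult)
      qed
      also have "\<dots> \<le> C powr (- \<theta>) * G" using first by (intro mult_left_mono) (auto simp: u_def)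
      finally have "K * A 1 powr (1 - \<theta>) \<le> K * (C powr (- \<theta>) * G)" using K by (intro mult_left_mono) auto
      moreover have "A 1 * l (Suc 1) powr (- \<theta>) \<le> G"
      proof -
        have "A 1 * l (Suc 1) powr (- \<theta>) = q * u 1" using up_pow(1)[OF T1 U1] by (simp add: u_def)
        also have "\<dots> \<le> 1 * u 1" using q u[OF T1] by (intro mult_right_mono) auto
        finally show ?thesis using first by (simp add: u_def)
      qed
      ultimately have "\<Phi> 1 \<le> G + K * (C powr (- \<theta>) * G)" by (simp add: \<Phi>_def)
      moreover have "\<eta> * (su T - u 1) + \<Phi> T \<le> \<Phi> 1 + Q * sd T" using step1[OF T] by simp
      moreover have "0 \<le> \<Phi> T" using \<Phi> T by simp
      moreover have "Q * sd T \<le> Q * G" using sd Q by (intro mult_left_mono) auto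
      ultimately have "\<eta> * (su T - u 1) \<le> (Q + 1 + K * C powr (- \<theta>)) * G" by (simp add: algebra_simps)
      then have "su T - u 1 \<le> (Q + 1 + K * C powr (- \<theta>)) / \<eta> * G" using \<eta> by (simp add: field_simps)
      moreover have "u 1 \<le> G" using first by (simp add: u_def)
      ultimately show ?thesis using sd by (simp add: c1_def algebra_simps)
    qed
    moreover have "su T + sd T = (\<Sum>k\<in>{1..T}. u k)"
      unfolding su_def sd_def by (subst sum.union_disjoint[symmetric]) (auto intro: sum.cong)
    ultimately have sum_u: "(\<Sum>k\<in>{1..T}. u k) \<le> c1 * G" by simp
    define fu where "fu n = (\<Sum>k\<in>{1..n} \<inter> U. f k)" for n
    define fd where "fd n = (\<Sum>k\<in>{1..n} - U. f k)" for n
    have fu_Suc: "fu (Suc n) = fu n + (if Suc n \<in> U then f (Suc n) else 0)" for n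
      unfolding fu_def by (simp add: atLeastAtMostSuc_conv Int_insert_left)
    have fd_Suc: "fd (Suc n) = fd n + (if Suc n \<in> U then 0 else f (Suc n))" for n
      unfolding fd_def by (simp add: atLeastAtMostSuc_conv insert_Diff_if)
    \<comment> \<open>The old potential is at least \<open>f ?k\<close>, since \<open>A\<close> does
      not decrease. The new one is \<open>f ?k / b\<close> after a decreasing step, a loss of at
      least \<open>(1 - 1 / b) * f ?k\<close>, and \<open>b * f ?k\<close> after an increasing
      step.\<close>
    have step2: "A n powr (- \<kappa>) * l (Suc n) powr (1 / r) + (1 - 1 / b) * fd n \<le> b * fu n"
      if "1 \<le> n" "n \<le> T" for n
      using that
    proof (induction n rule: nat_induct_at_least)
      case base
      show ?case using U1 T1 fu_Suc[of 0] fd_Suc[of 0] up_pow[OF T1 U1] f_eq[OF T1] by (simp add: fu_def fd_def)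
    next
      case (Suc n)
      let ?k = "Suc n"
      have k: "?k \<in> {1..T}" "n \<in> {1..T}" using Suc by auto
      have IH: "A n powr (- \<kappa>) * l ?k powr (1 / r) + (1 - 1 / b) * fd n \<le> b * fu n" using Suc by simp
      have An: "0 < A n" "A n \<le> A ?k" "0 < A ?k" "0 < l ?k" using pos k by force+
      have "A ?k powr (- \<kappa>) \<le> A n powr (- \<kappa>)" using An \<kappa> by (intro powr_mono2') auto
      then have "f ?k \<le> A n powr (- \<kappa>) * l ?k powr (1 / r)"
        unfolding f_eq[OF k(1)] by (intro mult_right_mono) auto
      moreover have "0 \<le> A n powr (- \<kappa>) * l ?k powr (1 / r)" by simp
      moreover have "A ?k powr (- \<kappa>) * l (Suc ?k) powr (1 / r) = (if ?k \<in> U then b else 1 / b) * f ?k"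
        using up_pow[OF k(1)] down_pow[OF k(1)] f_eq[OF k(1)] by simp
      ultimately show ?case using IH
        unfolding fu_Suc fd_Suc
        by (cases "?k \<in> U"; simp only: if_True if_False add_0_right distrib_left left_diff_distrib mult_1_left; linarith)
    qed
    have f_all: "(\<Sum>k\<in>{1..T}. f k) \<le> c2 * fu T"
    proof -
      have "0 \<le> A T powr (- \<kappa>) * l (Suc T) powr (1 / r)" by simp
      then have "(1 - 1 / b) * fd T \<le> b * fu T" using step2[OF T order.refl] by linarith
      then have "fd T \<le> b / (1 - 1 / b) * fu T"
        using b by (simp add: pos_le_divide_eq mult.commute)
      moreover have "fu T + fd T = (\<Sum>k\<in>{1..T}. f k)"
        unfolding fu_def fd_def by (subst sum.union_disjoint[symmetric]) (auto intro: sum.cong)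
      ultimately show ?thesis by (simp add: c2_def algebra_simps)
    qed
    \<comment> \<open>Concavity of the power \<open>1 / s\<close>, with the tangent at the later
      partial sum; inserting the weight equation produces the exponent \<open>- \<kappa>\<close> of
      \<open>A\<close>.\<close>
    have step3: "c3 * fu n \<le> A n powr (1 / s)" if "n \<le> T" for n
      using that
    proof (induction n)
      case 0
      show ?case by (simp add: fu_def A0)
    next
      case (Suc n)
      let ?k = "Suc n"
      have k: "?k \<in> {1..T}" using Suc by auto
      have An: "0 \<le> A n" "A n \<le> A ?k" "0 < A ?k" "0 < l ?k" using bspec[OF pos k] bspec[OF pos, of n] k A0 by (cases n; simp)+
      have IH: "c3 * fu n \<le> A n powr (1 / s)" using Suc by simp
      show ?case
      proof (cases "?k \<in> U")
        case True
        have "A n powr (1 / s) \<le> A ?k powr (1 / s) + 1 / s * A ?k powr (1 / s - 1) * (A n - A ?k)"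
          using An r by (intro powr_le_tangent) auto
        then have "A n powr (1 / s) + 1 / s * A ?k powr (1 / s - 1) * (A ?k - A n) \<le> A ?k powr (1 / s)"
          by (simp only: right_diff_distrib)
        moreover have "A ?k - A n = C powr (1 / r) * A ?k powr (1 - 1 / r) * l ?k powr (1 / r)"
        proof -
          have "A ?k - A n = (C * A ?k powr (r - 1) * l ?k) powr (1 / r)"
            using bspec[OF up, of ?k] k True by simp
          also have "\<dots> = C powr (1 / r) * A ?k powr ((r - 1) / r) * l ?k powr (1 / r)"
            using C An by (simp add: powr_mult powr_powr)
          finally show ?thesis using r by (simp add: diff_divide_distrib)
        qed
        moreover have "1 / s * A ?k powr (1 / s - 1) * (C powr (1 / r) * A ?k powr (1 - 1 / r) * l ?k powr (1 / r)) = c3 * f ?k"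
        proof -
          have "A ?k powr (1 / s - 1) * A ?k powr (1 - 1 / r) = A ?k powr (- \<kappa>)"
            by (simp flip: powr_add add: \<kappa>_def)
          then show ?thesis unfolding f_eq[OF k] c3_def by (simp flip: \<open>A ?k powr (1 / s - 1) * _ = _\<close>)
        qed
        ultimately have "A n powr (1 / s) + c3 * f ?k \<le> A ?k powr (1 / s)" by (simp only:)
        then show ?thesis using IH True by (simp add: fu_Suc algebra_simps)
      next
        case False
        have "A n powr (1 / s) \<le> A ?k powr (1 / s)" using An r by (intro powr_mono2) auto
        then show ?thesis using IH False by (simp add: fu_Suc)
      qed
    qed
    \<comment> \<open>Jensen's inequality over all \<open>T\<close> steps is what gains the
      additional \<open>\<kappa>\<close> in the exponent of \<open>T\<close>.\<close>
    have "real T powr (1 + \<kappa>) * (c1 * G) powr (- \<kappa>) \<le> (\<Sum>k\<in>{1..T}. f k)"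
      using sum_powr_neg_ge[of "{1..T}" u \<kappa> "c1 * G"] T u \<kappa> sum_u c1 G by (simp add: f_def)
    also note f_all
    also have "fu T \<le> A T powr (1 / s) / c3" using step3[of T] c3 by (simp add: field_simps)
    finally have "real T powr (1 + \<kappa>) * (c1 * G) powr (- \<kappa>) \<le> c2 * (A T powr (1 / s) / c3)"
      using c2 by simp
    then have "c3 / c2 * c1 powr (- \<kappa>) * (real T powr (1 + \<kappa>) * G powr (- \<kappa>)) \<le> A T powr (1 / s)"
      using c2 c3 c1 G by (simp add: powr_mult field_simps)
    then have "(c3 / c2 * c1 powr (- \<kappa>) * (real T powr (1 + \<kappa>) * G powr (- \<kappa>))) powr s \<le> (A T powr (1 / s)) powr s"
      using r c1 c2 c3 by (intro powr_mono2) auto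
    also have "(A T powr (1 / s)) powr s = A T" using bspec[OF pos, of T] T r by (simp add: powr_powr)
    also have "(c3 / c2 * c1 powr (- \<kappa>) * (real T powr (1 + \<kappa>) * G powr (- \<kappa>))) powr s
        = c * (real T powr ((1 + \<kappa>) * s) * G powr (- \<kappa> * s))"
      using c1 c2 c3 by (subst powr_mult) (simp_all add: c_def powr_mult powr_powr)
    also have "(1 + \<kappa>) * s = s + s / r - 1" using r by (simp add: \<kappa>_def field_simps)
    also have "- \<kappa> * s = - ((s - r) / r)" using r by (simp add: \<kappa>_def field_simps)
    finally show "c * real T powr (s + s / r - 1) * G powr (- ((s - r) / r)) \<le> A T" by (simp add: mult.assoc)
  qed
qed

section \<open>The two regimes\<close>

text \<open>By concavity of the power \<open>1 / r\<close>, each step raises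
  \<open>A powr (1 / r)\<close> by at least \<open>c powr (1 / r) / r\<close>.\<close>

lemma constant_growth:
  fixes A :: "nat \<Rightarrow> real" and r c :: real
  assumes r: "1 < r" and c: "0 < c" and A0: "A 0 = 0"
    and pos: "\<forall>k\<in>{1..T}. 0 < A k \<and> A (k - 1) \<le> A k"
    and step: "\<forall>k\<in>{1..T}. A k - A (k - 1) = (c * A k powr (r - 1)) powr (1 / r)"
  shows "c * (real T / r) powr r \<le> A T"
proof -
  have "c powr (1 / r) * (real n / r) \<le> A n powr (1 / r)" if "n \<le> T" for n
    using that
  proof (induction n)
    case 0
    show ?case by simp
  next
    case (Suc n)
    let ?k = "Suc n"
    have k: "?k \<in> {1..T}" using Suc by auto
    have An: "0 \<le> A n" "0 < A ?k" using bspec[OF pos k] bspec[OF pos, of n] k A0 by (cases n; simp)+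
    have t: "A n powr (1 / r) \<le> A ?k powr (1 / r) + 1 / r * A ?k powr (1 / r - 1) * (A n - A ?k)"
      using An r by (intro powr_le_tangent) auto
    have eq: "A n - A ?k = - (c powr (1 / r) * A ?k powr (1 - 1 / r))"
    proof -
      have "A ?k - A n = (c * A ?k powr (r - 1)) powr (1 / r)" using bspec[OF step k] by simp
      also have "\<dots> = c powr (1 / r) * A ?k powr ((r - 1) * (1 / r))"
        by (simp only: powr_mult powr_powr)
      also have "(r - 1) * (1 / r) = 1 - 1 / r" using r by (simp add: field_simps)
      finally show ?thesis by simp
    qed
    have "A ?k powr (1 / r - 1) * A ?k powr (1 - 1 / r) = 1" using An by (simp flip: powr_add)
    then have "1 / r * A ?k powr (1 / r - 1) * - (c powr (1 / r) * A ?k powr (1 - 1 / r)) = - (c powr (1 / r) / r)"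
      by (simp add: mult.left_commute)
    then have "A n powr (1 / r) + c powr (1 / r) / r \<le> A ?k powr (1 / r)" using t unfolding eq by linarith
    moreover have "c powr (1 / r) * (real n / r) \<le> A n powr (1 / r)" using Suc by simp
    moreover have "c powr (1 / r) * (real ?k / r) = c powr (1 / r) * (real n / r) + c powr (1 / r) / r"
      by (simp add: add_divide_distrib distrib_left)
    ultimately show ?case by linarith
  qed
  then have "(c powr (1 / r) * (real T / r)) powr r \<le> (A T powr (1 / r)) powr r"
    using r c by (intro powr_mono2) auto
  moreover have "(A T powr (1 / r)) powr r = A T"
    using r A0 bspec[OF pos, of T] by (cases "T = 0") (simp_all add: powr_powr)
  moreover have "(c powr (1 / r) * (real T / r)) powr r = c * (real T / r) powr r"
    using r c by (subst powr_mult) (simp add: powr_powr)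
  ultimately show ?thesis by simp
qed

text \<open>Weighted Young for \<open>n powr m\<close> and \<open>\<rho> powr m\<close> with weights
  \<open>s / m\<close> and \<open>1 - s / m\<close>. The two sides agree at distance
  \<open>\<rho>\<close>, so this scale is where the degree \<open>s\<close> bound is sharp.\<close>

lemma inexact_from_uniform:
  assumes p: "1 < p" and UC: "uniformly_convex d (pnorm d p) 1 m \<psi>"
    and s: "1 < s" "s \<le> m" and \<rho>: "0 < \<rho>"
  shows "inexact_uniformly_convex d (pnorm d p) (\<rho> powr m * (1 / s - 1 / m)) (\<rho> powr (m - s)) s \<psi>"
  unfolding inexact_uniformly_convex_def
proof (intro conjI ballI)
  show "times_differentiable d 1 \<psi>" using UC by (simp add: uniformly_convex_def inexact_uniformly_convex_def)
  fix x y assume xy: "x \<in> Rd d" "y \<in> Rd d"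
  define n where "n = pnorm d p (x - y)"
  have n: "0 \<le> n" by (simp add: n_def)
  have "\<rho> powr (m - s) / s * n powr s - \<rho> powr m * (1 / s - 1 / m) \<le> 1 / m * n powr m"
  proof (cases "n = 0")
    case True
    have "1 / m \<le> 1 / s" using s by (simp add: frac_le)
    then show ?thesis using True \<rho> by simp
  next
    case False
    then have n0: "0 < n" using n by simp
    have "(n powr m) powr (s / m) * (\<rho> powr m) powr (1 - s / m) \<le> s / m * n powr m + (1 - s / m) * \<rho> powr m"
      using s n0 \<rho> by (intro Youngs_inequality_0) auto
    moreover have "(n powr m) powr (s / m) = n powr s" "(\<rho> powr m) powr (1 - s / m) = \<rho> powr (m - s)"
      using s by (simp_all add: powr_powr right_diff_distrib)
    ultimately have "n powr s * \<rho> powr (m - s) / s \<le> (s / m * n powr m + (1 - s / m) * \<rho> powr m) / s"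
      using s by (intro divide_right_mono) auto
    also have "\<dots> = 1 / m * n powr m + \<rho> powr m * (1 / s - 1 / m)"
      using s by (simp add: field_simps)
    finally show ?thesis by (simp add: mult.commute)
  qed
  moreover have "1 / m * n powr m - 0 \<le> bregman d \<psi> x y"
    using UC xy unfolding uniformly_convex_def inexact_uniformly_convex_def n_def by blast
  ultimately show "\<rho> powr (m - s) / s * pnorm d p (x - y) powr s - \<rho> powr m * (1 / s - 1 / m) \<le> bregman d \<psi> x y"
    by (simp add: n_def)
qed

lemma rate_eq: "rate s p L R T = L * R powr s * real T powr (- (s + s / max 2 p - 1))"
proof -
  have "((max 2 p + 1) * s - max 2 p) / max 2 p = s + s / max 2 p - 1"
    by (simp add: field_simps)
  then show ?thesis by (simp add: rate_def Let_def)
qed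

text \<open>Reason for the choice of \<open>M\<close>: the summand \<open>C / t\<close> keeps the
  gradient error within the tolerance \<open>t\<close>, and \<open>4\<close> matches the tolerance
  \<open>1/4\<close> for the subgradient error.\<close>

lemma model_weight_bounds:
  fixes C L t :: real
  assumes "0 \<le> C" "0 < L" "0 < t"
  shows "0 < L * (C / t + 4)" "C * L \<le> t * (L * (C / t + 4))" "L \<le> 1/4 * (L * (C / t + 4))"
proof -
  show "0 < L * (C / t + 4)" using assms by (intro mult_pos_pos add_nonneg_pos) auto
  have "t * (L * (C / t + 4)) = C * L + 4 * t * L" using assms by (simp add: field_simps)
  then show "C * L \<le> t * (L * (C / t + 4))" using assms by simp
  have "1/4 * (L * (C / t + 4)) = L * (C / t) / 4 + L" by (simp add: algebra_simps)
  then show "L \<le> 1/4 * (L * (C / t + 4))" using assms by simp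
qed

section \<open>The two alternatives of the claim and a start at the minimizer\<close>

definition attained_by_A :: "nat \<Rightarrow> real \<Rightarrow> nat \<Rightarrow> real \<Rightarrow> real \<Rightarrow> real \<Rightarrow> nat \<Rightarrow> pt \<Rightarrow> real \<Rightarrow> bool"
  where "attained_by_A d p q \<nu> L R T x0 \<epsilon> \<longleftrightarrow>
      (\<exists>\<psi> \<delta> \<mu> r \<sigma> \<sigma>' lam Y V.
         admissible_A d (pnorm d p) \<psi> \<delta> \<mu> r \<sigma> \<sigma>' lam \<and>
         (\<forall>f xstar. smooth_convex_problem d p q \<nu> L f xstar \<longrightarrow> pnorm d p (xstar - x0) = R \<longrightarrow>
            (\<exists>y. algorithm_A d (pnorm d p) f \<psi> \<mu> r \<sigma> \<sigma>' lam (one_query_prox d f q Y V) x0 T y) \<and>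
            (\<forall>y. algorithm_A d (pnorm d p) f \<psi> \<mu> r \<sigma> \<sigma>' lam (one_query_prox d f q Y V) x0 T y \<longrightarrow>
               f (y T) - f xstar \<le> \<epsilon>)))"

definition attained_by_B :: "nat \<Rightarrow> real \<Rightarrow> nat \<Rightarrow> real \<Rightarrow> real \<Rightarrow> real \<Rightarrow> nat \<Rightarrow> pt \<Rightarrow> real \<Rightarrow> bool"
  where "attained_by_B d p q \<nu> L R T x0 \<epsilon> \<longleftrightarrow>
      (\<exists>\<psi> r \<sigma> \<sigma>' \<alpha> lamh0 Y V.
         admissible_B d (pnorm d p) \<psi> r \<sigma> \<sigma>' \<alpha> lamh0 \<and>
         (\<forall>f xstar. smooth_convex_problem d p q \<nu> L f xstar \<longrightarrow> pnorm d p (xstar - x0) = R \<longrightarrow>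
            (\<exists>y. algorithm_B d (pnorm d p) f \<psi> r \<sigma> \<sigma>' \<alpha> lamh0 (one_query_gen_prox d f q Y V) x0 T y) \<and>
            (\<forall>y. algorithm_B d (pnorm d p) f \<psi> r \<sigma> \<sigma>' \<alpha> lamh0 (one_query_gen_prox d f q Y V) x0 T y \<longrightarrow>
               f (y T) - f xstar \<le> \<epsilon>)))"

text \<open>For \<open>R = 0\<close> the scales \<open>\<rho>\<close> and \<open>l0\<close> of the
  main cases would be zero and the parameters inadmissible. Here \<open>x0\<close> is the minimizer,
  so a constant oracle suffices, and the right-hand side is zero for every \<open>K\<close> and
  \<open>s\<close>.\<close>

lemma problem_at_center:
  assumes p: "1 < p" and x0: "x0 \<in> Rd d" and L: "0 < L"
  shows "attained_by_A d p q \<nu> L 0 T x0 (K * rate s p L 0 T)"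
proof -
  interpret coord_norm d "pnorm d p" by (rule coord_norm_pnorm[OF p])
  define m where "m = max 2 p"
  have m: "1 < m" by (simp add: m_def)
  obtain c where c: "0 < c" "\<forall>d x0. uniformly_convex d (pnorm d p) 1 (max 2 p) (regularizer d p c x0) \<and>
    (x0 \<in> Rd d \<longrightarrow> (\<forall>z\<in>Rd d. bregman d (regularizer d p c x0) z x0 = c * pnorm d p (z - x0) powr max 2 p))"
    using exists_regularizer[OF p] by blast
  define \<psi> where "\<psi> = regularizer d p c x0"
  have UC: "uniformly_convex d (pnorm d p) 1 m \<psi>"
    and breg: "\<And>z. z \<in> Rd d \<Longrightarrow> bregman d \<psi> z x0 = c * pnorm d p (z - x0) powr max 2 p"
    using c(2) x0 unfolding \<psi>_def m_def by blast+
  define Y :: "pt \<Rightarrow> real \<Rightarrow> (pt list \<Rightarrow> real) \<Rightarrow> pt" where "Y = (\<lambda>_ _ _. x0)"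
  define V :: "pt \<Rightarrow> real \<Rightarrow> (pt list \<Rightarrow> real) \<Rightarrow> (pt list \<Rightarrow> real) \<Rightarrow> pt" where "V = (\<lambda>_ _ _ _. 0)"
  have orc: "one_query_prox d f q Y V x l = (x0, 0)" for f x l
    by (simp add: one_query_prox_def Y_def V_def Let_def)
  have adm: "admissible_A d (pnorm d p) \<psi> 0 1 m (prox_tol m) (1/4) (\<lambda>_. 1)"
    using UC prox_tol_bounds[OF m] m by (simp add: admissible_A_def uniformly_convex_def)
  have main: "(\<exists>y. algorithm_A d (pnorm d p) f \<psi> 1 m (prox_tol m) (1/4) (\<lambda>_. 1) (one_query_prox d f q Y V) x0 T y) \<and>
            (\<forall>y. algorithm_A d (pnorm d p) f \<psi> 1 m (prox_tol m) (1/4) (\<lambda>_. 1) (one_query_prox d f q Y V) x0 T y \<longrightarrow>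
               f (y T) - f xstar \<le> K * rate s p L 0 T)"
    if f: "smooth_convex_problem d p q \<nu> L f xstar" and xs: "pnorm d p (xstar - x0) = 0" for f xstar
  proof
    have "xstar \<in> Rd d" and min: "\<And>z. z \<in> Rd d \<Longrightarrow> f xstar \<le> f z"
      using f unfolding smooth_convex_problem_def is_arg_min_linorder by auto
    then have xs0: "xstar = x0" using N_eq_0[of "xstar - x0"] xs x0 by simp
    show "\<forall>y. algorithm_A d (pnorm d p) f \<psi> 1 m (prox_tol m) (1/4) (\<lambda>_. 1) (one_query_prox d f q Y V) x0 T y \<longrightarrow>
               f (y T) - f xstar \<le> K * rate s p L 0 T"
    proof (intro allI impI)
      fix y assume "algorithm_A d (pnorm d p) f \<psi> 1 m (prox_tol m) (1/4) (\<lambda>_. 1) (one_query_prox d f q Y V) x0 T y"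
      then have "y 0 = x0" "\<forall>k\<in>{1..T}. y k = x0"
        unfolding algorithm_A_def orc by blast+
      then have "y T = x0" by (cases "T = 0") auto
      then show "f (y T) - f xstar \<le> K * rate s p L 0 T" by (simp add: xs0 rate_def Let_def)
    qed
    have C: "0 < step_const 1 m (prox_tol m) (1/4)" by (rule step_const_pos[OF m]) simp
    have mir: "\<exists>z. is_arg_min (\<lambda>z. dotp d G z + bregman d \<psi> z x0) (\<lambda>z. z \<in> Rd d) z" for G
      by (rule exists_mirror_step[OF p c(1) x0 breg])
    have "\<exists>x yt z v lam lamh ah Ah a A \<gamma> y. accel_run d \<psi> x0 m (step_const 1 m (prox_tol m) (1/4))
        (\<lambda>_ _ _. (x0, 0, 1)) (\<lambda>_ _ _. 1) 1 x yt z v lam lamh ah Ah a A \<gamma> y"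
      by (rule exists_run[OF m C _ x0 _ _ mir]) (use x0 in auto)
    then obtain x yt z v lam lamh ah Ah a A \<gamma> y where
      "accel_run d \<psi> x0 m (step_const 1 m (prox_tol m) (1/4)) (\<lambda>_ _ _. (x0, 0, 1)) (\<lambda>_ _ _. 1) 1 x yt z v lam lamh ah Ah a A \<gamma> y"
      by blast
    note run = accel_runD[OF this]
    have lamh: "lamh k = 1" if "1 \<le> k" for k
      using run(4) run(18)[of "k - 1"] that by (cases "k = 1") auto
    have simp: "lam k = 1" "\<gamma> k = 1" "a k = ah k" "A k = Ah k" "yt k = x0" "v k = 0" if k: "1 \<le> k" for k
      using run(12,13,14,15,6)[OF k] lamh[OF k] by auto
    have y: "y k = x0" for k
    proof (cases "k = 0")
      case False
      then have k: "1 \<le> k" by simp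
      have "0 < Ah k" using run(5,6,19)[OF k] by simp
      then show ?thesis using run(16)[OF k] simp[OF k] by simp
    qed (simp add: run)
    \<comment> \<open>With vanishing subgradients the mirror step minimizes the Bregman distance
      from \<open>x0\<close> alone.\<close>
    have z: "z k = x0" for k
    proof (cases "k = 0")
      case False
      then have k: "1 \<le> k" by simp
      have v0: "(\<Sum>i=1..k. a i * dotp d (v i) w) = 0" for w
        using simp(6) by (intro sum.neutral) (auto simp: dotp_simps)
      have "z k \<in> Rd d" "bregman d \<psi> (z k) x0 \<le> bregman d \<psi> x0 x0"
        using run(17)[OF k] x0 unfolding mirror_step_def is_arg_min_linorder v0 by auto
      then have "c * pnorm d p (z k - x0) powr m \<le> 0" using breg x0 by (simp add: m_def N_0)
      then have "pnorm d p (z k - x0) = 0" using c(1) by (simp add: mult_le_0_iff)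
      then show ?thesis using N_eq_0[of "z k - x0"] \<open>z k \<in> Rd d\<close> x0 by simp
    qed (simp add: run)
    have x: "x k = x0" if k: "1 \<le> k" for k
    proof -
      have "A (k - 1) / Ah k + ah k / Ah k = 1"
        using run(5,6,19)[OF k] by (simp flip: add_divide_distrib)
      then show ?thesis using run(10)[OF k] by (simp add: y z flip: scaleR_add_left)
    qed
    have prox: "prox_answer d (pnorm d p) f m (prox_tol m) (1/4) x0 1 (x0 + 0) 0"
      by (rule prox_answerI[where g = 0 and \<epsilon> = 0])
         (use m x0 prox_tol_bounds[OF m] min xs0 in \<open>auto simp: dotp_simps N_0\<close>)
    show "\<exists>y. algorithm_A d (pnorm d p) f \<psi> 1 m (prox_tol m) (1/4) (\<lambda>_. 1) (one_query_prox d f q Y V) x0 T y"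
      unfolding algorithm_A_def orc
    proof (rule exI[of _ y], rule exI[of _ x], rule exI[of _ z], rule exI[of _ v], rule exI[of _ a], rule exI[of _ A],
        intro conjI ballI)
      fix k assume "k \<in> {1..T}"
      then have k: "1 \<le> k" by simp
      show "0 < a k" using run(5)[OF k] simp[OF k] by simp
      show "A k = a k + A (k - 1)" by (rule run(15)[OF k])
      show "a k = (step_const 1 m (prox_tol m) (1/4) * A k powr (m - 1) * 1) powr (1 / m)"
        using run(9)[OF k] simp[OF k] lamh[OF k] by simp
      show "x k = (A (k - 1) / A k) *\<^sub>R y (k - 1) + (a k / A k) *\<^sub>R z (k - 1)"
        using run(10)[OF k] simp[OF k] by simp
      show "(y k, v k) = (x0, 0)" using y simp[OF k] by simp
      show "prox_answer d (pnorm d p) f m (prox_tol m) (1/4) (x k) 1 (y k) (v k)"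
        using prox x[OF k] y simp[OF k] by simp
      show "mirror_step d \<psi> x0 a v k (z k)" by (rule run(17)[OF k])
    qed (simp_all add: run)
  qed
  show ?thesis unfolding attained_by_A_def using adm main by blast
qed

section \<open>Rate of algorithm A for \<open>s \<le> m\<close>\<close>

lemma nonadaptive_case:
  assumes q: "1 \<le> q" "0 < \<nu>" and p: "1 < p" and sm: "real q + \<nu> \<le> max 2 p"
  shows "\<exists>K. \<forall>d L R T x0. 0 < L \<longrightarrow> 0 < R \<longrightarrow> 1 \<le> T \<longrightarrow> x0 \<in> Rd d \<longrightarrow>
    attained_by_A d p q \<nu> L R T x0 (K * rate (real q + \<nu>) p L R T)"
proof -
  define s where "s = real q + \<nu>"
  define m where "m = max 2 p"
  have s: "1 < s" "real q < s" "s \<le> m" using q sm by (auto simp: s_def m_def)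
  have m: "1 < m" by (simp add: m_def)
  obtain Cq :: real where Cq: "0 \<le> Cq" "\<And>(b :: nat \<Rightarrow> real) M. (\<forall>t\<in>{0..1}. \<bar>\<Sum>j\<le>q. b j * t ^ j\<bar> \<le> M) \<Longrightarrow> (\<forall>j\<le>q. \<bar>b j\<bar> \<le> Cq * M)"
    using poly_coeff_bound[of q] by blast
  obtain c where c: "0 < c" "\<forall>d x0. uniformly_convex d (pnorm d p) 1 (max 2 p) (regularizer d p c x0) \<and>
    (x0 \<in> Rd d \<longrightarrow> (\<forall>z\<in>Rd d. bregman d (regularizer d p c x0) z x0 = c * pnorm d p (z - x0) powr max 2 p))"
    using exists_regularizer[OF p] by blast
  note sb = prox_tol_bounds[OF s(1)]
  define B where "B = Cq * 2 * 2 powr s / prox_tol s + 4"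
  have B: "0 < B" using Cq sb by (simp add: B_def add_nonneg_pos)
  define C1 where "C1 = step_const 1 s (prox_tol s) (1/4)"
  have C1: "0 < C1" unfolding C1_def by (rule step_const_pos[OF s(1)]) simp
  define K where "K = (c + 2) * s powr s * B / C1"
  have K: "0 < K" using c s B C1 by (simp add: K_def)
  show ?thesis
  proof (rule exI[of _ K], intro allI impI)
    fix d T :: nat and L R :: real and x0 :: pt
    assume L: "0 < L" and R: "0 < R" and T: "1 \<le> T" and x0: "x0 \<in> Rd d"
    interpret coord_norm d "pnorm d p" by (rule coord_norm_pnorm[OF p])
    define M where "M = L * B"
    have M: "0 < M" using L B by (simp add: M_def)
    have M1: "Cq * 2 * 2 powr s * L \<le> prox_tol s * M" "L \<le> 1/4 * M"
      unfolding M_def B_def using model_weight_bounds[of "Cq * 2 * 2 powr s" L "prox_tol s"] Cq L sb by auto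
    \<comment> \<open>The largest scale, up to constants, for which \<open>T\<close> errors of size
      \<open>\<rho> powr m\<close> stay of the order \<open>R powr m\<close>.\<close>
    define \<rho> where "\<rho> = R * real T powr (- 1 / m)"
    have \<rho>: "0 < \<rho>" using R T by (simp add: \<rho>_def)
    define \<mu> where "\<mu> = \<rho> powr (m - s)"
    define \<delta> where "\<delta> = \<rho> powr m * (1 / s - 1 / m)"
    have \<mu>: "0 < \<mu>" using \<rho> by (simp add: \<mu>_def)
    have \<rho>m: "\<rho> powr m = R powr m / real T"
    proof -
      have "- 1 / m * m = - 1" using m by simp
      then have "\<rho> powr m = R powr m * real T powr (- 1)" by (simp only: \<rho>_def powr_mult powr_powr)
      then show ?thesis using T by (simp add: powr_minus_divide)
    qed
    have \<delta>: "0 \<le> \<delta>" "\<delta> \<le> R powr m / real T"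
    proof -
      have "1 / m \<le> 1 / s" "1 / s \<le> 1" "0 \<le> 1 / m" using s m by (simp_all add: frac_le)
      then have le: "0 \<le> 1 / s - 1 / m" "1 / s - 1 / m \<le> 1" by linarith+
      show "0 \<le> \<delta>" unfolding \<delta>_def using le by simp
      have "\<delta> \<le> \<rho> powr m * 1" unfolding \<delta>_def using le by (intro mult_left_mono) auto
      then show "\<delta> \<le> R powr m / real T" by (simp add: \<rho>m)
    qed
    define \<psi> where "\<psi> = regularizer d p c x0"
    have UC: "uniformly_convex d (pnorm d p) 1 m \<psi>"
      and breg: "\<And>z. z \<in> Rd d \<Longrightarrow> bregman d \<psi> z x0 = c * pnorm d p (z - x0) powr max 2 p"
      using c(2) x0 unfolding \<psi>_def m_def by blast+
    have IUC: "inexact_uniformly_convex d (pnorm d p) \<delta> \<mu> s \<psi>"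
      unfolding \<delta>_def \<mu>_def by (rule inexact_from_uniform[OF p UC s(1,3) \<rho>])
    have mir: "\<exists>z. is_arg_min (\<lambda>z. dotp d G z + bregman d \<psi> z x0) (\<lambda>z. z \<in> Rd d) z" for G
      by (rule exists_mirror_step[OF p c(1) x0 breg])
    define Y where "Y = (\<lambda>x (_::real) ans. x + taylor_step M s q ans)"
    define V where "V = (\<lambda>(_::pt) (_::real) ans ans'. ans_grad (if q = 1 then ans else ans'))"
    have adm: "admissible_A d (pnorm d p) \<psi> \<delta> \<mu> s (prox_tol s) (1/4) (\<lambda>_. 1 / M)"
      using s \<mu> \<delta> IUC sb M by (simp add: admissible_A_def)
    have main: "(\<exists>y. algorithm_A d (pnorm d p) f \<psi> \<mu> s (prox_tol s) (1/4) (\<lambda>_. 1 / M) (one_query_prox d f q Y V) x0 T y) \<and>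
            (\<forall>y. algorithm_A d (pnorm d p) f \<psi> \<mu> s (prox_tol s) (1/4) (\<lambda>_. 1 / M) (one_query_prox d f q Y V) x0 T y \<longrightarrow>
               f (y T) - f xstar \<le> K * rate s p L R T)"
      if prob: "smooth_convex_problem d p q \<nu> L f xstar" and xsR: "pnorm d p (xstar - x0) = R" for f xstar
    proof
      have f: "times_differentiable d q f" "holder_deriv d (pnorm d p) q L \<nu> f" "convex_on (Rd d) f"
        and xs: "xstar \<in> Rd d" and min: "\<And>z. z \<in> Rd d \<Longrightarrow> f xstar \<le> f z"
        using prob unfolding smooth_convex_problem_def is_arg_min_linorder by auto
      let ?O = "one_query_prox d f q Y V"
      have prox: "fst (?O x (1 / M)) \<in> Rd d"
        "prox_answer d (pnorm d p) f s (prox_tol s) (1/4) x (1 / M) (fst (?O x (1 / M))) (snd (?O x (1 / M)))"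
        if x: "x \<in> Rd d" for x
      proof -
        define h where "h = taylor_step M s q (order_oracle d f q x)"
        have O: "?O x (1 / M) = (x + h, ans_grad (if q = 1 then order_oracle d f q x else order_oracle d f (min 1 (q - 1)) (x + h)))"
          by (simp add: one_query_prox_def Y_def V_def Let_def h_def)
        note tpa = taylor_prox_answer[OF f q less_imp_le[OF L] x s(1) less_imp_le[OF sb(1)] Cq(2,1) M, of "1/4" "1 / M", folded s_def, OF _ M1, folded h_def]
        have "h \<in> Rd d" "prox_answer d (pnorm d p) f s (prox_tol s) (1/4) x (1 / M) (x + h)
            (ans_grad (if q = 1 then order_oracle d f q x else order_oracle d f (min 1 (q - 1)) (x + h)))"
          by (rule tpa; use M in simp)+
        then show "fst (?O x (1 / M)) \<in> Rd d"
          "prox_answer d (pnorm d p) f s (prox_tol s) (1/4) x (1 / M) (fst (?O x (1 / M))) (snd (?O x (1 / M)))"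
          unfolding O using x by auto
      qed
      show "\<forall>y. algorithm_A d (pnorm d p) f \<psi> \<mu> s (prox_tol s) (1/4) (\<lambda>_. 1 / M) ?O x0 T y \<longrightarrow>
               f (y T) - f xstar \<le> K * rate s p L R T"
      proof (intro allI impI)
        fix y assume "algorithm_A d (pnorm d p) f \<psi> \<mu> s (prox_tol s) (1/4) (\<lambda>_. 1 / M) ?O x0 T y"
        then obtain x z v a A where init: "z 0 = x0" "y 0 = x0" "A 0 = 0"
          and run: "\<forall>k\<in>{1..T}. a k > 0 \<and> A k = a k + A (k - 1) \<and>
          a k = (step_const \<mu> s (prox_tol s) (1/4) * A k powr (s - 1) * (1 / M)) powr (1 / s) \<and>
          x k = (A (k - 1) / A k) *\<^sub>R y (k - 1) + (a k / A k) *\<^sub>R z (k - 1) \<and>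
          (y k, v k) = ?O (x k) (1 / M) \<and>
          prox_answer d (pnorm d p) f s (prox_tol s) (1/4) (x k) (1 / M) (y k) (v k) \<and>
          mirror_step d \<psi> x0 a v k (z k)"
          unfolding algorithm_A_def by blast
        define one :: "nat \<Rightarrow> real" where "one = (\<lambda>_. 1)"
        define lam :: "nat \<Rightarrow> real" where "lam = (\<lambda>_. 1 / M)"
        have run': "\<forall>k\<in>{1..T}. accel_step d (pnorm d p) f \<psi> \<mu> s x0 x y z v lam lam a A a A one y k"
          if pos: "\<forall>k\<in>{1..T}. 0 < A k"
        proof
          fix k assume k: "k \<in> {1..T}"
          have "one k = min (lam k / lam k) 1" "a k = one k * a k" "0 < lam k" using M by (auto simp: one_def lam_def)
          moreover have "y k = ((1 - one k) * A (k - 1) / A k) *\<^sub>R y (k - 1) + (one k * A k / A k) *\<^sub>R y k"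
            using bspec[OF pos k] by (simp add: one_def)
          ultimately show "accel_step d (pnorm d p) f \<psi> \<mu> s x0 x y z v lam lam a A a A one y k"
            using bspec[OF run k] unfolding accel_step_def lam_def by blast
        qed
        have Apos: "0 \<le> A k \<and> (1 \<le> k \<longrightarrow> 0 < A k)" if "k \<le> T" for k
          using that
        proof (induction k)
          case (Suc n)
          have "Suc n \<in> {1..T}" using Suc.prems by simp
          from bspec[OF run this, unfolded diff_Suc_1] have "0 < a (Suc n)" "A (Suc n) = a (Suc n) + A n" by blast+
          then show ?case using Suc by auto
        qed (simp add: init)
        have pos: "\<forall>k\<in>{1..T}. 0 < A k" using Apos by auto
        note ab = accelerated_bound[OF s(1) \<mu> f(3) IUC x0 xs init run'[OF pos]]
        have "0 \<le> (\<Sum>k=1..T. prox_gain s * (one k * A k * pnorm d p (x k - y k) powr s / lam k))"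
        proof (rule sum_nonneg)
          fix k assume "k \<in> {1..T}"
          then have "0 < A k" using pos by blast
          then show "0 \<le> prox_gain s * (one k * A k * pnorm d p (x k - y k) powr s / lam k)"
            using prox_gain_pos[OF s(1)] M by (simp add: one_def lam_def)
        qed
        then have "A T * (f (y T) - f xstar) \<le> c * R powr m + (real T + 1) * \<delta>"
          using ab(1) breg[OF xs] xsR by (simp add: m_def)
        also have "(real T + 1) * \<delta> \<le> (2 * real T) * (R powr m / real T)"
          using \<delta> T by (intro mult_mono) auto
        also have "\<dots> = 2 * R powr m" using T by simp
        finally have up: "A T * (f (y T) - f xstar) \<le> (c + 2) * R powr m" by (simp add: distrib_right)
        have grow: "\<mu> * C1 / M * (real T / s) powr s \<le> A T"
        proof (rule constant_growth[OF s(1) _ init(3) ab(2)])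
          show "0 < \<mu> * C1 / M" using \<mu> C1 M by simp
          show "\<forall>k\<in>{1..T}. A k - A (k - 1) = (\<mu> * C1 / M * A k powr (s - 1)) powr (1 / s)"
          proof
            fix k assume "k \<in> {1..T}"
            from bspec[OF run this] have Ak: "A k = a k + A (k - 1)"
              and ak: "a k = (step_const \<mu> s (prox_tol s) (1/4) * A k powr (s - 1) * (1 / M)) powr (1 / s)"
              by blast+
            have "A k - A (k - 1) = a k" using Ak by linarith
            also have "step_const \<mu> s (prox_tol s) (1/4) * A k powr (s - 1) * (1 / M) = \<mu> * C1 / M * A k powr (s - 1)"
              by (subst step_const_scale) (simp add: C1_def)
            then have "a k = (\<mu> * C1 / M * A k powr (s - 1)) powr (1 / s)" using ak by (simp only:)
            finally show "A k - A (k - 1) = (\<mu> * C1 / M * A k powr (s - 1)) powr (1 / s)" .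
          qed
        qed
        \<comment> \<open>The powers of \<open>T\<close> cancel: \<open>\<mu>\<close> contributes
          \<open>- (m - s) / m\<close>, the growth of the weights contributes \<open>s\<close>, and
          the rate the negative of their sum.\<close>
        have "(c + 2) * R powr m = K * rate s p L R T * (\<mu> * C1 / M * (real T / s) powr s)"
        proof -
          have Rm: "R powr m = R powr s * R powr (m - s)" using R by (simp flip: powr_add)
          have Te: "real T powr (- (s + s / m - 1)) * (real T powr (- ((m - s) / m)) * real T powr s) = 1"
          proof -
            have "- (s + s / m - 1) + (- ((m - s) / m) + s) = 0" using m by (simp add: field_simps)
            then show ?thesis using T by (simp flip: powr_add)
          qed
          have \<mu>': "\<mu> = R powr (m - s) * real T powr (- ((m - s) / m))"
            using R T by (simp add: \<mu>_def \<rho>_def powr_mult powr_powr)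
          have "K * rate s p L R T * (\<mu> * C1 / M * (real T / s) powr s)
            = (K * L * C1 / M / s powr s) * (R powr s * R powr (m - s)) *
              (real T powr (- (s + s / m - 1)) * (real T powr (- ((m - s) / m)) * real T powr s))"
            using s T by (simp add: rate_eq \<mu>' powr_divide m_def[symmetric])
          also have "K * L * C1 / M / s powr s = c + 2"
            using C1 L B s by (simp add: K_def M_def)
          finally show ?thesis using Te Rm by simp
        qed
        also have "\<dots> \<le> K * rate s p L R T * A T"
          using grow K L by (intro mult_left_mono) (auto simp: rate_eq)
        finally have "A T * (f (y T) - f xstar) \<le> A T * (K * rate s p L R T)"
          using up by (simp add: mult.commute)
        moreover have "0 < A T" using pos T by simp
        ultimately show "f (y T) - f xstar \<le> K * rate s p L R T" by (simp only: mult_le_cancel_left_pos)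
      qed
      have C: "0 < step_const \<mu> s (prox_tol s) (1/4)" by (rule step_const_pos[OF s(1) \<mu>])
      have "\<exists>x yt z v lam lamh ah Ah a A \<gamma> y. accel_run d \<psi> x0 s (step_const \<mu> s (prox_tol s) (1/4))
          (\<lambda>_ x _. (fst (?O x (1 / M)), snd (?O x (1 / M)), 1 / M)) (\<lambda>_ _ _. 1 / M) (1 / M) x yt z v lam lamh ah Ah a A \<gamma> y"
        by (rule exists_run[OF s(1) C _ x0 _ _ mir]) (use prox(1) M in auto)
      then obtain x yt z v lam lamh ah Ah a A \<gamma> y where
        "accel_run d \<psi> x0 s (step_const \<mu> s (prox_tol s) (1/4))
          (\<lambda>_ x _. (fst (?O x (1 / M)), snd (?O x (1 / M)), 1 / M)) (\<lambda>_ _ _. 1 / M) (1 / M) x yt z v lam lamh ah Ah a A \<gamma> y"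
        by blast
      note run = accel_runD[OF this]
      have lamh: "lamh k = 1 / M" if "1 \<le> k" for k
        using run(4) run(18)[of "k - 1"] that by (cases "k = 1") auto
      have simp: "lam k = 1 / M" "\<gamma> k = 1" "a k = ah k" "A k = Ah k" "(yt k, v k) = ?O (x k) (1 / M)" if k: "1 \<le> k" for k
        using run(12,13,14,15,6)[OF k] lamh[OF k] M by auto
      have y: "y k = yt k" if k: "1 \<le> k" for k
      proof -
        have "0 < Ah k" using run(5,6,19)[OF k] by simp
        then show ?thesis using run(16)[OF k] simp(2,4)[OF k] by simp
      qed
      show "\<exists>y. algorithm_A d (pnorm d p) f \<psi> \<mu> s (prox_tol s) (1/4) (\<lambda>_. 1 / M) ?O x0 T y"
        unfolding algorithm_A_def
      proof (rule exI[of _ y], rule exI[of _ x], rule exI[of _ z], rule exI[of _ v], rule exI[of _ a], rule exI[of _ A],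
          intro conjI ballI)
        fix k assume "k \<in> {1..T}"
        then have k: "1 \<le> k" by simp
        show "0 < a k" using run(5)[OF k] simp(3)[OF k] by simp
        show "A k = a k + A (k - 1)" by (rule run(15)[OF k])
        show "a k = (step_const \<mu> s (prox_tol s) (1/4) * A k powr (s - 1) * (1 / M)) powr (1 / s)"
          unfolding simp(3,4)[OF k] using run(9)[OF k] lamh[OF k] by metis
        show "x k = (A (k - 1) / A k) *\<^sub>R y (k - 1) + (a k / A k) *\<^sub>R z (k - 1)"
          unfolding simp(3,4)[OF k] by (rule run(10)[OF k])
        show "(y k, v k) = ?O (x k) (1 / M)" using y[OF k] simp(5)[OF k] by simp
        show "prox_answer d (pnorm d p) f s (prox_tol s) (1/4) (x k) (1 / M) (y k) (v k)"
          using prox(2)[OF run(11)[OF k]] y[OF k] simp(5)[OF k] by (metis fst_conv snd_conv)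
        show "mirror_step d \<psi> x0 a v k (z k)" by (rule run(17)[OF k])
      qed (simp_all add: run)
    qed
    show "attained_by_A d p q \<nu> L R T x0 (K * rate (real q + \<nu>) p L R T)"
      unfolding attained_by_A_def s_def[symmetric] using adm main by blast
  qed
qed

section \<open>Rate of algorithm B for \<open>s > m\<close>\<close>

text \<open>The parameter determines the length of the step, so \<open>\<rho> powr m\<close> is a
  multiple of \<open>lam powr (- m / (s - m))\<close>. The damping \<open>lam / lamh\<close>
  replaces one factor \<open>1 / lam\<close> by \<open>1 / lamh\<close>, and
  \<open>lam \<le> lamh\<close> allows the remaining negative power to be evaluated at
  \<open>lamh\<close>.\<close>

lemma down_step_weight:
  fixes m s M Ah lam lamh \<rho> :: real
  assumes m: "1 < m" "m < s" and M: "0 < M" and Ah: "0 < Ah" and lam: "0 < lam" "lam \<le> lamh"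
    and \<rho>: "0 < \<rho>" "lam = \<rho> powr (m - s) / M" and g: "g = min (lam / lamh) 1"
  shows "Ah * lamh powr (- (s / (s - m))) \<le> M powr (m / (s - m)) * (g * Ah * \<rho> powr m / lam)"
proof -
  define e where "e = m / (s - m)"
  have e: "0 < e" "s / (s - m) = 1 + e" "(m - s) * (- e) = m" using m by (auto simp: e_def field_simps)
  have lamh: "0 < lamh" using lam by simp
  have "M * lam = \<rho> powr (m - s)" using M \<rho> by simp
  then have "(M * lam) powr (- e) = \<rho> powr m" by (simp only: powr_powr e(3))
  then have "\<rho> powr m = M powr (- e) * lam powr (- e)" by (simp add: powr_mult)
  then have \<rho>m: "M powr e * \<rho> powr m = lam powr (- e)" using M by (simp add: powr_minus)
  have "lamh powr (- (1 + e)) = lamh powr (- e) / lamh"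
  proof -
    have "- (1 + e) = - e - 1" by simp
    then show ?thesis using lamh by (metis powr_diff powr_one less_imp_le)
  qed
  then have "Ah * lamh powr (- (s / (s - m))) = Ah / lamh * lamh powr (- e)" by (simp add: e(2))
  also have "\<dots> \<le> Ah / lamh * lam powr (- e)"
    using Ah lamh lam e by (intro mult_left_mono powr_mono2') auto
  also have "\<dots> = M powr e * (g * Ah * \<rho> powr m / lam)"
    using lam lamh by (simp add: g min_def \<rho>m[symmetric])
  finally show ?thesis by (simp add: e_def)
qed

lemma adaptive_case:
  assumes q: "1 \<le> q" "0 < \<nu>" and p: "1 < p" and sm: "max 2 p < real q + \<nu>"
  shows "\<exists>K. \<forall>d L R T x0. 0 < L \<longrightarrow> 0 < R \<longrightarrow> 1 \<le> T \<longrightarrow> x0 \<in> Rd d \<longrightarrow>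
    attained_by_B d p q \<nu> L R T x0 (K * rate (real q + \<nu>) p L R T)"
proof -
  define s where "s = real q + \<nu>"
  define m where "m = max 2 p"
  have m: "1 < m" "m < s" using sm by (auto simp: m_def s_def)
  have s: "1 < s" using m by simp
  obtain Cq :: real where Cq: "0 \<le> Cq" "\<And>(b :: nat \<Rightarrow> real) M. (\<forall>t\<in>{0..1}. \<bar>\<Sum>j\<le>q. b j * t ^ j\<bar> \<le> M) \<Longrightarrow> (\<forall>j\<le>q. \<bar>b j\<bar> \<le> Cq * M)"
    using poly_coeff_bound[of q] by blast
  obtain c where c: "0 < c" "\<forall>d x0. uniformly_convex d (pnorm d p) 1 (max 2 p) (regularizer d p c x0) \<and>
    (x0 \<in> Rd d \<longrightarrow> (\<forall>z\<in>Rd d. bregman d (regularizer d p c x0) z x0 = c * pnorm d p (z - x0) powr max 2 p))"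
    using exists_regularizer[OF p] by blast
  note sb = prox_tol_bounds[OF m(1)]
  define B where "B = Cq * 2 * 2 powr s / prox_tol m + 4"
  have B: "0 < B" using Cq sb by (simp add: B_def add_nonneg_pos)
  define C where "C = step_const 1 m (prox_tol m) (1/4)"
  have C: "0 < C" unfolding C_def by (rule step_const_pos[OF m(1)]) simp
  define e where "e = m / (s - m)"
  define \<theta> where "\<theta> = s / (s - m)"
  have e: "0 < e" "(m - s) * (- e) = m" "1 - \<theta> = - e" "e * ((s - m) / m) = 1" "m * ((s - m) / m) = s - m"
    using m by (auto simp: e_def \<theta>_def field_simps)
  \<comment> \<open>The first summand comes from the potential bound on the proximal sum, the second
    covers a first step that does not move.\<close>
  define W where "W = c / prox_gain m + C"
  have W: "0 < W" using c prox_gain_pos[OF m(1)] C by (simp add: W_def add_pos_pos)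
  have "(1::real) < 2" by simp
  from adaptive_growth[OF m C this, folded \<theta>_def]
  obtain cg where cg: "0 < cg" and cg_growth: "\<forall>T (U :: nat set) A l G. 1 \<le> T \<longrightarrow> 0 < G \<longrightarrow> 1 \<in> U \<longrightarrow> A 0 = 0 \<longrightarrow>
    (\<forall>k\<in>{1..T}. 0 < l k \<and> 0 < A k \<and> A (k - 1) \<le> A k) \<longrightarrow>
    (\<forall>k\<in>{1..T} \<inter> U. A k - A (k - 1) = (C * A k powr (m - 1) * l k) powr (1 / m)) \<longrightarrow>
    (\<forall>k\<in>{1..T}. l (k + 1) = (if k \<in> U then 2 * l k else inverse 2 * l k)) \<longrightarrow>
    (\<Sum>k\<in>{1..T} - U. A k * l k powr (- \<theta>)) \<le> G \<longrightarrow>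
    A 1 * l 1 powr (- \<theta>) \<le> G \<longrightarrow>
    cg * real T powr (s + s / m - 1) * G powr (- ((s - m) / m)) \<le> A T"
    by (elim exE conjE)
  note growth = cg_growth[THEN spec, THEN spec, THEN spec, THEN spec, THEN spec, THEN mp, THEN mp, THEN mp, THEN mp,
    THEN mp, THEN mp, THEN mp, THEN mp, THEN mp]
  define K where "K = c * B / (cg * W powr (- ((s - m) / m)))"
  have K: "0 < K" using c B cg W by (simp add: K_def)
  show ?thesis
  proof (rule exI[of _ K], intro allI impI)
    fix d T :: nat and L R :: real and x0 :: pt
    assume L: "0 < L" and R: "0 < R" and T: "1 \<le> T" and x0: "x0 \<in> Rd d"
    interpret coord_norm d "pnorm d p" by (rule coord_norm_pnorm[OF p])
    define M where "M = L * B"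
    have M: "0 < M" using L B by (simp add: M_def)
    have M1: "Cq * 2 * 2 powr s * L \<le> prox_tol m * M" "L \<le> 1/4 * M"
      unfolding M_def B_def using model_weight_bounds[of "Cq * 2 * 2 powr s" L "prox_tol m"] Cq L sb by auto
    define \<psi> where "\<psi> = regularizer d p c x0"
    have UC: "uniformly_convex d (pnorm d p) 1 m \<psi>"
      and breg: "\<And>z. z \<in> Rd d \<Longrightarrow> bregman d \<psi> z x0 = c * pnorm d p (z - x0) powr max 2 p"
      using c(2) x0 unfolding \<psi>_def m_def by blast+
    have IUC: "inexact_uniformly_convex d (pnorm d p) 0 1 m \<psi>" using UC by (simp add: uniformly_convex_def)
    have mir: "\<exists>z. is_arg_min (\<lambda>z. dotp d G z + bregman d \<psi> z x0) (\<lambda>z. z \<in> Rd d) z" for G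
      by (rule exists_mirror_step[OF p c(1) x0 breg])
    \<comment> \<open>only matters if the first step does not move, that is, if \<open>x0\<close> is stationary\<close>
    define l0 where "l0 = R powr (m - s) / M"
    have l0: "0 < l0" using R M by (simp add: l0_def)
    \<comment> \<open>A step of length zero has no parameter of its own and returns the guess, so it
      counts as an increasing step.\<close>
    define \<Lambda> where "\<Lambda> h l = (if pnorm d p h = 0 then l else pnorm d p h powr (m - s) / M)" for h l
    define Y where "Y = (\<lambda>x l ans. (x + taylor_step M s q ans, \<Lambda> (taylor_step M s q ans) l))"
    define V where "V = (\<lambda>(_::pt) (_::real) ans ans'. ans_grad (if q = 1 then ans else ans'))"
    have adm: "admissible_B d (pnorm d p) \<psi> m (prox_tol m) (1/4) 2 l0"
      using UC sb l0 by (simp add: admissible_B_def)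
    have main: "(\<exists>y. algorithm_B d (pnorm d p) f \<psi> m (prox_tol m) (1/4) 2 l0 (one_query_gen_prox d f q Y V) x0 T y) \<and>
            (\<forall>y. algorithm_B d (pnorm d p) f \<psi> m (prox_tol m) (1/4) 2 l0 (one_query_gen_prox d f q Y V) x0 T y \<longrightarrow>
               f (y T) - f xstar \<le> K * rate s p L R T)"
      if prob: "smooth_convex_problem d p q \<nu> L f xstar" and xsR: "pnorm d p (xstar - x0) = R" for f xstar
    proof
      have f: "times_differentiable d q f" "holder_deriv d (pnorm d p) q L \<nu> f" "convex_on (Rd d) f"
        and xs: "xstar \<in> Rd d" and min: "\<And>z. z \<in> Rd d \<Longrightarrow> f xstar \<le> f z"
        using prob unfolding smooth_convex_problem_def is_arg_min_linorder by auto
      let ?O = "one_query_gen_prox d f q Y V"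
      define h where "h x = taylor_step M s q (order_oracle d f q x)" for x
      have O: "?O x l = (x + h x, ans_grad (if q = 1 then order_oracle d f q x else order_oracle d f (min 1 (q - 1)) (x + h x)), \<Lambda> (h x) l)" for x l
        by (simp add: one_query_gen_prox_def Y_def V_def Let_def h_def)
      have Lam: "0 < \<Lambda> w l" if "0 < l" for w l
        using that M N_ge0[of w] by (auto simp: \<Lambda>_def)
      have prox: "fst (?O x l) \<in> Rd d" "0 < snd (snd (?O x l))"
        "prox_answer d (pnorm d p) f m (prox_tol m) (1/4) x (snd (snd (?O x l))) (fst (?O x l)) (fst (snd (?O x l)))"
        if x: "x \<in> Rd d" and l: "0 < l" for x l
      proof -
        note tpa = taylor_prox_answer[OF f q less_imp_le[OF L] x m(1) less_imp_le[OF sb(1)] Cq(2,1) M, of "1/4" "\<Lambda> (h x) l", folded s_def, OF _ M1, folded h_def]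
        have "h x \<in> Rd d" "prox_answer d (pnorm d p) f m (prox_tol m) (1/4) x (\<Lambda> (h x) l) (x + h x)
            (ans_grad (if q = 1 then order_oracle d f q x else order_oracle d f (min 1 (q - 1)) (x + h x)))"
          by (rule tpa; use Lam[OF l] in \<open>simp add: \<Lambda>_def\<close>)+
        then show "fst (?O x l) \<in> Rd d" "0 < snd (snd (?O x l))"
          "prox_answer d (pnorm d p) f m (prox_tol m) (1/4) x (snd (snd (?O x l))) (fst (?O x l)) (fst (snd (?O x l)))"
          unfolding O using x Lam[OF l] by auto
      qed
      have O_lam: "lam = (if pnorm d p (x - y) = 0 then l else pnorm d p (x - y) powr (m - s) / M)"
        if "(y, v, lam) = ?O x l" for x y v l lam
      proof -
        have "y = x + h x" "lam = \<Lambda> (h x) l" using that by (auto simp: O)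
        moreover have "pnorm d p (x - (x + h x)) = pnorm d p (h x)"
          using N_minus[of "h x"] by simp
        ultimately show ?thesis by (simp add: \<Lambda>_def)
      qed
      show "\<forall>y. algorithm_B d (pnorm d p) f \<psi> m (prox_tol m) (1/4) 2 l0 ?O x0 T y \<longrightarrow>
               f (y T) - f xstar \<le> K * rate s p L R T"
      proof (intro allI impI)
        fix y assume "algorithm_B d (pnorm d p) f \<psi> m (prox_tol m) (1/4) 2 l0 ?O x0 T y"
        then obtain x yt z v lam lamh ah Ah a A \<gamma> where
          init: "z 0 = x0" "y 0 = x0" "A 0 = 0" "lamh 0 = l0"
          and one: "(yt 1, v 1, lam 1) = ?O x0 (lamh 0)" "0 < lam 1"
            "prox_answer d (pnorm d p) f m (prox_tol m) (1/4) x0 (lam 1) (yt 1) (v 1)" "lamh 1 = lam 1"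
          and run: "\<forall>k\<in>{1..T}.
          ah k > 0 \<and> Ah k = ah k + A (k - 1) \<and>
          ah k = (step_const 1 m (prox_tol m) (1/4) * Ah k powr (m - 1) * lamh k) powr (1 / m) \<and>
          x k = (A (k - 1) / Ah k) *\<^sub>R y (k - 1) + (ah k / Ah k) *\<^sub>R z (k - 1) \<and>
          (k > 1 \<longrightarrow>
             (yt k, v k, lam k) = ?O (x k) (lamh k) \<and>
             0 < lam k \<and> prox_answer d (pnorm d p) f m (prox_tol m) (1/4) (x k) (lam k) (yt k) (v k)) \<and>
          \<gamma> k = min (lam k / lamh k) 1 \<and>
          a k = \<gamma> k * ah k \<and> A k = a k + A (k - 1) \<and>
          (is_arg_min f (\<lambda>u. u \<in> {yt k, y (k - 1)}) (y k) \<or>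
           y k = ((1 - \<gamma> k) * A (k - 1) / A k) *\<^sub>R y (k - 1) + (\<gamma> k * Ah k / A k) *\<^sub>R yt k) \<and>
          mirror_step d \<psi> x0 a v k (z k) \<and>
          lamh (k + 1) = (if lamh k \<le> lam k then 2 * lamh k else inverse 2 * lamh k)"
          unfolding algorithm_B_def by blast
        have T1: "1 \<in> {1..T}" using T by simp
        have w1: "0 < ah 1" "Ah 1 = ah 1 + A (1 - 1)" "x 1 = (A (1 - 1) / Ah 1) *\<^sub>R y (1 - 1) + (ah 1 / Ah 1) *\<^sub>R z (1 - 1)"
          using bspec[OF run T1] by blast+
        \<comment> \<open>Since \<open>A 0 = 0\<close>, the extrapolated point of the first
          iteration is \<open>x0\<close>, where the initial oracle call was made; from here on the
          first iteration is treated like the others.\<close>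
        have "Ah 1 = ah 1" using w1(2) init(3) by simp
        then have x1: "x 1 = x0" using w1(1,3) init by simp
        have lamh_step: "lamh (Suc k) = (if lamh k \<le> lam k then 2 * lamh k else inverse 2 * lamh k)" if "k \<in> {1..T}" for k
          using bspec[OF run that, unfolded Suc_eq_plus1[symmetric]] by blast
        have lamh: "0 < lamh k" if "1 \<le> k" "k \<le> T" for k
          using that
        proof (induction k rule: nat_induct_at_least)
          case base
          show ?case using one by simp
        next
          case (Suc n)
          then show ?case using lamh_step[of n] by simp
        qed
        have orc: "(yt k, v k, lam k) = ?O (x k) (if k = 1 then l0 else lamh k)" "0 < lam k"
          "prox_answer d (pnorm d p) f m (prox_tol m) (1/4) (x k) (lam k) (yt k) (v k)" if k: "k \<in> {1..T}" for k
        proof -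
          have "(yt k, v k, lam k) = ?O (x k) (if k = 1 then l0 else lamh k) \<and> 0 < lam k \<and>
            prox_answer d (pnorm d p) f m (prox_tol m) (1/4) (x k) (lam k) (yt k) (v k)"
          proof (cases "k = 1")
            case True
            show ?thesis unfolding True x1 using one(1-3) unfolding init(4) by simp
          next
            case False
            then have "1 < k" using k by simp
            then have "(yt k, v k, lam k) = ?O (x k) (lamh k) \<and> 0 < lam k \<and>
              prox_answer d (pnorm d p) f m (prox_tol m) (1/4) (x k) (lam k) (yt k) (v k)"
              using bspec[OF run k] by blast
            then show ?thesis unfolding if_not_P[OF False] .
          qed
          then show "(yt k, v k, lam k) = ?O (x k) (if k = 1 then l0 else lamh k)" "0 < lam k"
            "prox_answer d (pnorm d p) f m (prox_tol m) (1/4) (x k) (lam k) (yt k) (v k)"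
            by blast+
        qed
        have run': "\<forall>k\<in>{1..T}. accel_step d (pnorm d p) f \<psi> 1 m x0 x yt z v lam lamh ah Ah a A \<gamma> y k"
        proof
          fix k assume k: "k \<in> {1..T}"
          have "0 < lamh k" using lamh k by simp
          then show "accel_step d (pnorm d p) f \<psi> 1 m x0 x yt z v lam lamh ah Ah a A \<gamma> y k"
            unfolding accel_step_def using bspec[OF run k] orc(2,3)[OF k] by blast
        qed
        note ab = accelerated_bound[OF m(1) zero_less_one f(3) IUC x0 xs init(1-3) run']
        have wt: "\<gamma> k = min (lam k / lamh k) 1" "a k = \<gamma> k * ah k" "A k = a k + A (k - 1)" "Ah k = ah k + A (k - 1)"
          "ah k = (C * Ah k powr (m - 1) * lamh k) powr (1 / m)" "0 < ah k" "0 < lamh k" "0 < A k" "A (k - 1) \<le> A k"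
          if k: "k \<in> {1..T}" for k
          using bspec[OF run' k, unfolded accel_step_def] bspec[OF ab(2) k] unfolding C_def by blast+
        have Aprev: "0 \<le> A (k - 1)" if "k \<in> {1..T}" for k
        proof (cases "k = 1")
          case False
          then have "k - 1 \<in> {1..T}" using that by auto
          from wt(8)[OF this] show ?thesis by simp
        qed (simp add: init(3))
        have \<gamma>: "0 < \<gamma> k" "\<gamma> k \<le> 1" if "k \<in> {1..T}" for k
          using wt(1,7)[OF that] orc(2)[OF that] by auto
        have Ah: "0 < Ah k" "A k \<le> Ah k" if k: "k \<in> {1..T}" for k
        proof -
          show "0 < Ah k" using wt(4,6)[OF k] Aprev[OF k] by simp
          have "\<gamma> k * ah k \<le> 1 * ah k" using \<gamma>[OF k] wt(6)[OF k] by (intro mult_right_mono) auto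
          then show "A k \<le> Ah k" using wt(2,3,4)[OF k] by simp
        qed
        define w where "w k = \<gamma> k * Ah k * pnorm d p (x k - yt k) powr m / lam k" for k
        have w0: "0 \<le> w k" if "k \<in> {1..T}" for k
          using \<gamma>[OF that] Ah[OF that] orc(2)[OF that] by (simp add: w_def)
        have "y T \<in> Rd d"
        proof -
          have "y k \<in> Rd d" if "k \<le> T" for k
            using that
          proof (induction k)
            case (Suc n)
            have k: "Suc n \<in> {1..T}" using Suc.prems by simp
            have "yt (Suc n) \<in> Rd d" using orc(3)[OF k] unfolding prox_answer_def by blast
            moreover have "y n \<in> Rd d" using Suc by simp
            moreover have "is_arg_min f (\<lambda>u. u \<in> {yt (Suc n), y n}) (y (Suc n)) \<or>
               y (Suc n) = ((1 - \<gamma> (Suc n)) * A n / A (Suc n)) *\<^sub>R y n + (\<gamma> (Suc n) * Ah (Suc n) / A (Suc n)) *\<^sub>R yt (Suc n)"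
              using bspec[OF run k, unfolded diff_Suc_1] by blast
            ultimately show ?case by (auto simp: is_arg_min_def)
          qed (simp add: init x0)
          then show ?thesis by simp
        qed
        \<comment> \<open>Nonnegativity of the gap lets the potential bound control the proximal sum
          by itself, before anything is known about the growth of \<open>A T\<close>.\<close>
        then have gap: "0 \<le> f (y T) - f xstar" using min by simp
        have AT: "0 < A T" using wt(8)[of T] T by simp
        have up: "A T * (f (y T) - f xstar) + prox_gain m * (\<Sum>k=1..T. w k) \<le> c * R powr m"
          using ab(1) breg[OF xs] xsR by (simp add: m_def w_def sum_distrib_left)
        have sum_w: "(\<Sum>k=1..T. w k) \<le> c / prox_gain m * R powr m"
        proof -
          have "0 \<le> A T * (f (y T) - f xstar)" using gap AT by simp
          then have "prox_gain m * (\<Sum>k=1..T. w k) \<le> c * R powr m" using up by linarith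
          then show ?thesis using prox_gain_pos[OF m(1)] by (simp add: field_simps)
        qed
        define G where "G = M powr e * (R powr m * W)"
        have G: "0 < G" using M R W by (simp add: G_def)
        have part: "M powr e * (c / prox_gain m * R powr m) \<le> G" "M powr e * (C * R powr m) \<le> G"
          using M R C c prox_gain_pos[OF m(1)] by (simp_all add: G_def W_def algebra_simps)
        define U where "U = {k. lamh k \<le> lam k}"
        have down: "A k * lamh k powr (- \<theta>) \<le> M powr e * w k"
          if k: "k \<in> {1..T}" and le: "lam k \<le> lamh k" and N: "pnorm d p (x k - yt k) \<noteq> 0" for k
        proof -
          have "lam k = pnorm d p (x k - yt k) powr (m - s) / M" using O_lam[OF orc(1)[OF k]] N by simp
          moreover have "0 < pnorm d p (x k - yt k)" using N N_ge0[of "x k - yt k"] by linarith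
          ultimately have "Ah k * lamh k powr (- \<theta>) \<le> M powr e * w k"
            unfolding \<theta>_def e_def w_def
            using down_step_weight[OF m M Ah(1)[OF k] orc(2)[OF k] le _ _ wt(1)[OF k]] by simp
          moreover have "A k * lamh k powr (- \<theta>) \<le> Ah k * lamh k powr (- \<theta>)"
            using Ah[OF k] by (intro mult_right_mono) auto
          ultimately show ?thesis by linarith
        qed
        have "cg * real T powr (s + s / m - 1) * G powr (- ((s - m) / m)) \<le> A T"
        proof (rule growth[of T G U A lamh, OF T G])
          show "1 \<in> U" using one(4) by (simp add: U_def)
          show "A 0 = 0" by (rule init(3))
          show "\<forall>k\<in>{1..T}. 0 < lamh k \<and> 0 < A k \<and> A (k - 1) \<le> A k" using wt by blast
          show "\<forall>k\<in>{1..T} \<inter> U. A k - A (k - 1) = (C * A k powr (m - 1) * lamh k) powr (1 / m)"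
          proof
            fix k assume "k \<in> {1..T} \<inter> U"
            then have k: "k \<in> {1..T}" "lamh k \<le> lam k" by (auto simp: U_def)
            then have "\<gamma> k = 1" using wt(1,7)[OF k(1)] by simp
            then have "a k = ah k" "A k = Ah k" using wt(2,3,4)[OF k(1)] by simp_all
            then show "A k - A (k - 1) = (C * A k powr (m - 1) * lamh k) powr (1 / m)"
              using wt(3,5)[OF k(1)] by simp
          qed
          show "\<forall>k\<in>{1..T}. lamh (k + 1) = (if k \<in> U then 2 * lamh k else inverse 2 * lamh k)"
            using lamh_step by (simp add: U_def)
          have "(\<Sum>k\<in>{1..T} - U. A k * lamh k powr (- \<theta>)) \<le> (\<Sum>k\<in>{1..T} - U. M powr e * w k)"
          proof (rule sum_mono)
            fix k assume "k \<in> {1..T} - U"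
            then have k: "k \<in> {1..T}" "lam k < lamh k" by (auto simp: U_def)
            \<comment> \<open>A step that does not move cannot lower the guess: it returns the guess
              for \<open>k > 1\<close>, and for \<open>k = 1\<close> the guess is set to the
              returned parameter.\<close>
            have "pnorm d p (x k - yt k) \<noteq> 0"
            proof
              assume "pnorm d p (x k - yt k) = 0"
              then have "lam k = (if k = 1 then l0 else lamh k)" using O_lam[OF orc(1)[OF k(1)]] by simp
              then show False using k one(4) by (cases "k = 1") auto
            qed
            then show "A k * lamh k powr (- \<theta>) \<le> M powr e * w k" using down k by simp
          qed
          also have "\<dots> \<le> (\<Sum>k=1..T. M powr e * w k)"
            using w0 by (intro sum_mono2) auto
          also have "\<dots> \<le> M powr e * (c / prox_gain m * R powr m)"
            unfolding sum_distrib_left[symmetric] using sum_w by (intro mult_left_mono) auto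
          finally show "(\<Sum>k\<in>{1..T} - U. A k * lamh k powr (- \<theta>)) \<le> G" using part by linarith
          show "A 1 * lamh 1 powr (- \<theta>) \<le> G"
          proof (cases "pnorm d p (x 1 - yt 1) = 0")
            case False
            have "A 1 * lamh 1 powr (- \<theta>) \<le> M powr e * w 1"
              using down[OF T1 _ False] one(4) by simp
            also have "w 1 \<le> (\<Sum>k=1..T. w k)" using w0 T1 by (intro member_le_sum) auto
            then have "M powr e * w 1 \<le> M powr e * (c / prox_gain m * R powr m)"
              using sum_w by (intro mult_left_mono) auto
            finally show ?thesis using part by linarith
          next
            case True
            \<comment> \<open>\<open>l0\<close> is the parameter that a step of length
              \<open>R\<close> would have. The first term is then
              \<open>C * M powr e * R powr m\<close>, which has the order of
              \<open>G\<close>.\<close>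
            then have l1: "lamh 1 = l0" using O_lam[OF orc(1)[OF T1]] one(4) by simp
            have "\<gamma> 1 = 1" using wt(1,7)[OF T1] one(4) by simp
            then have A1: "A 1 = ah 1" "Ah 1 = A 1" using wt(2,3,4)[OF T1] init(3) by simp_all
            have "A 1 = (C * A 1 powr (m - 1) * lamh 1) powr (1 / m)"
              using wt(5)[OF T1] unfolding A1(2) A1(1)[symmetric] .
            then have "A 1 = C * lamh 1"
              by (rule weight_from_zero[OF m(1) wt(8)[OF T1] C wt(7)[OF T1]])
            then have "A 1 * lamh 1 powr (- \<theta>) = C * (l0 * l0 powr (- \<theta>))" by (simp only: l1 mult.assoc)
            also have "l0 * l0 powr (- \<theta>) = l0 powr (- e)"
              using l0 e(3) by (simp add: powr_mult_base)
            also have "l0 powr (- e) = R powr m * M powr e"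
            proof -
              have "l0 powr (- e) = (R powr (m - s)) powr (- e) / M powr (- e)"
                unfolding l0_def using M R by (subst powr_divide) auto
              also have "(R powr (m - s)) powr (- e) = R powr m" by (simp only: powr_powr e(2))
              finally show ?thesis by (simp add: powr_minus divide_inverse)
            qed
            finally show ?thesis using part by (simp add: mult_ac)
          qed
        qed
        moreover have "G powr (- ((s - m) / m)) = R powr (- (s - m)) * W powr (- ((s - m) / m)) / M"
        proof -
          have "e * (- ((s - m) / m)) = - 1" "m * (- ((s - m) / m)) = - (s - m)" using e(4,5) by simp_all
          then have "(M powr e) powr (- ((s - m) / m)) = M powr (- 1)"
            "(R powr m) powr (- ((s - m) / m)) = R powr (- (s - m))" by (simp_all only: powr_powr)
          moreover have "M powr (- 1) = 1 / M" using M by (simp add: powr_minus_divide)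
          ultimately have "G powr (- ((s - m) / m)) = 1 / M * (R powr (- (s - m)) * W powr (- ((s - m) / m)))"
            unfolding G_def powr_mult by (simp only:)
          then show ?thesis by simp
        qed
        ultimately have grow: "cg * real T powr (s + s / m - 1) * (R powr (- (s - m)) * W powr (- ((s - m) / m)) / M) \<le> A T"
          by (simp only:)
        have "c * R powr m = K * rate s p L R T * (cg * real T powr (s + s / m - 1) * (R powr (- (s - m)) * W powr (- ((s - m) / m)) / M))"
        proof -
          have Rm: "R powr m = R powr s * R powr (- (s - m))" using R by (simp flip: powr_add)
          have Te: "real T powr (- (s + s / m - 1)) * real T powr (s + s / m - 1) = 1"
            using T by (simp flip: powr_add)
          have "K * rate s p L R T * (cg * real T powr (s + s / m - 1) * (R powr (- (s - m)) * W powr (- ((s - m) / m)) / M))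
            = (K * L * cg * W powr (- ((s - m) / m)) / M) * (R powr s * R powr (- (s - m))) *
              (real T powr (- (s + s / m - 1)) * real T powr (s + s / m - 1))"
            by (simp add: rate_eq m_def[symmetric])
          also have "K * L * cg * W powr (- ((s - m) / m)) / M = c"
            using cg L B W by (simp add: K_def M_def)
          finally show ?thesis using Te Rm by simp
        qed
        also have "\<dots> \<le> K * rate s p L R T * A T"
          using grow K L by (intro mult_left_mono) (auto simp: rate_eq)
        finally have "c * R powr m \<le> A T * (K * rate s p L R T)" by (simp add: mult.commute)
        moreover have "0 \<le> prox_gain m * (\<Sum>k=1..T. w k)"
          using prox_gain_pos[OF m(1)] w0 by (intro mult_nonneg_nonneg sum_nonneg) auto
        ultimately have "A T * (f (y T) - f xstar) \<le> A T * (K * rate s p L R T)" using up by linarith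
        then show "f (y T) - f xstar \<le> K * rate s p L R T" using AT by (simp only: mult_le_cancel_left_pos)
      qed
      \<comment> \<open>The first call receives \<open>l0\<close>, whereas the first guess entering
        the weights is \<open>l1\<close>, the parameter returned by that call.\<close>
      define Orc where "Orc = (\<lambda>(k::nat) x l. ?O x (if k = 1 then l0 else l))"
      define upd where "upd = (\<lambda>(k::nat) (l::real) lm. if l \<le> lm then 2 * l else inverse 2 * l)"
      define l1 where "l1 = snd (snd (?O x0 l0))"
      have l1: "0 < l1" unfolding l1_def by (rule prox(2)[OF x0 l0])
      have "\<exists>x yt z v lam lamh ah Ah a A \<gamma> y. accel_run d \<psi> x0 m C Orc upd l1 x yt z v lam lamh ah Ah a A \<gamma> y"
        by (rule exists_run[OF m(1) C l1 x0 _ _ mir]) (use prox(1,2) l0 in \<open>auto simp: Orc_def upd_def\<close>)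
      then obtain x yt z v lam lamh ah Ah a A \<gamma> y where
        "accel_run d \<psi> x0 m C Orc upd l1 x yt z v lam lamh ah Ah a A \<gamma> y" by blast
      note run = accel_runD[OF this]
      \<comment> \<open>The guesses of the run start at index \<open>1\<close>; index
        \<open>0\<close> has to carry the initial value.\<close>
      define lamh' where "lamh' = lamh(0 := l0)"
      have lamh': "lamh' k = lamh k" if "1 \<le> k" for k using that by (simp add: lamh'_def)
      have orc: "(yt k, v k, lam k) = ?O (x k) (if k = 1 then l0 else lamh k)" if "1 \<le> k" for k
        using run(12)[OF that] by (simp add: Orc_def)
      have prox_k: "prox_answer d (pnorm d p) f m (prox_tol m) (1/4) (x k) (lam k) (yt k) (v k)" if k: "1 \<le> k" for k
      proof -
        have "0 < (if k = 1 then l0 else lamh k)" using l0 run(8)[OF k] by simp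
        from prox(3)[OF run(11)[OF k] this] show ?thesis
          using orc[OF k] by (metis fst_conv snd_conv)
      qed
      have x1: "x 1 = x0"
        using run(10)[of 1] run(5,6)[of 1] run(1,2,3) by simp
      have lam1: "lam 1 = l1" using orc[of 1] x1 unfolding l1_def by (metis order.refl snd_conv)
      show "\<exists>y. algorithm_B d (pnorm d p) f \<psi> m (prox_tol m) (1/4) 2 l0 ?O x0 T y"
        unfolding algorithm_B_def
      proof (rule exI[of _ y], rule exI[of _ x], rule exI[of _ yt], rule exI[of _ z], rule exI[of _ v], rule exI[of _ lam],
          rule exI[of _ lamh'], rule exI[of _ ah], rule exI[of _ Ah], rule exI[of _ a], rule exI[of _ A], rule exI[of _ \<gamma>],
          intro conjI ballI impI)
        show "lamh' 0 = l0" by (simp add: lamh'_def)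
        show "(yt 1, v 1, lam 1) = ?O x0 (lamh' 0)" using orc[of 1] x1 by (simp add: lamh'_def)
        show "0 < lam 1" by (rule run(7)) simp
        show "prox_answer d (pnorm d p) f m (prox_tol m) (1/4) x0 (lam 1) (yt 1) (v 1)"
          using prox_k[of 1] unfolding x1 by simp
        show "lamh' 1 = lam 1" using run(4) lam1 lamh'[of 1] by simp
        fix k assume "k \<in> {1..T}"
        then have k: "1 \<le> k" by simp
        show "0 < ah k" by (rule run(5)[OF k])
        show "Ah k = ah k + A (k - 1)" by (rule run(6)[OF k])
        show "ah k = (step_const 1 m (prox_tol m) (1/4) * Ah k powr (m - 1) * lamh' k) powr (1 / m)"
          unfolding lamh'[OF k] C_def[symmetric] by (rule run(9)[OF k])
        show "x k = (A (k - 1) / Ah k) *\<^sub>R y (k - 1) + (ah k / Ah k) *\<^sub>R z (k - 1)" by (rule run(10)[OF k])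
        show "\<gamma> k = min (lam k / lamh' k) 1" unfolding lamh'[OF k] by (rule run(13)[OF k])
        show "a k = \<gamma> k * ah k" by (rule run(14)[OF k])
        show "A k = a k + A (k - 1)" by (rule run(15)[OF k])
        show "is_arg_min f (\<lambda>u. u \<in> {yt k, y (k - 1)}) (y k) \<or>
           y k = ((1 - \<gamma> k) * A (k - 1) / A k) *\<^sub>R y (k - 1) + (\<gamma> k * Ah k / A k) *\<^sub>R yt k"
          by (rule disjI2[OF run(16)[OF k]])
        show "mirror_step d \<psi> x0 a v k (z k)" by (rule run(17)[OF k])
        show "lamh' (k + 1) = (if lamh' k \<le> lam k then 2 * lamh' k else inverse 2 * lamh' k)"
          using run(18)[OF k] lamh'[OF k] lamh'[of "k + 1"] by (simp add: upd_def)
        show "0 < lam k" by (rule run(7)[OF k])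
        show "prox_answer d (pnorm d p) f m (prox_tol m) (1/4) (x k) (lam k) (yt k) (v k)" by (rule prox_k[OF k])
        assume "1 < k"
        then show "(yt k, v k, lam k) = ?O (x k) (lamh' k)" using orc[OF k] lamh'[OF k] by simp
      qed (simp_all add: run)
    qed
    show "attained_by_B d p q \<nu> L R T x0 (K * rate (real q + \<nu>) p L R T)"
      unfolding attained_by_B_def s_def[symmetric] using adm main by blast
  qed
qed

section \<open>Both regimes and the choice of the constant\<close>

lemma rate_for_fixed_order:
  assumes q: "1 \<le> q" "0 < \<nu>" and p: "1 < p"
  shows "\<exists>K. \<forall>d L R T x0. 0 < L \<longrightarrow> 0 \<le> R \<longrightarrow> 1 \<le> T \<longrightarrow> x0 \<in> Rd d \<longrightarrow>
    attained_by_A d p q \<nu> L R T x0 (K * rate (real q + \<nu>) p L R T) \<or>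
    attained_by_B d p q \<nu> L R T x0 (K * rate (real q + \<nu>) p L R T)"
proof -
  obtain K where K: "\<And>d L R T x0. 0 < L \<Longrightarrow> 0 < R \<Longrightarrow> 1 \<le> T \<Longrightarrow> x0 \<in> Rd d \<Longrightarrow>
    attained_by_A d p q \<nu> L R T x0 (K * rate (real q + \<nu>) p L R T) \<or>
    attained_by_B d p q \<nu> L R T x0 (K * rate (real q + \<nu>) p L R T)"
    using nonadaptive_case[OF q p] adaptive_case[OF q p] by (meson not_le)
  have "attained_by_A d p q \<nu> L R T x0 (K * rate (real q + \<nu>) p L R T) \<or>
    attained_by_B d p q \<nu> L R T x0 (K * rate (real q + \<nu>) p L R T)"
    if "0 < L" "0 \<le> R" "1 \<le> T" "x0 \<in> Rd d" for d L R T x0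
    using K[of L R T x0 d] problem_at_center[OF p, of x0 d L] that by (cases "R = 0") auto
  then show ?thesis by blast
qed

theorem theorem10:
  shows "\<exists>K :: real \<Rightarrow> real \<Rightarrow> real.
    \<forall>(q::nat) (\<nu>::real) (p::real) (d::nat) (L::real) (R::real) (T::nat) (x0::pt).
      1 \<le> q \<longrightarrow> 0 < \<nu> \<longrightarrow> \<nu> \<le> 1 \<longrightarrow> 1 < p \<longrightarrow> 1 \<le> d \<longrightarrow> 0 < L \<longrightarrow> 0 \<le> R \<longrightarrow> 1 \<le> T \<longrightarrow> x0 \<in> Rd d \<longrightarrow>
      (\<exists>\<psi> \<delta> \<mu> r \<sigma> \<sigma>' lam Y V.
         admissible_A d (pnorm d p) \<psi> \<delta> \<mu> r \<sigma> \<sigma>' lam \<and>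
         (\<forall>f xstar. smooth_convex_problem d p q \<nu> L f xstar \<longrightarrow> pnorm d p (xstar - x0) = R \<longrightarrow>
            (\<exists>y. algorithm_A d (pnorm d p) f \<psi> \<mu> r \<sigma> \<sigma>' lam (one_query_prox d f q Y V) x0 T y) \<and>
            (\<forall>y. algorithm_A d (pnorm d p) f \<psi> \<mu> r \<sigma> \<sigma>' lam (one_query_prox d f q Y V) x0 T y \<longrightarrow>
               f (y T) - f xstar \<le> K (real q + \<nu>) p * rate (real q + \<nu>) p L R T)))
      \<or>
      (\<exists>\<psi> r \<sigma> \<sigma>' \<alpha> lamh0 Y V.
         admissible_B d (pnorm d p) \<psi> r \<sigma> \<sigma>' \<alpha> lamh0 \<and>
         (\<forall>f xstar. smooth_convex_problem d p q \<nu> L f xstar \<longrightarrow> pnorm d p (xstar - x0) = R \<longrightarrow>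
            (\<exists>y. algorithm_B d (pnorm d p) f \<psi> r \<sigma> \<sigma>' \<alpha> lamh0 (one_query_gen_prox d f q Y V) x0 T y) \<and>
            (\<forall>y. algorithm_B d (pnorm d p) f \<psi> r \<sigma> \<sigma>' \<alpha> lamh0 (one_query_gen_prox d f q Y V) x0 T y \<longrightarrow>
               f (y T) - f xstar \<le> K (real q + \<nu>) p * rate (real q + \<nu>) p L R T)))"
proof -
  define holds where "holds q \<nu> p k \<longleftrightarrow> (\<forall>d L R T x0. 0 < L \<longrightarrow> 0 \<le> R \<longrightarrow> 1 \<le> T \<longrightarrow> x0 \<in> Rd d \<longrightarrow>
    attained_by_A d p q \<nu> L R T x0 (k * rate (real q + \<nu>) p L R T) \<or>
    attained_by_B d p q \<nu> L R T x0 (k * rate (real q + \<nu>) p L R T))" for q \<nu> p k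
  \<comment> \<open>The constant may depend on \<open>q\<close> and \<open>\<nu>\<close> only
    through their sum. As \<open>0 < \<nu> \<le> 1\<close>, the sum determines \<open>q\<close> as
    its ceiling minus one, and then \<open>\<nu>\<close>.\<close>
  define order :: "real \<Rightarrow> nat" where "order s = nat (\<lceil>s\<rceil> - 1)" for s
  define K where "K s p = (SOME k. holds (order s) (s - real (order s)) p k)" for s p
  have "holds q \<nu> p (K (real q + \<nu>) p)" if "1 \<le> q" "0 < \<nu>" "\<nu> \<le> 1" "1 < p" for q \<nu> p
  proof -
    have "\<lceil>real q + \<nu>\<rceil> = int q + 1" using that by (simp add: ceiling_eq_iff)
    then have "order (real q + \<nu>) = q" by (simp add: order_def)
    then have "K (real q + \<nu>) p = (SOME k. holds q \<nu> p k)" by (simp add: K_def)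
    moreover have "\<exists>k. holds q \<nu> p k" unfolding holds_def by (rule rate_for_fixed_order[OF that(1,2,4)])
    ultimately show ?thesis by (simp only: someI_ex)
  qed
  then have "attained_by_A d p q \<nu> L R T x0 (K (real q + \<nu>) p * rate (real q + \<nu>) p L R T) \<or>
    attained_by_B d p q \<nu> L R T x0 (K (real q + \<nu>) p * rate (real q + \<nu>) p L R T)"
    if "1 \<le> q" "0 < \<nu>" "\<nu> \<le> 1" "1 < p" "0 < L" "0 \<le> R" "1 \<le> T" "x0 \<in> Rd d" for q \<nu> p d L R T x0
    using that unfolding holds_def by blast
  then show ?thesis
    unfolding attained_by_A_def[symmetric] attained_by_B_def[symmetric] by (intro exI[of _ K] allI impI)
qed

end
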